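(* Let $(M^n,g)$ be a Riemannian manifold and suppose that there is a sequence $\{m_i\}\subset\mathbb{R}$ with $m_i\to\infty$ such that the weighted Weyl tractors $W_i^W$ of the smooth metric measure spaces $(M^n,g,1^{m_i}\mathrm{dvol})$ (that is, $v=1$ and $m=m_i$) with characteristic constant $\mu=-\frac12$ are nonnegative. Then $$B(\alpha,\alpha)-2\langle d\mathrm{Ric},\Phi\otimes\alpha\rangle+\mathrm{Rm}(\Phi,\Phi)\ge0$$ for all $\alpha\in T^*M$ and $\Phi\in\Lambda^2T^*M$, where $$B=\Delta\mathrm{Ric}-\tfrac12\nabla^2R+2\langle\mathrm{Rm},\mathrm{Ric}\rangle-\mathrm{Ric}^2+\tfrac12\mathrm{Ric}.$$
   Context: Riemannian conventions ($n\ge 2$). $\mathrm{Rm}(x,y)w=-\nabla_x\nabla_yw+\nabla_y\nabla_xw+\nabla_{[x,y]}w$, $\mathrm{Rm}(x,y,w,z)=\langle \mathrm{Rm}(x,y)w,z\rangle$, so $\mathrm{Ric}(y,z)=\sum_i\mathrm{Rm}(e_i,y,e_i,z)$ for an orthonormal basis $\{e_i\}$ (round spheres have $\mathrm{Rm}(\Phi,\Phi)>0$). $\mathrm{Rm}(\Phi,\Phi)=\frac14\sum\mathrm{Rm}(e_i,e_j,e_k,e_l)\Phi(e_i,e_j)\Phi(e_k,e_l)$, $d\mathrm{Ric}(x,y,z)=\nabla_x\mathrm{Ric}(y,z)-\nabla_y\mathrm{Ric}(x,z)$, $\langle d\mathrm{Ric},\Phi\otimes\alpha\rangle=\frac12\sum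 d\mathrm{Ric}(e_i,e_j,e_k)\Phi(e_i,e_j)\alpha(e_k)$, $\langle\mathrm{Rm},T\rangle(x,y)=\sum_{i,j}\mathrm{Rm}(e_i,x,e_j,y)T(e_i,e_j)$, $\mathrm{Ric}^2(x,y)=\sum_i\mathrm{Ric}(x,e_i)\mathrm{Ric}(e_i,y)$, $R$ is the scalar curvature. For symmetric 2-tensors, $h\wedge k$ is the Kulkarni–Nomizu product $(h\wedge k)(x,y,w,z)=h(x,w)k(y,z)+h(y,z)k(x,w)-h(x,z)k(y,w)-h(y,w)k(x,z)$; $dT(x,y,z)=\nabla_xT(y,z)-\nabla_yT(x,z)$. Weighted objects. A smooth metric measure space $(M^n,g,v^m\mathrm{dvol}_g)$ with characteristic constant $\mu$ is a Riemannian manifold with a positive function $v$, a parameter $m$ (standing assumption $m\notin\{-n,1-n,2-n\}$) and a constant $\mu\in\mathbb{R}$; $v^m=e^{-\phi}$. Put $\mathrm{Ric}_\phi^m=\mathrm{Ric}-mv^{-1}\nabla^2v$, $R_\phi^m=R-2mv^{-1}\Delta v-m(m-1)v^{-2}|\nabla v|^2$, $\mathrm{J}^W=\frac{R_\phi^m+m\mu v^{-2}}{2(m+n-1)}$, $P^W=\frac{1}{m+n-2}(\mathrm{Ric}_\phi^m-\mathrm{J}^Wg)$, $A^W=\mathrm{Rm}-P^W\wedge g$. Tractors (in the scale $g$). $\mathcal{T}=\mathbb{R}\oplus TM\oplus\mathbb{R}\ni(\sigma,\omega,\rho)$ with metric $\langle I,I\rangle=2\sigma\rho+|\omega|^2$;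 $X$, $Z(\omega)$, $Y$ denote the elements with only nonzero component $\rho=1$, $\omega$, $\sigma=1$ respectively. $\mathcal{A}=\Lambda^2\mathcal{T}$, identified with 2-forms on $\mathcal{T}$ by the tractor metric; $(I_1\wedge I_2)(S,T)=\langle I_1,S\rangle\langle I_2,T\rangle-\langle I_1,T\rangle\langle I_2,S\rangle$. Let $J=(v,\nabla v,-\frac1n(\Delta v+\frac{R}{2(n-1)}v))$ and $\tilde J=J+\frac{(m+2n-2)(\mu-(m-1)|J|^2)}{2(m+n-1)(m+n-2)v}X$. The connection $\nabla^W(\sigma,\omega,\rho)=(\nabla\sigma-\omega,\ \nabla\omega+\sigma P^W+\rho g,\ \nabla\rho-P^W(\omega))$ on $\mathcal{T}$ has curvature $\mathcal{R}^W(x,y)=-\nabla^W_x\nabla^W_y+\nabla^W_y\nabla^W_x+\nabla^W_{[x,y]}$, a section of $\Lambda^2T^*M\otimes\mathcal{A}$ via $\mathcal{R}^W(x,y)(I_1,I_2)=\langle\mathcal{R}^W(x,y)I_1,I_2\rangle$; $\delta_\phi^W\mathcal{R}^W(x)=\sum_i(\nabla^W_{e_i}\mathcal{R}^W)(e_i,x)-\mathcal{R}^W(\nabla\phi,x)$. The weighted Weyl tractor $W^W\in\mathcal{A}\otimes\mathcal{A}$ (of weight $-2$; a scale-independent section with Riemann curvature tensor symmetries) is determined by $W^W(Z(e),Z(f),\cdot,\cdot)=(m+n-4)\mathcal{R}^W(e,f)$, $W^W(Y,Z(e),\cdot,\cdot)=-\delta^W_\phi\mathcal{R}^W(e)+mv^{-2}(\nabla^W_e\tilde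 J)\wedge\tilde J$, $W^W(X,\cdot,\cdot,\cdot)=0$. It is nonnegative if $W^W(T,T)\ge0$ for all $T\in\mathcal{A}$, where $W^W(\cdot,\cdot)$ is the induced symmetric bilinear form on $\mathcal{A}=\Lambda^2\mathcal{T}$ (with $W^W(I_1\wedge I_2,I_3\wedge I_4)=W^W(I_1,I_2,I_3,I_4)$). *)

theory Defs
  imports "HOL-Analysis.Analysis"
begin

section \<open>Smooth and Riemannian manifolds\<close>

text \<open>
  \<open>\<partial> f p x\<close> is the derivative of \<open>f\<close> at the point \<open>p\<close> in the direction \<open>x\<close>.  \<open>C_k_on\<close> is
  only meant for open sets.
\<close>

abbreviation dirder :: "('a::real_normed_vector \<Rightarrow> 'b::real_normed_vector) \<Rightarrow> 'a \<Rightarrow> 'a \<Rightarrow> 'b" ("\<partial>") where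
  "\<partial> f p x \<equiv> frechet_derivative f (at p) x"

primrec C_k_on :: "nat \<Rightarrow> 'a::euclidean_space set \<Rightarrow> ('a \<Rightarrow> 'b::real_normed_vector) \<Rightarrow> bool" where
  "C_k_on 0 S f \<longleftrightarrow> continuous_on S f"
| "C_k_on (Suc k) S f \<longleftrightarrow> f differentiable_on S \<and> (\<forall>x. C_k_on k S (\<lambda>p. \<partial> f p x))"

definition smooth_on :: "'a::euclidean_space set \<Rightarrow> ('a \<Rightarrow> 'b::real_normed_vector) \<Rightarrow> bool" where
  "smooth_on S f \<longleftrightarrow> (\<forall>k. C_k_on k S f)"

type_synonym ('a, 'n) chart = "'a set \<times> ('a \<Rightarrow> real^'n)"

definition smooth_atlas :: "'a topology \<Rightarrow> ('a, 'n::finite) chart set \<Rightarrow> bool" where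
  "smooth_atlas M \<A> \<longleftrightarrow>
     (\<forall>(U, \<xi>)\<in>\<A>. openin M U \<and> open (\<xi> ` U) \<and>
        homeomorphic_map (subtopology M U) (top_of_set (\<xi> ` U)) \<xi>) \<and>
     (\<Union>(U, \<xi>)\<in>\<A>. U) = topspace M \<and>
     (\<forall>(U, \<xi>)\<in>\<A>. \<forall>(V, \<eta>)\<in>\<A>. smooth_on (\<xi> ` (U \<inter> V)) (\<eta> \<circ> inv_into U \<xi>))"

text \<open>
  In a chart a Riemannian metric is a field of positive definite matrices on an open subset
  of Euclidean space.
\<close>

type_synonym 'n metric = "real^'n \<Rightarrow> real^'n^'n"

definition ip :: "'n::finite metric \<Rightarrow> real^'n \<Rightarrow> real^'n \<Rightarrow> real^'n \<Rightarrow> real" where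
  "ip g p x y = x \<bullet> (g p *v y)"

text \<open>
  A tensor field on a manifold is given by its local expressions in all charts of the atlas;
  the last conjunct is the transformation law under a change of charts.
\<close>

definition riemannian_manifold ::
  "'a topology \<Rightarrow> ('a, 'n::finite) chart set \<Rightarrow> (('a, 'n) chart \<Rightarrow> 'n metric) \<Rightarrow> bool" where
  "riemannian_manifold M \<A> g \<longleftrightarrow>
     Hausdorff_space M \<and> second_countable M \<and> smooth_atlas M \<A> \<and>
     (\<forall>(U, \<xi>)\<in>\<A>. smooth_on (\<xi> ` U) (g (U, \<xi>)) \<and>
        (\<forall>p\<in>\<xi> ` U. (\<forall>x y. ip (g (U, \<xi>)) p x y = ip (g (U, \<xi>)) p y x) \<and>
                   (\<forall>x. x \<noteq> 0 \<longrightarrow> 0 < ip (g (U, \<xi>)) p x x))) \<and>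
     (\<forall>(U, \<xi>)\<in>\<A>. \<forall>(V, \<eta>)\<in>\<A>. \<forall>p\<in>\<xi> ` (U \<inter> V). \<forall>x y.
        ip (g (U, \<xi>)) p x y =
        ip (g (V, \<eta>)) (\<eta> (inv_into U \<xi> p))
          (\<partial> (\<eta> \<circ> inv_into U \<xi>) p x) (\<partial> (\<eta> \<circ> inv_into U \<xi>) p y))"

section \<open>Riemannian geometry in a chart\<close>

text \<open>
  Vectors at \<open>p\<close> are elements of \<open>real^'n\<close>, covariant tensors at \<open>p\<close> are multilinear functions
  of vectors.  \<open>contract g p T\<close> is the sum of \<open>T (e\<^sub>i) (e\<^sub>i)\<close> over an orthonormal basis at \<open>p\<close>
  (lemma \<open>contract_orthonormal\<close>), written in the coordinate basis.
\<close>

definition contract :: "'n::finite metric \<Rightarrow> real^'n \<Rightarrow> (real^'n \<Rightarrow> real^'n \<Rightarrow> real) \<Rightarrow> real" where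
  "contract g p T =
     (\<Sum>i\<in>UNIV. \<Sum>j\<in>UNIV. matrix_inv (g p) $ i $ j * T (axis i 1) (axis j 1))"

definition sharp :: "'n::finite metric \<Rightarrow> real^'n \<Rightarrow> (real^'n \<Rightarrow> real) \<Rightarrow> real^'n" where
  "sharp g p \<alpha> = matrix_inv (g p) *v (\<chi> i. \<alpha> (axis i 1))"

definition christoffel :: "'n::finite metric \<Rightarrow> real^'n \<Rightarrow> real^'n \<Rightarrow> real^'n \<Rightarrow> real^'n" where
  "christoffel g p x y = sharp g p (\<lambda>z.
     (\<partial> (\<lambda>q. ip g q y z) p x + \<partial> (\<lambda>q. ip g q x z) p y - \<partial> (\<lambda>q. ip g q x y) p z) / 2)"

text \<open>
  The Levi-Civita connection on vector fields (functions of the point), and on covariant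
  tensor fields of rank 1, 2 and 3; in the latter the first vector argument is the direction of
  differentiation.
\<close>

definition cov_vec ::
  "'n::finite metric \<Rightarrow> (real^'n \<Rightarrow> real^'n) \<Rightarrow> (real^'n \<Rightarrow> real^'n) \<Rightarrow> real^'n \<Rightarrow> real^'n" where
  "cov_vec g X Y p = \<partial> Y p (X p) + christoffel g p (X p) (Y p)"

definition lie_bracket ::
  "(real^'n::finite \<Rightarrow> real^'n) \<Rightarrow> (real^'n \<Rightarrow> real^'n) \<Rightarrow> real^'n \<Rightarrow> real^'n" where
  "lie_bracket X Y p = \<partial> Y p (X p) - \<partial> X p (Y p)"

definition cov1 ::
  "'n::finite metric \<Rightarrow> (real^'n \<Rightarrow> real^'n \<Rightarrow> real) \<Rightarrow> real^'n \<Rightarrow> real^'n \<Rightarrow> real^'n \<Rightarrow> real" where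
  "cov1 g T p x y = \<partial> (\<lambda>q. T q y) p x - T p (christoffel g p x y)"

definition cov2 ::
  "'n::finite metric \<Rightarrow> (real^'n \<Rightarrow> real^'n \<Rightarrow> real^'n \<Rightarrow> real) \<Rightarrow>
   real^'n \<Rightarrow> real^'n \<Rightarrow> real^'n \<Rightarrow> real^'n \<Rightarrow> real" where
  "cov2 g T p x y z =
     \<partial> (\<lambda>q. T q y z) p x - T p (christoffel g p x y) z - T p y (christoffel g p x z)"

definition cov3 ::
  "'n::finite metric \<Rightarrow> (real^'n \<Rightarrow> real^'n \<Rightarrow> real^'n \<Rightarrow> real^'n \<Rightarrow> real) \<Rightarrow>
   real^'n \<Rightarrow> real^'n \<Rightarrow> real^'n \<Rightarrow> real^'n \<Rightarrow> real^'n \<Rightarrow> real" where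
  "cov3 g T p x y z w =
     \<partial> (\<lambda>q. T q y z w) p x - T p (christoffel g p x y) z w
       - T p y (christoffel g p x z) w - T p y z (christoffel g p x w)"

definition grad :: "'n::finite metric \<Rightarrow> (real^'n \<Rightarrow> real) \<Rightarrow> real^'n \<Rightarrow> real^'n" where
  "grad g f p = sharp g p (\<partial> f p)"

definition hess :: "'n::finite metric \<Rightarrow> (real^'n \<Rightarrow> real) \<Rightarrow> real^'n \<Rightarrow> real^'n \<Rightarrow> real^'n \<Rightarrow> real" where
  "hess g f = cov1 g (\<partial> f)"

definition laplacian :: "'n::finite metric \<Rightarrow> (real^'n \<Rightarrow> real) \<Rightarrow> real^'n \<Rightarrow> real" where
  "laplacian g f p = contract g p (hess g f p)"

definition laplacian2 ::
  "'n::finite metric \<Rightarrow> (real^'n \<Rightarrow> real^'n \<Rightarrow> real^'n \<Rightarrow> real) \<Rightarrow>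
   real^'n \<Rightarrow> real^'n \<Rightarrow> real^'n \<Rightarrow> real" where
  "laplacian2 g T p x y = contract g p (\<lambda>a b. cov3 g (cov2 g T) p a b x y)"

text \<open>
  \<open>riem_field\<close> is the curvature operator applied to vector fields; the curvature tensor is its
  value on constant vector fields.  The sign makes the curvature of round spheres positive on
  2-forms.
\<close>

definition riem_field ::
  "'n::finite metric \<Rightarrow> (real^'n \<Rightarrow> real^'n) \<Rightarrow> (real^'n \<Rightarrow> real^'n) \<Rightarrow> (real^'n \<Rightarrow> real^'n) \<Rightarrow>
   real^'n \<Rightarrow> real^'n" where
  "riem_field g X Y W p =
     - cov_vec g X (cov_vec g Y W) p + cov_vec g Y (cov_vec g X W) p
     + cov_vec g (lie_bracket X Y) W p"

definition riem ::
  "'n::finite metric \<Rightarrow> real^'n \<Rightarrow> real^'n \<Rightarrow> real^'n \<Rightarrow> real^'n \<Rightarrow> real^'n \<Rightarrow> real" where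
  "riem g p x y w z = ip g p (riem_field g (\<lambda>_. x) (\<lambda>_. y) (\<lambda>_. w) p) z"

definition ricci :: "'n::finite metric \<Rightarrow> real^'n \<Rightarrow> real^'n \<Rightarrow> real^'n \<Rightarrow> real" where
  "ricci g p y z = contract g p (\<lambda>a b. riem g p a y b z)"

definition scal :: "'n::finite metric \<Rightarrow> real^'n \<Rightarrow> real" where
  "scal g p = contract g p (ricci g p)"

definition d_ricci :: "'n::finite metric \<Rightarrow> real^'n \<Rightarrow> real^'n \<Rightarrow> real^'n \<Rightarrow> real^'n \<Rightarrow> real" where
  "d_ricci g p x y z = cov2 g (ricci g) p x y z - cov2 g (ricci g) p y x z"

definition riem_pair ::
  "'n::finite metric \<Rightarrow> (real^'n \<Rightarrow> real^'n \<Rightarrow> real^'n \<Rightarrow> real) \<Rightarrow>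
   real^'n \<Rightarrow> real^'n \<Rightarrow> real^'n \<Rightarrow> real" where
  "riem_pair g T p x y =
     contract g p (\<lambda>a a'. contract g p (\<lambda>b b'. riem g p a x b y * T p a' b'))"

definition ricci_sq :: "'n::finite metric \<Rightarrow> real^'n \<Rightarrow> real^'n \<Rightarrow> real^'n \<Rightarrow> real" where
  "ricci_sq g p x y = contract g p (\<lambda>a b. ricci g p x a * ricci g p b y)"

text \<open>
  \<open>B\<close>, and the terms of the quadratic form, for a covector \<open>\<alpha>\<close> and a 2-form \<open>\<Phi>\<close> at \<open>p\<close>.
\<close>

definition B_tensor :: "'n::finite metric \<Rightarrow> real^'n \<Rightarrow> real^'n \<Rightarrow> real^'n \<Rightarrow> real" where
  "B_tensor g p x y =
     laplacian2 g (ricci g) p x y - 1/2 * hess g (scal g) p x y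
     + 2 * riem_pair g (ricci g) p x y - ricci_sq g p x y + 1/2 * ricci g p x y"

definition eval_covectors ::
  "'n::finite metric \<Rightarrow> real^'n \<Rightarrow> (real^'n \<Rightarrow> real^'n \<Rightarrow> real) \<Rightarrow>
   (real^'n \<Rightarrow> real) \<Rightarrow> (real^'n \<Rightarrow> real) \<Rightarrow> real" where
  "eval_covectors g p T \<alpha> \<beta> = T (sharp g p \<alpha>) (sharp g p \<beta>)"

definition two_form :: "(real^'n::finite \<Rightarrow> real^'n \<Rightarrow> real) \<Rightarrow> bool" where
  "two_form \<Phi> \<longleftrightarrow> bilinear \<Phi> \<and> (\<forall>x y. \<Phi> x y = - \<Phi> y x)"

definition d_ricci_pair ::
  "'n::finite metric \<Rightarrow> real^'n \<Rightarrow> (real^'n \<Rightarrow> real^'n \<Rightarrow> real) \<Rightarrow> (real^'n \<Rightarrow> real) \<Rightarrow> real" where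
  "d_ricci_pair g p \<Phi> \<alpha> =
     1/2 * contract g p (\<lambda>a a'. contract g p (\<lambda>b b'. contract g p (\<lambda>c c'.
       d_ricci g p a b c * \<Phi> a' b' * \<alpha> c')))"

definition riem_two_forms ::
  "'n::finite metric \<Rightarrow> real^'n \<Rightarrow> (real^'n \<Rightarrow> real^'n \<Rightarrow> real) \<Rightarrow>
   (real^'n \<Rightarrow> real^'n \<Rightarrow> real) \<Rightarrow> real" where
  "riem_two_forms g p \<Phi> \<Psi> =
     1/4 * contract g p (\<lambda>a a'. contract g p (\<lambda>b b'. contract g p (\<lambda>c c'. contract g p (\<lambda>d d'.
       riem g p a b c d * \<Phi> a' b' * \<Psi> c' d'))))"

section \<open>Weighted objects in a chart\<close>

definition ricci_w ::
  "'n::finite metric \<Rightarrow> (real^'n \<Rightarrow> real) \<Rightarrow> real \<Rightarrow> real^'n \<Rightarrow> real^'n \<Rightarrow> real^'n \<Rightarrow> real" where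
  "ricci_w g v m p x y = ricci g p x y - m / v p * hess g v p x y"

definition scal_w :: "'n::finite metric \<Rightarrow> (real^'n \<Rightarrow> real) \<Rightarrow> real \<Rightarrow> real^'n \<Rightarrow> real" where
  "scal_w g v m p =
     scal g p - 2 * m / v p * laplacian g v p
     - m * (m - 1) / (v p)\<^sup>2 * ip g p (grad g v p) (grad g v p)"

definition J_w :: "'n::finite metric \<Rightarrow> (real^'n \<Rightarrow> real) \<Rightarrow> real \<Rightarrow> real \<Rightarrow> real^'n \<Rightarrow> real" where
  "J_w g v m \<mu> p = (scal_w g v m p + m * \<mu> / (v p)\<^sup>2) / (2 * (m + real CARD('n) - 1))"

definition P_w ::
  "'n::finite metric \<Rightarrow> (real^'n \<Rightarrow> real) \<Rightarrow> real \<Rightarrow> real \<Rightarrow> real^'n \<Rightarrow> real^'n \<Rightarrow> real^'n \<Rightarrow> real" where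
  "P_w g v m \<mu> p x y =
     (ricci_w g v m p x y - J_w g v m \<mu> p * ip g p x y) / (m + real CARD('n) - 2)"

section \<open>Tractors in a chart, in the scale \<open>g\<close>\<close>

text \<open>The components of a tractor are \<open>(\<sigma>, \<omega>, \<rho>)\<close>.\<close>

type_synonym 'n tractor = "real \<times> (real^'n) \<times> real"

definition tr_X :: "'n::finite tractor" where "tr_X = (0, 0, 1)"
definition tr_Z :: "real^'n \<Rightarrow> 'n::finite tractor" where "tr_Z x = (0, x, 0)"
definition tr_Y :: "'n::finite tractor" where "tr_Y = (1, 0, 0)"

definition tip :: "'n::finite metric \<Rightarrow> real^'n \<Rightarrow> 'n tractor \<Rightarrow> 'n tractor \<Rightarrow> real" where
  "tip g p = (\<lambda>(\<sigma>, \<omega>, \<rho>) (\<sigma>', \<omega>', \<rho>'). \<sigma> * \<rho>' + \<rho> * \<sigma>' + ip g p \<omega> \<omega>')"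

definition twedge ::
  "'n::finite metric \<Rightarrow> real^'n \<Rightarrow> 'n tractor \<Rightarrow> 'n tractor \<Rightarrow> 'n tractor \<Rightarrow> 'n tractor \<Rightarrow> real" where
  "twedge g p I1 I2 S T = tip g p I1 S * tip g p I2 T - tip g p I1 T * tip g p I2 S"

text \<open>
  The derivative of the section \<open>I\<close> of the tractor bundle along the vector field \<open>X\<close>, for the
  connection determined by the symmetric 2-tensor field \<open>P\<close>.
\<close>

definition tcov ::
  "'n::finite metric \<Rightarrow> (real^'n \<Rightarrow> real^'n \<Rightarrow> real^'n \<Rightarrow> real) \<Rightarrow>
   (real^'n \<Rightarrow> real^'n) \<Rightarrow> (real^'n \<Rightarrow> 'n tractor) \<Rightarrow> real^'n \<Rightarrow> 'n tractor" where
  "tcov g P X I p =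
     (let \<sigma> = (\<lambda>q. fst (I q)); \<omega> = (\<lambda>q. fst (snd (I q))); \<rho> = (\<lambda>q. snd (snd (I q)))
      in (\<partial> \<sigma> p (X p) - ip g p (\<omega> p) (X p),
          cov_vec g X \<omega> p + \<sigma> p *\<^sub>R sharp g p (P p (X p)) + \<rho> p *\<^sub>R X p,
          \<partial> \<rho> p (X p) - P p (X p) (\<omega> p)))"

definition tcurv_field ::
  "'n::finite metric \<Rightarrow> (real^'n \<Rightarrow> real^'n \<Rightarrow> real^'n \<Rightarrow> real) \<Rightarrow>
   (real^'n \<Rightarrow> real^'n) \<Rightarrow> (real^'n \<Rightarrow> real^'n) \<Rightarrow> (real^'n \<Rightarrow> 'n tractor) \<Rightarrow> real^'n \<Rightarrow> 'n tractor"
  where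
  "tcurv_field g P X Y I p =
     - tcov g P X (tcov g P Y I) p + tcov g P Y (tcov g P X I) p
     + tcov g P (lie_bracket X Y) I p"

definition tcurv ::
  "'n::finite metric \<Rightarrow> (real^'n \<Rightarrow> real^'n \<Rightarrow> real^'n \<Rightarrow> real) \<Rightarrow>
   real^'n \<Rightarrow> real^'n \<Rightarrow> real^'n \<Rightarrow> 'n tractor \<Rightarrow> 'n tractor \<Rightarrow> real" where
  "tcurv g P p x y I1 I2 = tip g p (tcurv_field g P (\<lambda>_. x) (\<lambda>_. y) (\<lambda>_. I1) p) I2"

text \<open>
  The covariant derivative of the curvature in the direction \<open>w\<close>, coupling the tractor
  connection with the Levi-Civita connection.
\<close>

definition tcurv_cov ::
  "'n::finite metric \<Rightarrow> (real^'n \<Rightarrow> real^'n \<Rightarrow> real^'n \<Rightarrow> real) \<Rightarrow>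
   real^'n \<Rightarrow> real^'n \<Rightarrow> real^'n \<Rightarrow> real^'n \<Rightarrow> 'n tractor \<Rightarrow> 'n tractor \<Rightarrow> real" where
  "tcurv_cov g P p w x y I1 I2 =
     \<partial> (\<lambda>q. tcurv g P q x y I1 I2) p w
     - tcurv g P p (christoffel g p w x) y I1 I2 - tcurv g P p x (christoffel g p w y) I1 I2
     - tcurv g P p x y (tcov g P (\<lambda>_. w) (\<lambda>_. I1) p) I2
     - tcurv g P p x y I1 (tcov g P (\<lambda>_. w) (\<lambda>_. I2) p)"

definition tcurv_div ::
  "'n::finite metric \<Rightarrow> (real^'n \<Rightarrow> real^'n \<Rightarrow> real^'n \<Rightarrow> real) \<Rightarrow> (real^'n \<Rightarrow> real) \<Rightarrow>
   real^'n \<Rightarrow> real^'n \<Rightarrow> 'n tractor \<Rightarrow> 'n tractor \<Rightarrow> real" where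
  "tcurv_div g P \<phi> p x I1 I2 =
     contract g p (\<lambda>a b. tcurv_cov g P p a b x I1 I2) - tcurv g P p (grad g \<phi> p) x I1 I2"

definition tr_J :: "'n::finite metric \<Rightarrow> (real^'n \<Rightarrow> real) \<Rightarrow> real^'n \<Rightarrow> 'n tractor" where
  "tr_J g v p =
     (v p, grad g v p,
      - (1 / real CARD('n)) * (laplacian g v p + scal g p / (2 * (real CARD('n) - 1)) * v p))"

definition tr_Jt :: "'n::finite metric \<Rightarrow> (real^'n \<Rightarrow> real) \<Rightarrow> real \<Rightarrow> real \<Rightarrow> real^'n \<Rightarrow> 'n tractor" where
  "tr_Jt g v m \<mu> p =
     tr_J g v p +
     ((m + 2 * real CARD('n) - 2) * (\<mu> - (m - 1) * tip g p (tr_J g v p) (tr_J g v p)) /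
      (2 * (m + real CARD('n) - 1) * (m + real CARD('n) - 2) * v p)) *\<^sub>R tr_X"

text \<open>
  The values \<open>W (Z e) (Z f) \<cdot> \<cdot>\<close> and \<open>W Y (Z e) \<cdot> \<cdot>\<close> of the weighted Weyl tractor; since \<open>W\<close> is
  skew in its first two arguments and \<open>W X \<cdot> \<cdot> \<cdot> = 0\<close>, they determine it
  (lemma \<open>weighted_weyl_values\<close>).  The density \<open>v\<^sup>m = exp (- \<phi>)\<close> gives \<open>\<phi> = - m * ln v\<close>.
\<close>

definition weyl_ZZ ::
  "'n::finite metric \<Rightarrow> (real^'n \<Rightarrow> real) \<Rightarrow> real \<Rightarrow> real \<Rightarrow> real^'n \<Rightarrow> real^'n \<Rightarrow> real^'n \<Rightarrow>
   'n tractor \<Rightarrow> 'n tractor \<Rightarrow> real" where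
  "weyl_ZZ g v m \<mu> p x y S T =
     (m + real CARD('n) - 4) * tcurv g (P_w g v m \<mu>) p x y S T"

definition weyl_YZ ::
  "'n::finite metric \<Rightarrow> (real^'n \<Rightarrow> real) \<Rightarrow> real \<Rightarrow> real \<Rightarrow> real^'n \<Rightarrow> real^'n \<Rightarrow>
   'n tractor \<Rightarrow> 'n tractor \<Rightarrow> real" where
  "weyl_YZ g v m \<mu> p x S T =
     - tcurv_div g (P_w g v m \<mu>) (\<lambda>q. - m * ln (v q)) p x S T
     + m / (v p)\<^sup>2 *
       twedge g p (tcov g (P_w g v m \<mu>) (\<lambda>_. x) (tr_Jt g v m \<mu>) p) (tr_Jt g v m \<mu> p) S T"

definition weighted_weyl ::
  "'n::finite metric \<Rightarrow> (real^'n \<Rightarrow> real) \<Rightarrow> real \<Rightarrow> real \<Rightarrow> real^'n \<Rightarrow>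
   'n tractor \<Rightarrow> 'n tractor \<Rightarrow> 'n tractor \<Rightarrow> 'n tractor \<Rightarrow> real" where
  "weighted_weyl g v m \<mu> p = (\<lambda>(\<sigma>1, \<omega>1, \<rho>1) (\<sigma>2, \<omega>2, \<rho>2) S T.
     weyl_ZZ g v m \<mu> p \<omega>1 \<omega>2 S T
     + \<sigma>1 * weyl_YZ g v m \<mu> p \<omega>2 S T - \<sigma>2 * weyl_YZ g v m \<mu> p \<omega>1 S T)"

text \<open>
  An element of \<open>\<Lambda>\<^sup>2\<close> of the tractor bundle is \<open>\<Sum> T A B (A \<and> B) / 2\<close>, the sum being over the
  standard basis \<open>Basis\<close> of the fibre; it is represented by its coefficients \<open>T A B\<close>,
  for \<open>A\<close>, \<open>B\<close> in \<open>Basis\<close>, which are skew.  The induced bilinear form is characterized by lemma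
  \<open>on_bivectors_wedge\<close>.
\<close>

definition bivector :: "('n::finite tractor \<Rightarrow> 'n tractor \<Rightarrow> real) \<Rightarrow> bool" where
  "bivector T \<longleftrightarrow> (\<forall>A\<in>Basis. \<forall>B\<in>Basis. T A B = - T B A)"

definition bivector_wedge :: "'n::finite tractor \<Rightarrow> 'n tractor \<Rightarrow> 'n tractor \<Rightarrow> 'n tractor \<Rightarrow> real" where
  "bivector_wedge I1 I2 A B = (I1 \<bullet> A) * (I2 \<bullet> B) - (I1 \<bullet> B) * (I2 \<bullet> A)"

definition on_bivectors ::
  "('n::finite tractor \<Rightarrow> 'n tractor \<Rightarrow> 'n tractor \<Rightarrow> 'n tractor \<Rightarrow> real) \<Rightarrow>
   ('n tractor \<Rightarrow> 'n tractor \<Rightarrow> real) \<Rightarrow> ('n tractor \<Rightarrow> 'n tractor \<Rightarrow> real) \<Rightarrow> real" where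
  "on_bivectors W S T =
     1/4 * (\<Sum>A\<in>Basis. \<Sum>B\<in>Basis. \<Sum>C\<in>Basis. \<Sum>D\<in>Basis. S A B * T C D * W A B C D)"

section \<open>Smooth metric measure spaces\<close>

text \<open>Functions on the manifold are pulled back to the charts.\<close>

definition smooth_metric_measure_space ::
  "'a topology \<Rightarrow> ('a, 'n::finite) chart set \<Rightarrow> (('a, 'n) chart \<Rightarrow> 'n metric) \<Rightarrow>
   ('a \<Rightarrow> real) \<Rightarrow> real \<Rightarrow> bool" where
  "smooth_metric_measure_space M \<A> g v m \<longleftrightarrow>
     riemannian_manifold M \<A> g \<and>
     (\<forall>x\<in>topspace M. 0 < v x) \<and> (\<forall>(U, \<xi>)\<in>\<A>. smooth_on (\<xi> ` U) (v \<circ> inv_into U \<xi>)) \<and>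
     m \<notin> {- real CARD('n), 1 - real CARD('n), 2 - real CARD('n)}"

definition weighted_weyl_nonneg ::
  "('a, 'n::finite) chart set \<Rightarrow> (('a, 'n) chart \<Rightarrow> 'n metric) \<Rightarrow>
   ('a \<Rightarrow> real) \<Rightarrow> real \<Rightarrow> real \<Rightarrow> bool" where
  "weighted_weyl_nonneg \<A> g v m \<mu> \<longleftrightarrow>
     (\<forall>(U, \<xi>)\<in>\<A>. \<forall>p\<in>\<xi> ` U. \<forall>T. bivector T \<longrightarrow>
        0 \<le> on_bivectors (weighted_weyl (g (U, \<xi>)) (v \<circ> inv_into U \<xi>) m \<mu> p) T T)"

section \<open>Consistency of the definitions\<close>

lemma posdef_invertible:
  fixes g :: "'n::finite metric"
  assumes "\<And>x. x \<noteq> 0 \<Longrightarrow> 0 < ip g p x x"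
  shows "invertible (g p)"
proof -
  have "x = 0" if "g p *v x = 0" for x
    using assms[of x] that by (auto simp: ip_def)
  then show ?thesis
    by (simp add: invertible_left_inverse matrix_left_invertible_ker)
qed

lemma matrix_inv_inverse:
  assumes "invertible A"
  shows "A ** matrix_inv A = mat 1" and "matrix_inv A ** A = mat 1"
  using someI_ex[OF assms[unfolded invertible_def]] by (simp_all add: matrix_inv_def)

lemma ip_sharp:
  fixes g :: "'n::finite metric"
  assumes sym: "\<And>x y. ip g p x y = ip g p y x" and pos: "\<And>x. x \<noteq> 0 \<Longrightarrow> 0 < ip g p x x"
    and lin: "linear \<alpha>"
  shows "ip g p (sharp g p \<alpha>) x = \<alpha> x"
proof -
  have inv: "g p ** matrix_inv (g p) = mat 1"
    using matrix_inv_inverse(1)[OF posdef_invertible[OF pos]] .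
  have "ip g p (sharp g p \<alpha>) x = x \<bullet> (g p *v sharp g p \<alpha>)"
    using sym by (simp add: ip_def)
  also have "\<dots> = x \<bullet> (\<chi> i. \<alpha> (axis i 1))"
    by (simp add: sharp_def matrix_vector_mul_assoc inv)
  also have "\<dots> = \<alpha> (\<Sum>i\<in>UNIV. x $ i *\<^sub>R axis i 1)"
    by (simp add: inner_vec_def linear_sum[OF lin] linear_cmul[OF lin])
  also have "\<dots> = \<alpha> x"
    by (simp add: basis_expansion flip: scalar_mult_eq_scaleR)
  finally show ?thesis .
qed

lemma contract_orthonormal:
  fixes g :: "'n::finite metric" and e :: "'n \<Rightarrow> real^'n"
  assumes sym: "\<And>x y. ip g p x y = ip g p y x" and pos: "\<And>x. x \<noteq> 0 \<Longrightarrow> 0 < ip g p x x"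
    and bil: "bilinear T"
    and orth: "\<And>i j. ip g p (e i) (e j) = (if i = j then 1 else 0)"
  shows "contract g p T = (\<Sum>i\<in>UNIV. T (e i) (e i))"
proof -
  define E where "E = (\<chi> i j. e j $ i)"
  have col: "column j E = e j" for j
    by (simp add: E_def column_def vec_eq_iff)
  have "transpose E ** (g p ** E) = mat 1"
    unfolding vec_eq_iff
  proof (intro allI)
    fix i j
    have "(transpose E ** (g p ** E)) $ i $ j = e i \<bullet> (g p *v e j)"
      by (simp add: matrix_matrix_mult_def transpose_def E_def matrix_vector_mult_def inner_vec_def)
    then show "(transpose E ** (g p ** E)) $ i $ j = (mat 1 :: real^'n^'n) $ i $ j"
      using orth[of i j] by (simp add: ip_def mat_def)
  qed
  then have "(g p ** E) ** transpose E = mat 1"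
    using matrix_left_right_inverse by blast
  then have "g p ** (E ** transpose E) = mat 1"
    by (simp add: matrix_mul_assoc)
  moreover have "matrix_inv (g p) ** g p = mat 1"
    using matrix_inv_inverse(2)[OF posdef_invertible[OF pos]] .
  ultimately have inv: "matrix_inv (g p) = E ** transpose E"
    by (metis matrix_mul_assoc matrix_mul_lid matrix_mul_rid)
  have exp: "e k = (\<Sum>i\<in>UNIV. e k $ i *\<^sub>R axis i 1)" for k
    by (simp add: basis_expansion flip: scalar_mult_eq_scaleR)
  have T: "T (e k) (e k) = (\<Sum>i\<in>UNIV. \<Sum>j\<in>UNIV. e k $ i * e k $ j * T (axis i 1) (axis j 1))" for k
  proof -
    have l1: "linear (\<lambda>x. T x y)" and l2: "linear (T x)" for x y
      using bil by (auto simp: bilinear_def)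
    have "T (e k) (e k) = T (\<Sum>i\<in>UNIV. e k $ i *\<^sub>R axis i 1) (\<Sum>j\<in>UNIV. e k $ j *\<^sub>R axis j 1)"
      using exp[of k] by simp
    also have "\<dots> = (\<Sum>i\<in>UNIV. e k $ i * T (axis i 1) (\<Sum>j\<in>UNIV. e k $ j *\<^sub>R axis j 1))"
      by (simp only: linear_sum[OF l1] linear_cmul[OF l1] real_scaleR_def)
    also have "\<dots> = (\<Sum>i\<in>UNIV. \<Sum>j\<in>UNIV. e k $ i * e k $ j * T (axis i 1) (axis j 1))"
      by (simp only: linear_sum[OF l2] linear_cmul[OF l2] real_scaleR_def sum_distrib_left mult.assoc)
    finally show ?thesis .
  qed
  have "contract g p T = (\<Sum>i\<in>UNIV. \<Sum>j\<in>UNIV. \<Sum>k\<in>UNIV. e k $ i * e k $ j * T (axis i 1) (axis j 1))"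
    by (simp add: contract_def inv matrix_matrix_mult_def transpose_def E_def sum_distrib_right)
  also have "\<dots> = (\<Sum>i\<in>UNIV. \<Sum>k\<in>UNIV. \<Sum>j\<in>UNIV. e k $ i * e k $ j * T (axis i 1) (axis j 1))"
    by (intro sum.cong refl sum.swap)
  also have "\<dots> = (\<Sum>k\<in>UNIV. \<Sum>i\<in>UNIV. \<Sum>j\<in>UNIV. e k $ i * e k $ j * T (axis i 1) (axis j 1))"
    by (rule sum.swap)
  finally show ?thesis by (simp add: T)
qed

lemma differentiable_ip:
  fixes g :: "'n::finite metric"
  assumes "g differentiable at p"
  shows "(\<lambda>q. ip g q x y) differentiable at p"
proof -
  have eq: "(\<lambda>q. ip g q x y) = (\<lambda>h. ip (\<lambda>_. h) p x y) \<circ> g"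
    by (auto simp: ip_def)
  have "linear (\<lambda>h. ip (\<lambda>_. h) p x y)"
    by (rule linearI) (simp_all add: ip_def matrix_vector_mult_add_rdistrib inner_add_right
        scaleR_matrix_vector_assoc[symmetric])
  then have "(\<lambda>h. ip (\<lambda>_. h) p x y) differentiable at (g p)"
    by (intro linear_imp_differentiable)
  with assms show ?thesis
    unfolding eq by (intro differentiable_chain_at)
qed

text \<open>The connection is the Levi-Civita connection: it is torsion-free and metric.\<close>

lemma levi_civita:
  fixes g :: "'n::finite metric"
  assumes sym: "\<And>q x y. q \<in> U \<Longrightarrow> ip g q x y = ip g q y x"
    and pos: "\<And>x. x \<noteq> 0 \<Longrightarrow> 0 < ip g p x x"
    and diff: "g differentiable at p" and U: "open U" "p \<in> U"
  shows "christoffel g p x y = christoffel g p y x" and "cov2 g (ip g) p x y z = 0"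
proof -
  have psym: "\<And>x y. ip g p x y = ip g p y x"
    using sym U by blast
  have dsym: "\<partial> (\<lambda>q. ip g q a b) p = \<partial> (\<lambda>q. ip g q b a) p" for a b
  proof -
    have "((\<lambda>q. ip g q b a) has_derivative \<partial> (\<lambda>q. ip g q b a) p) (at p)"
      using differentiable_ip[OF diff] frechet_derivative_works by blast
    then have "((\<lambda>q. ip g q a b) has_derivative \<partial> (\<lambda>q. ip g q b a) p) (at p)"
      by (rule has_derivative_transform_within_open[OF _ U]) (use sym in auto)
    then show ?thesis
      by (simp add: frechet_derivative_at[symmetric])
  qed
  show "christoffel g p x y = christoffel g p y x"
    unfolding christoffel_def by (simp add: dsym[of x y] add.commute)
  have dlin: "linear (\<partial> (\<lambda>q. ip g q a b) p)" for a b
    using linear_frechet_derivative[OF differentiable_ip[OF diff]] .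
  have D: "((\<lambda>q. ip g q a b) has_derivative \<partial> (\<lambda>q. ip g q a b) p) (at p)" for a b
    using differentiable_ip[OF diff] frechet_derivative_works by blast
  have d2lin: "linear (\<lambda>c. \<partial> (\<lambda>q. ip g q a c) p b)" for a b
  proof (rule linearI)
    fix c d and r :: real
    have "((\<lambda>q. ip g q a (c + d)) has_derivative
        (\<lambda>w. \<partial> (\<lambda>q. ip g q a c) p w + \<partial> (\<lambda>q. ip g q a d) p w)) (at p)"
      using has_derivative_add[OF D[of a c] D[of a d]]
      by (simp add: ip_def matrix_vector_right_distrib inner_add_right)
    from frechet_derivative_at[OF this, symmetric]
    show "\<partial> (\<lambda>q. ip g q a (c + d)) p b = \<partial> (\<lambda>q. ip g q a c) p b + \<partial> (\<lambda>q. ip g q a d) p b"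
      by simp
    have "((\<lambda>q. ip g q a (r *\<^sub>R c)) has_derivative (\<lambda>w. r *\<^sub>R \<partial> (\<lambda>q. ip g q a c) p w)) (at p)"
      using has_derivative_scaleR_right[OF D[of a c], of r]
      by (simp add: ip_def matrix_vector_mult_scaleR)
    from frechet_derivative_at[OF this, symmetric]
    show "\<partial> (\<lambda>q. ip g q a (r *\<^sub>R c)) p b = r *\<^sub>R \<partial> (\<lambda>q. ip g q a c) p b"
      by simp
  qed
  have koszul: "ip g p (christoffel g p a b) c =
    (\<partial> (\<lambda>q. ip g q b c) p a + \<partial> (\<lambda>q. ip g q a c) p b - \<partial> (\<lambda>q. ip g q a b) p c) / 2" for a b c
    unfolding christoffel_def
  proof (rule ip_sharp[OF psym pos])
    show "linear (\<lambda>z. (\<partial> (\<lambda>q. ip g q b z) p a + \<partial> (\<lambda>q. ip g q a z) p b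
                       - \<partial> (\<lambda>q. ip g q a b) p z) / 2)"
      by (rule linearI)
        (simp_all add: linear_add[OF dlin] linear_cmul[OF dlin] linear_add[OF d2lin]
          linear_cmul[OF d2lin] field_simps)
  qed
  show "cov2 g (ip g) p x y z = 0"
    unfolding cov2_def koszul psym[of y "christoffel g p x z"] by (simp add: dsym[of y x] dsym[of z x] dsym[of z y] field_simps)
qed

text \<open>The curvature and its divergence are tensorial, so the hypotheses below hold for smooth data.\<close>

lemma weighted_weyl_values:
  fixes g :: "'n::finite metric"
  assumes "\<And>S T. bilinear (\<lambda>x y. weyl_ZZ g v m \<mu> p x y S T)"
    and "\<And>S T. linear (\<lambda>x. weyl_YZ g v m \<mu> p x S T)"
  shows "weighted_weyl g v m \<mu> p (tr_Z x) (tr_Z y) S T = weyl_ZZ g v m \<mu> p x y S T"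
    and "weighted_weyl g v m \<mu> p tr_Y (tr_Z x) S T = weyl_YZ g v m \<mu> p x S T"
    and "weighted_weyl g v m \<mu> p tr_X I S T = 0"
  using bilinear_lzero[OF assms(1)] linear_0[OF assms(2)]
  by (auto simp: weighted_weyl_def tr_X_def tr_Y_def tr_Z_def split: prod.split)

lemma on_bivectors_wedge:
  fixes W :: "'n::finite tractor \<Rightarrow> 'n tractor \<Rightarrow> 'n tractor \<Rightarrow> 'n tractor \<Rightarrow> real"
  assumes skew: "\<And>A B C D. W A B C D = - W B A C D" "\<And>A B C D. W A B C D = - W A B D C"
    and lin: "\<And>B C D. linear (\<lambda>A. W A B C D)" "\<And>A B D. linear (\<lambda>C. W A B C D)"
  shows "on_bivectors W (bivector_wedge I1 I2) (bivector_wedge I3 I4) = W I1 I2 I3 I4"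
proof -
  have lin': "linear (\<lambda>B. W A B C D)" "linear (\<lambda>D. W A B C D)" for A B C D
  proof -
    have "linear (\<lambda>B. - W B A C D)" "linear (\<lambda>D. - W A B D C)"
      by (rule linear_compose_neg, rule lin)+
    moreover have "(\<lambda>B. W A B C D) = (\<lambda>B. - W B A C D)" "(\<lambda>D. W A B C D) = (\<lambda>D. - W A B D C)"
      by (rule ext, rule skew)+
    ultimately show "linear (\<lambda>B. W A B C D)" "linear (\<lambda>D. W A B C D)"
      by (simp_all only:)
  qed
  have exp: "(\<Sum>A\<in>Basis. (I \<bullet> A) * f A) = f I" if "linear f" for f :: "'n tractor \<Rightarrow> real" and I
    using linear_sum[OF that, of "\<lambda>A. (I \<bullet> A) *\<^sub>R A" Basis]
    by (simp add: linear_cmul[OF that] euclidean_representation)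
  have two: "(\<Sum>C\<in>Basis. \<Sum>D\<in>Basis. bivector_wedge J1 J2 C D * F C D) = 2 * F J1 J2"
    if l: "\<And>D. linear (\<lambda>C. F C D)" "\<And>C. linear (F C)" and s: "\<And>C D. F C D = - F D C"
    for F :: "'n tractor \<Rightarrow> 'n tractor \<Rightarrow> real" and J1 J2
  proof -
    have "(\<Sum>C\<in>Basis. \<Sum>D\<in>Basis. bivector_wedge J1 J2 C D * F C D) =
      (\<Sum>C\<in>Basis. (J1 \<bullet> C) * (\<Sum>D\<in>Basis. (J2 \<bullet> D) * F C D)) -
      (\<Sum>C\<in>Basis. (J2 \<bullet> C) * (\<Sum>D\<in>Basis. (J1 \<bullet> D) * F C D))"
      by (simp add: bivector_wedge_def sum_subtractf sum_distrib_left algebra_simps)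
    also have "\<dots> = F J1 J2 - F J2 J1"
      by (simp add: exp[OF l(2)] exp[OF l(1)])
    finally show ?thesis
      using s[of J2 J1] by simp
  qed
  have "on_bivectors W (bivector_wedge I1 I2) (bivector_wedge I3 I4) =
    1/4 * (\<Sum>A\<in>Basis. \<Sum>B\<in>Basis. bivector_wedge I1 I2 A B *
      (\<Sum>C\<in>Basis. \<Sum>D\<in>Basis. bivector_wedge I3 I4 C D * W A B C D))"
    by (simp add: on_bivectors_def sum_distrib_left mult.assoc)
  also have "\<dots> = 1/4 * (\<Sum>A\<in>Basis. \<Sum>B\<in>Basis. bivector_wedge I1 I2 A B * (2 * W A B I3 I4))"
    by (simp only: two[OF lin(2) lin'(2) skew(2)])
  also have "\<dots> = 1/4 * (2 * (\<Sum>A\<in>Basis. \<Sum>B\<in>Basis. bivector_wedge I1 I2 A B * W A B I3 I4))"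
    by (simp add: sum_distrib_left mult.left_commute)
  also have "\<dots> = W I1 I2 I3 I4"
    by (simp only: two[OF lin(1) lin'(1) skew(1)])
  finally show ?thesis .
qed

end

theory Submission
  imports Defs
begin

text \<open>
  For \<open>v = 1\<close> the weighted Schouten tensor is \<open>P = a Ric + (b + c R) g\<close> with constants \<open>a \<sim> 1/m\<close>,
  \<open>b \<sim> 1/(4 m)\<close>, \<open>c = O(1/m\<^sup>2)\<close>, and the modified tractor of \<open>v\<close> is \<open>(1, 0, \<rho>)\<close> with
  \<open>\<rho> \<sim> -1/(4 m)\<close>.  Evaluate the weighted Weyl tractor on
  \<open>T = m Y \<and> Z(u) + \<Phi>\<close>, where \<open>u\<close> is the vector dual to \<open>\<alpha>\<close>, divide by \<open>m\<close> and let \<open>m\<close> tend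
  to infinity.  The \<open>\<Phi>\<Phi>\<close> part converges to \<open>Rm(\<Phi>, \<Phi>)\<close>; both mixed parts converge to
  \<open>- \<langle>dRic, \<Phi> \<otimes> \<alpha>\<rangle>\<close>, one of them by the contracted second Bianchi identity
  \<open>div Rm = dRic\<close>; the \<open>YY\<close> part converges to
  \<open>div dRic + \<langle>Rm, Ric + g/4\<rangle> + Ric/4\<close>, which is \<open>B\<close> because \<open>div Ric = dR/2\<close> and the Ricci
  identity give \<open>div dRic = \<Delta> Ric - \<nabla>\<^sup>2 R / 2 - Ric\<^sup>2 + \<langle>Rm, Ric\<rangle>\<close>.
\<close>

section \<open>Smooth functions\<close>

text \<open>The factor \<open>m\<close> in the test bivector balances three orders of growth: the
  \<open>YZYZ\<close> values of the weighted Weyl tractor are at most of order 1/m, the mixed values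
  of order 1, the \<open>ZZZZ\<close> values of order m. Weighted by m^2, m and 1, every part is of
  order m, so all of them survive the division by m. The two mixed limits agree for different
  reasons: one is -(m + n - 4) dP with dP ~ dRic/m; in the other all terms with P vanish and only
  the divergence of Rm remains. The summand Ric/2 of B is -\<mu> Ric: the trace of Rm against the
  metric part -\<mu> g/(2m) of P gives one half of it, the wedge of the modified tractor with its
  derivative gives the other half, and in that wedge the metric part of P cancels against \<rho> g.
  The inequality is pointwise, so the manifold only supplies a chart; in return the whole tensor
  calculus is derived from Frechet derivatives of coordinate fields, through identities that hold
  only on the open image of the chart.\<close>

lemma C_k_on_cong:
  assumes "open S" "\<And>q. q \<in> S \<Longrightarrow> f q = h q" "C_k_on k S f"
  shows "C_k_on k S h"
  using assms(2,3)
proof (induction k arbitrary: f h)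
  case 0
  then show ?case using continuous_on_cong by force
next
  case (Suc k)
  have h: "(h has_derivative \<partial> f q) (at q)" if "q \<in> S" for q
  proof -
    have "f differentiable at q"
      using Suc.prems(2) that \<open>open S\<close> by (auto simp: differentiable_on_eq_differentiable_at)
    then have "(f has_derivative \<partial> f q) (at q)"
      using frechet_derivative_works by blast
    then show ?thesis
      by (rule has_derivative_transform_within_open[OF _ \<open>open S\<close> that]) (use Suc.prems in auto)
  qed
  then have eq: "\<partial> h q = \<partial> f q" if "q \<in> S" for q
    using that frechet_derivative_at by metis
  have "h differentiable_on S"
    using h \<open>open S\<close> by (auto simp: differentiable_on_eq_differentiable_at differentiable_def)
  moreover have "C_k_on k S (\<lambda>p. \<partial> h p x)" for x
    using Suc.IH[of "\<lambda>p. \<partial> f p x"] eq Suc.prems(2) by simp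
  ultimately show ?case by simp
qed

lemma C_k_on_Suc_imp: "C_k_on (Suc k) S f \<Longrightarrow> C_k_on k S f"
  by (induction k arbitrary: f) (auto simp: differentiable_imp_continuous_on)

text \<open>Closed formulas for geometric fields hold only on the chart image; openness makes
  agreement there enough to transfer smoothness.\<close>

lemma smooth_on_cong:
  assumes "open S" "\<And>q. q \<in> S \<Longrightarrow> f q = h q" "smooth_on S f"
  shows "smooth_on S h"
  using assms C_k_on_cong unfolding smooth_on_def by blast

lemma smooth_on_deriv: "smooth_on S f \<Longrightarrow> smooth_on S (\<lambda>q. \<partial> f q x)"
  unfolding smooth_on_def by (metis C_k_on.simps(2))

lemma smooth_on_differentiable:
  assumes "open S" "smooth_on S f" "q \<in> S"
  shows "f differentiable at q"
proof -
  have "C_k_on 1 S f" using assms(2) by (simp add: smooth_on_def)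
  then show ?thesis
    using assms by (auto simp: differentiable_on_eq_differentiable_at)
qed

lemma smooth_on_has_derivative:
  assumes "open S" "smooth_on S f" "q \<in> S"
  shows "(f has_derivative \<partial> f q) (at q)"
  using smooth_on_differentiable[OF assms] frechet_derivative_works by blast

lemma dirder_const [simp]: "\<partial> (\<lambda>_. c) q = (\<lambda>_. 0)"
  using frechet_derivative_at[OF has_derivative_const, of c q] by simp

lemma C_k_on_const: "C_k_on k S (\<lambda>_. c)"
  by (induction k arbitrary: c) simp_all

lemma smooth_on_const: "smooth_on S (\<lambda>_. c)"
  by (simp add: smooth_on_def C_k_on_const)

lemma dirder_eqI: "(f has_derivative f') (at q) \<Longrightarrow> \<partial> f q x = f' x"
  by (metis frechet_derivative_at)

text \<open>\<open>frechet_derivative\<close> is a choice from \<open>has_derivative\<close>, and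
  near \<open>q\<close> this predicate cannot tell \<open>f\<close> from \<open>h\<close>; so
  equality holds even where no derivative exists.\<close>

lemma dirder_cong:
  assumes "open S" "q \<in> S" "\<And>q. q \<in> S \<Longrightarrow> f q = h q"
  shows "\<partial> f q x = \<partial> h q x"
proof -
  have "(f has_derivative D) (at q) \<longleftrightarrow> (h has_derivative D) (at q)" for D
    using has_derivative_transform_within_open[OF _ assms(1,2)] assms(3) by metis
  then show ?thesis
    by (simp add: frechet_derivative_def)
qed

lemma C_k_on_add:
  assumes "open S" "C_k_on k S f" "C_k_on k S h"
  shows "C_k_on k S (\<lambda>q. f q + h q)"
  using assms(2,3)
proof (induction k arbitrary: f h)
  case 0
  then show ?case by (auto intro: continuous_on_add)
next
  case (Suc k)
  have "C_k_on k S (\<lambda>q. \<partial> (\<lambda>q. f q + h q) q x)" for x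
  proof (rule C_k_on_cong[OF \<open>open S\<close>])
    show "C_k_on k S (\<lambda>q. \<partial> f q x + \<partial> h q x)"
      using Suc by simp
    fix q assume "q \<in> S"
    then have "f differentiable at q" "h differentiable at q"
      using Suc.prems \<open>open S\<close> by (auto simp: differentiable_on_eq_differentiable_at)
    then show "\<partial> f q x + \<partial> h q x = \<partial> (\<lambda>q. f q + h q) q x"
      unfolding frechet_derivative_works by (rule dirder_eqI[OF has_derivative_add, symmetric])
  qed
  then show ?case
    using Suc.prems by (auto intro: differentiable_on_add)
qed

text \<open>By the product rule the derivative is a sum of two products of the same kind, so the
  induction must generalize over both factors; the undifferentiated factor is lowered by one order
  with \<open>C_k_on_Suc_imp\<close>.\<close>

lemma C_k_on_bilinear:
  assumes "open S" "bounded_bilinear B" "C_k_on k S f" "C_k_on k S h"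
  shows "C_k_on k S (\<lambda>q. B (f q) (h q))"
  using assms(3,4)
proof (induction k arbitrary: f h)
  case 0
  then show ?case using bounded_bilinear.continuous_on[OF assms(2)] by auto
next
  case (Suc k)
  have D: "((\<lambda>q. B (f q) (h q)) has_derivative (\<lambda>x. B (f q) (\<partial> h q x) + B (\<partial> f q x) (h q))) (at q)"
    if "q \<in> S" for q
  proof (rule bounded_bilinear.FDERIV[OF assms(2)])
    show "(f has_derivative \<partial> f q) (at q)" "(h has_derivative \<partial> h q) (at q)"
      using Suc.prems \<open>open S\<close> that unfolding frechet_derivative_works[symmetric]
      by (auto simp: differentiable_on_eq_differentiable_at)
  qed
  have "C_k_on k S (\<lambda>q. \<partial> (\<lambda>q. B (f q) (h q)) q x)" for x
  proof (rule C_k_on_cong[OF \<open>open S\<close>])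
    show "C_k_on k S (\<lambda>q. B (f q) (\<partial> h q x) + B (\<partial> f q x) (h q))"
      using Suc.IH C_k_on_Suc_imp[OF Suc.prems(1)] C_k_on_Suc_imp[OF Suc.prems(2)] Suc.prems
      by (intro C_k_on_add \<open>open S\<close>) simp_all
  qed (simp add: dirder_eqI[OF D])
  then show ?case
    using D \<open>open S\<close> by (auto simp: differentiable_on_eq_differentiable_at differentiable_def)
qed

text \<open>The derivative of 1/f is a product of f' with two copies of 1/f, whose regularity of one
  order less is the induction hypothesis.\<close>

lemma C_k_on_inverse:
  fixes f :: "'a::euclidean_space \<Rightarrow> real"
  assumes "open S" "C_k_on k S f" "\<And>q. q \<in> S \<Longrightarrow> f q \<noteq> 0"
  shows "C_k_on k S (\<lambda>q. inverse (f q))"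
  using assms(2)
proof (induction k)
  case 0
  then show ?case using assms(3) by (auto intro: continuous_on_inverse)
next
  case (Suc k)
  have D: "((\<lambda>q. inverse (f q)) has_derivative (\<lambda>x. - (inverse (f q) * \<partial> f q x * inverse (f q)))) (at q)"
    if "q \<in> S" for q
  proof -
    have "f differentiable at q"
      using Suc.prems \<open>open S\<close> that by (auto simp: differentiable_on_eq_differentiable_at)
    then show ?thesis
      unfolding frechet_derivative_works by (rule Deriv.has_derivative_inverse[of f q, OF assms(3)[OF that]])
  qed
  have I: "C_k_on k S (\<lambda>q. inverse (f q))"
    using Suc.IH C_k_on_Suc_imp[OF Suc.prems] by blast
  have "C_k_on k S (\<lambda>q. \<partial> (\<lambda>q. inverse (f q)) q x)" for x
  proof (rule C_k_on_cong[OF \<open>open S\<close>])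
    show "C_k_on k S (\<lambda>q. (-1) * (inverse (f q) * \<partial> f q x * inverse (f q)))"
      using Suc.prems I
      by (intro C_k_on_bilinear[OF \<open>open S\<close> bounded_bilinear_mult] C_k_on_const) simp_all
  qed (simp add: dirder_eqI[OF D])
  then show ?case
    using D \<open>open S\<close> by (auto simp: differentiable_on_eq_differentiable_at differentiable_def)
qed

context
  fixes S :: "'a::euclidean_space set"
  assumes S: "open S"
begin

lemma smooth_on_add: "smooth_on S f \<Longrightarrow> smooth_on S h \<Longrightarrow> smooth_on S (\<lambda>q. f q + h q)"
  using C_k_on_add[OF S] unfolding smooth_on_def by blast

lemma smooth_on_bilinear:
  "bounded_bilinear B \<Longrightarrow> smooth_on S f \<Longrightarrow> smooth_on S h \<Longrightarrow> smooth_on S (\<lambda>q. B (f q) (h q))"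
  using C_k_on_bilinear[OF S] unfolding smooth_on_def by blast

text \<open>A linear map is read as the bilinear map taking \<open>c\<close> and \<open>y\<close> to
  \<open>c *\<^sub>R L y\<close>, applied to the constant function 1.\<close>

lemma smooth_on_linear:
  assumes "bounded_linear L" "smooth_on S f"
  shows "smooth_on S (\<lambda>q. L (f q))"
  using smooth_on_bilinear[OF bounded_bilinear.comp[OF bounded_bilinear_scaleR bounded_linear_ident assms(1)]
    smooth_on_const[of _ 1] assms(2)] by simp

lemmas smooth_on_mult = smooth_on_bilinear[OF bounded_bilinear_mult]
lemmas smooth_on_scaleR = smooth_on_bilinear[OF bounded_bilinear_scaleR]

lemma smooth_on_minus: "smooth_on S f \<Longrightarrow> smooth_on S (\<lambda>q. - f q)"
  using smooth_on_linear[OF bounded_linear_minus[OF bounded_linear_ident]] .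

lemma smooth_on_diff: "smooth_on S f \<Longrightarrow> smooth_on S h \<Longrightarrow> smooth_on S (\<lambda>q. f q - h q)"
  using smooth_on_add[OF _ smooth_on_minus, of f h] by simp

lemma smooth_on_divide_const: "smooth_on S f \<Longrightarrow> smooth_on S (\<lambda>q. f q / c)" for c :: real
  using smooth_on_linear[OF bounded_linear_divide[of c]] .

lemma smooth_on_inverse:
  "smooth_on S f \<Longrightarrow> (\<And>q. q \<in> S \<Longrightarrow> f q \<noteq> 0) \<Longrightarrow> smooth_on S (\<lambda>q. inverse (f q))"
  for f :: "_ \<Rightarrow> real"
  using C_k_on_inverse[OF S] unfolding smooth_on_def by blast

lemma smooth_on_sum:
  assumes "\<And>i. i \<in> I \<Longrightarrow> smooth_on S (f i)"
  shows "smooth_on S (\<lambda>q. \<Sum>i\<in>I. f i q)"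
  using assms by (induction I rule: infinite_finite_induct) (auto intro: smooth_on_const smooth_on_add)

lemma smooth_on_prod:
  fixes f :: "_ \<Rightarrow> _ \<Rightarrow> real"
  assumes "\<And>i. i \<in> I \<Longrightarrow> smooth_on S (f i)"
  shows "smooth_on S (\<lambda>q. \<Prod>i\<in>I. f i q)"
  using assms by (induction I rule: infinite_finite_induct) (auto intro: smooth_on_const smooth_on_mult)

end

lemma smooth_on_det:
  fixes f :: "'a::euclidean_space \<Rightarrow> real^'n^'n"
  assumes "open S" "\<And>i j. smooth_on S (\<lambda>q. f q $ i $ j)"
  shows "smooth_on S (\<lambda>q. det (f q))"
  unfolding det_def
  by (intro smooth_on_sum smooth_on_mult smooth_on_prod smooth_on_const assms)

lemma smooth_on_nth:
  fixes f :: "'a::euclidean_space \<Rightarrow> 'b::real_normed_vector^'n"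
  shows "open S \<Longrightarrow> smooth_on S f \<Longrightarrow> smooth_on S (\<lambda>q. f q $ i)"
  using smooth_on_linear[OF _ bounded_linear_vec_nth] .

text \<open>Cramer's rule: entry (i, j) of the inverse is the determinant with column i replaced by
  the j-th unit vector, divided by the determinant. Both determinants are polynomials in the
  entries.\<close>

lemma smooth_on_matrix_inv:
  fixes f :: "'a::euclidean_space \<Rightarrow> real^'n^'n"
  assumes S: "open S" and f: "smooth_on S f" and inv: "\<And>q. q \<in> S \<Longrightarrow> invertible (f q)"
  shows "smooth_on S (\<lambda>q. matrix_inv (f q) $ i $ j)"
proof (rule smooth_on_cong[OF S])
  have f': "smooth_on S (\<lambda>q. f q $ i $ j)" for i j
    by (intro smooth_on_nth S f)
  have d: "det (f q) \<noteq> 0" if "q \<in> S" for q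
    using inv[OF that] by (simp add: invertible_det_nz)
  let ?c = "\<lambda>q. (\<chi> k l. if l = i then axis j 1 $ k else f q $ k $ l) :: real^'n^'n"
  have "smooth_on S (\<lambda>q. det (?c q))"
  proof (rule smooth_on_det[OF S])
    show "smooth_on S (\<lambda>q. ?c q $ k $ l)" for k l
      by (cases "l = i") (simp_all add: f' smooth_on_const)
  qed
  moreover have "smooth_on S (\<lambda>q. inverse (det (f q)))"
    by (intro smooth_on_inverse smooth_on_det S f' d)
  ultimately show "smooth_on S (\<lambda>q. det (?c q) * inverse (det (f q)))"
    by (rule smooth_on_mult[OF S])
  fix q assume q: "q \<in> S"
  have "f q *v (matrix_inv (f q) *v axis j 1) = axis j 1"
    using matrix_inv_inverse(1)[OF inv[OF q]] by (simp add: matrix_vector_mul_assoc)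
  then have "matrix_inv (f q) *v axis j 1 =
      (\<chi> k. det (\<chi> i l. if l = k then axis j 1 $ i else f q $ i $ l) / det (f q))"
    using cramer[OF d[OF q]] by blast
  then have "(matrix_inv (f q) *v axis j 1) $ i = det (?c q) / det (f q)"
    by simp
  then show "det (?c q) * inverse (det (f q)) = matrix_inv (f q) $ i $ j"
    by (simp add: matrix_vector_mult_basis column_def divide_inverse)
qed

section \<open>Symmetry of mixed second derivatives\<close>

lemma has_real_derivative_line:
  fixes f :: "'a::real_normed_vector \<Rightarrow> real"
  assumes "(f has_derivative f') (at (c + s *\<^sub>R x))"
  shows "((\<lambda>s. f (c + s *\<^sub>R x)) has_real_derivative f' x) (at s)"
proof -
  have "((\<lambda>s. c + s *\<^sub>R x) has_derivative (\<lambda>h. h *\<^sub>R x)) (at s)"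
    by (auto intro!: derivative_eq_intros)
  from has_derivative_compose[OF this assms]
  have "((\<lambda>s. f (c + s *\<^sub>R x)) has_derivative (\<lambda>h. f' (h *\<^sub>R x))) (at s)" .
  moreover have "f' (h *\<^sub>R x) = f' x * h" for h
    using linear_cmul[OF has_derivative_linear[OF assms]] by simp
  ultimately show ?thesis
    by (simp add: has_field_derivative_def)
qed

text \<open>Two applications of the mean value theorem: first along \<open>x\<close> to the
  increment of \<open>f\<close> in direction \<open>y\<close>, then along \<open>y\<close> to the
  derivative of \<open>f\<close> in direction \<open>x\<close>.\<close>

lemma second_difference:
  fixes f :: "'a::euclidean_space \<Rightarrow> real"
  assumes S: "open S" and f: "smooth_on S f" and t: "0 < t"
    and in_S: "\<And>a b. a \<in> {0..t} \<Longrightarrow> b \<in> {0..t} \<Longrightarrow> p + a *\<^sub>R x + b *\<^sub>R y \<in> S"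
  shows "\<exists>a\<in>{0<..<t}. \<exists>b\<in>{0<..<t}. f (p + t *\<^sub>R x + t *\<^sub>R y) - f (p + t *\<^sub>R x) - f (p + t *\<^sub>R y) + f p
           = t * (t * \<partial> (\<lambda>q. \<partial> f q x) (p + a *\<^sub>R x + b *\<^sub>R y) y)"
proof -
  have "((\<lambda>s. f (p + t *\<^sub>R y + s *\<^sub>R x) - f (p + s *\<^sub>R x)) has_real_derivative
      \<partial> f (p + t *\<^sub>R y + s *\<^sub>R x) x - \<partial> f (p + s *\<^sub>R x) x) (at s)" if "0 \<le> s" "s \<le> t" for s
    using in_S[of s t] in_S[of s 0] that t
    by (intro DERIV_diff has_real_derivative_line smooth_on_has_derivative[OF S f])
      (auto simp: add_ac)
  from MVT2[OF t this] obtain a where a: "0 < a" "a < t" and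
    1: "f (p + t *\<^sub>R y + t *\<^sub>R x) - f (p + t *\<^sub>R x) - (f (p + t *\<^sub>R y) - f p)
       = t * (\<partial> f (p + t *\<^sub>R y + a *\<^sub>R x) x - \<partial> f (p + a *\<^sub>R x) x)"
    by auto
  have "((\<lambda>s. \<partial> f (p + a *\<^sub>R x + s *\<^sub>R y) x) has_real_derivative
      \<partial> (\<lambda>q. \<partial> f q x) (p + a *\<^sub>R x + s *\<^sub>R y) y) (at s)" if "0 \<le> s" "s \<le> t" for s
    using in_S[of a s] that a
    by (intro has_real_derivative_line[of "\<lambda>q. \<partial> f q x"] smooth_on_has_derivative[OF S smooth_on_deriv[OF f]]) auto
  from MVT2[OF t this] obtain b where b: "0 < b" "b < t" and
    2: "\<partial> f (p + a *\<^sub>R x + t *\<^sub>R y) x - \<partial> f (p + a *\<^sub>R x) x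
       = t * \<partial> (\<lambda>q. \<partial> f q x) (p + a *\<^sub>R x + b *\<^sub>R y) y"
    by auto
  show ?thesis
    using a b 1 2 by (intro bexI[of _ a] bexI[of _ b]) (auto simp: algebra_simps)
qed

text \<open>The second difference over a parallelogram is symmetric in its two sides, so both mixed
  derivatives take a common value at points arbitrarily close to \<open>p\<close>; their continuity
  finishes the argument.\<close>

lemma second_derivative_symmetric_real:
  fixes f :: "'a::euclidean_space \<Rightarrow> real"
  assumes S: "open S" and f: "smooth_on S f" and p: "p \<in> S"
  shows "\<partial> (\<lambda>q. \<partial> f q x) p y = \<partial> (\<lambda>q. \<partial> f q y) p x"
proof -
  let ?F = "\<lambda>x y q. \<partial> (\<lambda>q. \<partial> f q x) q y"
  have cont: "isCont (?F x y) p" for x y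
    using smooth_on_differentiable[OF S smooth_on_deriv[OF smooth_on_deriv[OF f]] p]
    by (rule differentiable_imp_continuous_within)
  have le: "dist (?F x y p) (?F y x p) \<le> 2 * e" if e: "0 < e" for e
  proof -
    have "\<forall>\<^sub>F q in nhds p. dist (?F x y q) (?F x y p) < e" for x y
    proof -
      have "(?F x y \<longlongrightarrow> ?F x y p) (nhds p)"
        using cont[of x y] unfolding isCont_def by (rule tendsto_at_iff_tendsto_nhds[THEN iffD1])
      then show ?thesis using e by (rule tendstoD)
    qed
    then have "\<forall>\<^sub>F q in nhds p. q \<in> S \<and> dist (?F x y q) (?F x y p) < e \<and> dist (?F y x q) (?F y x p) < e"
      by (intro eventually_conj eventually_nhds_in_open S p)
    then obtain d where d: "0 < d" and
      D: "\<And>q. dist q p < d \<Longrightarrow> q \<in> S \<and> dist (?F x y q) (?F x y p) < e \<and> dist (?F y x q) (?F y x p) < e"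
      unfolding eventually_nhds_metric by blast
    \<comment> \<open>Small enough for the whole parallelogram to lie in the ball of radius
      \<open>d\<close>; the summand 1 keeps the denominator positive when both directions are
      0.\<close>
    define t where "t = d / (2 * (norm x + norm y + 1))"
    have n: "0 < norm x + norm y + 1"
      using norm_ge_zero[of x] norm_ge_zero[of y] by linarith
    have t: "0 < t"
      using n d by (simp add: t_def)
    have near: "dist (p + a *\<^sub>R x + b *\<^sub>R y) p < d" if "a \<in> {0..t}" "b \<in> {0..t}" for a b
    proof -
      have "dist (p + a *\<^sub>R x + b *\<^sub>R y) p \<le> norm (a *\<^sub>R x) + norm (b *\<^sub>R y)"
        using norm_triangle_ineq[of "a *\<^sub>R x" "b *\<^sub>R y"] by (simp add: dist_norm)
      also have "\<dots> = a * norm x + b * norm y"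
        using that by simp
      also have "\<dots> \<le> t * norm x + t * norm y"
        using that by (intro add_mono mult_right_mono) auto
      also have "\<dots> < t * (2 * (norm x + norm y + 1))"
      proof -
        have "norm x + norm y < 2 * (norm x + norm y + 1)"
          using n by simp
        from mult_strict_left_mono[OF this t] show ?thesis
          by (simp only: distrib_left)
      qed
      also have "\<dots> = d"
        using n by (simp add: t_def)
      finally show ?thesis .
    qed
    have near': "dist (p + b *\<^sub>R y + a *\<^sub>R x) p < d" if "a \<in> {0..t}" "b \<in> {0..t}" for a b
      using near[OF that] by (simp add: add_ac)
    obtain a b where ab: "a \<in> {0<..<t}" "b \<in> {0<..<t}" and
      1: "f (p + t *\<^sub>R x + t *\<^sub>R y) - f (p + t *\<^sub>R x) - f (p + t *\<^sub>R y) + f p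
           = t * (t * ?F x y (p + a *\<^sub>R x + b *\<^sub>R y))"
      using second_difference[OF S f t, of p x y] D near by blast
    obtain a' b' where ab': "a' \<in> {0<..<t}" "b' \<in> {0<..<t}" and
      2: "f (p + t *\<^sub>R y + t *\<^sub>R x) - f (p + t *\<^sub>R y) - f (p + t *\<^sub>R x) + f p
           = t * (t * ?F y x (p + a' *\<^sub>R y + b' *\<^sub>R x))"
      using second_difference[OF S f t, of p y x] D near' by blast
    have "?F x y (p + a *\<^sub>R x + b *\<^sub>R y) = ?F y x (p + a' *\<^sub>R y + b' *\<^sub>R x)"
    proof -
      have "p + t *\<^sub>R y + t *\<^sub>R x = p + t *\<^sub>R x + t *\<^sub>R y"
        by (simp add: add_ac)
      note 1 2[unfolded this]
      then have "t * (t * ?F x y (p + a *\<^sub>R x + b *\<^sub>R y)) = t * (t * ?F y x (p + a' *\<^sub>R y + b' *\<^sub>R x))"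
        by linarith
      with t show ?thesis by simp
    qed
    moreover have "dist (?F x y (p + a *\<^sub>R x + b *\<^sub>R y)) (?F x y p) < e"
      using D near ab by simp
    moreover have "dist (?F y x (p + a' *\<^sub>R y + b' *\<^sub>R x)) (?F y x p) < e"
      using D near' ab' by simp
    ultimately show ?thesis
      by (simp add: dist_real_def)
  qed
  have "dist (?F x y p) (?F y x p) \<le> 0"
  proof (rule field_le_epsilon)
    fix e :: real assume "0 < e"
    then show "dist (?F x y p) (?F y x p) \<le> 0 + e" using le[of "e/2"] by simp
  qed
  then show ?thesis by simp
qed

lemma dirder_linear:
  assumes "bounded_linear L" "f differentiable at q"
  shows "\<partial> (\<lambda>q. L (f q)) q x = L (\<partial> f q x)"
proof -
  have "(f has_derivative \<partial> f q) (at q)"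
    using assms(2) frechet_derivative_works by blast
  from dirder_eqI[OF bounded_linear.has_derivative[OF assms(1) this]] show ?thesis .
qed

lemma second_derivative_symmetric:
  fixes f :: "'a::euclidean_space \<Rightarrow> 'b::euclidean_space"
  assumes S: "open S" and f: "smooth_on S f" and p: "p \<in> S"
  shows "\<partial> (\<lambda>q. \<partial> f q x) p y = \<partial> (\<lambda>q. \<partial> f q y) p x"
proof (rule euclidean_eqI)
  fix b :: 'b
  have L: "bounded_linear (\<lambda>v. v \<bullet> b)"
    by (rule bounded_linear_inner_left)
  have *: "\<partial> (\<lambda>q. \<partial> f q x) p y \<bullet> b = \<partial> (\<lambda>q. \<partial> (\<lambda>q. f q \<bullet> b) q x) p y" for x y
  proof -
    have "\<partial> (\<lambda>q. \<partial> (\<lambda>q. f q \<bullet> b) q x) p y = \<partial> (\<lambda>q. \<partial> f q x \<bullet> b) p y"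
      by (rule dirder_cong[OF S p]) (simp add: dirder_linear[OF L] smooth_on_differentiable[OF S f])
    then show ?thesis
      by (simp add: dirder_linear[OF L] smooth_on_differentiable[OF S smooth_on_deriv[OF f] p])
  qed
  show "\<partial> (\<lambda>q. \<partial> f q x) p y \<bullet> b = \<partial> (\<lambda>q. \<partial> f q y) p x \<bullet> b"
    unfolding * by (rule second_derivative_symmetric_real[OF S smooth_on_linear[OF S L f] p])
qed

section \<open>Tensor calculus in a chart\<close>

lemma ip_bilinear: "bilinear (ip g p)"
  by (auto simp: bilinear_def ip_def inner_add_left inner_add_right matrix_vector_right_distrib
      matrix_vector_mult_scaleR intro!: linearI)

lemmas ip_simps =
  bilinear_ladd[OF ip_bilinear] bilinear_radd[OF ip_bilinear]
  bilinear_lsub[OF ip_bilinear] bilinear_rsub[OF ip_bilinear]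
  bilinear_lneg[OF ip_bilinear] bilinear_rneg[OF ip_bilinear]
  bilinear_lmul[OF ip_bilinear] bilinear_rmul[OF ip_bilinear]
  bilinear_lzero[OF ip_bilinear] bilinear_rzero[OF ip_bilinear]

lemma sharp_add: "sharp g p (\<lambda>z. a z + b z) = sharp g p a + sharp g p b"
  by (simp add: sharp_def flip: matrix_vector_right_distrib) (simp add: plus_vec_def)

lemma sharp_scaleR: "sharp g p (\<lambda>z. c * a z) = c *\<^sub>R sharp g p a"
  by (simp add: sharp_def flip: matrix_vector_mult_scaleR) (simp add: scaleR_vec_def)

section \<open>Smooth fields of linear and bilinear maps\<close>

definition smooth_form ::
  "'a::euclidean_space set \<Rightarrow> ('a \<Rightarrow> 'c::euclidean_space \<Rightarrow> 'b::real_normed_vector) \<Rightarrow> bool" where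
  "smooth_form S T \<longleftrightarrow> (\<forall>q\<in>S. linear (T q)) \<and> (\<forall>v. smooth_on S (\<lambda>q. T q v))"

lemma smooth_formD:
  assumes "smooth_form S T"
  shows "q \<in> S \<Longrightarrow> linear (T q)" "smooth_on S (\<lambda>q. T q v)"
  using assms by (auto simp: smooth_form_def)

lemma linear_expand:
  fixes L :: "'c::euclidean_space \<Rightarrow> 'b::real_normed_vector"
  assumes "linear L"
  shows "L v = (\<Sum>b\<in>Basis. (v \<bullet> b) *\<^sub>R L b)"
  using linear_sum[OF assms, of "\<lambda>b. (v \<bullet> b) *\<^sub>R b" Basis]
  by (simp add: linear_cmul[OF assms] euclidean_representation)

context
  fixes S :: "'a::euclidean_space set"
  assumes S: "open S"
begin

text \<open>Expanding \<open>X\<close> in the constant basis reduces a varying argument to fixed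
  ones, which is why \<open>smooth_form\<close> tests smoothness on fixed vectors only.\<close>

lemma smooth_form_app:
  assumes T: "smooth_form S T" and X: "smooth_on S X"
  shows "smooth_on S (\<lambda>q. T q (X q))"
proof (rule smooth_on_cong[OF S])
  show "smooth_on S (\<lambda>q. \<Sum>b\<in>Basis. (X q \<bullet> b) *\<^sub>R T q b)"
    by (intro smooth_on_sum smooth_on_scaleR smooth_on_linear[OF _ bounded_linear_inner_left] S X
        smooth_formD(2)[OF T])
qed (simp add: linear_expand[OF smooth_formD(1)[OF T], symmetric])

text \<open>Linearity in \<open>v\<close> is an identity between functions on the open set, so it
  can be differentiated in the base point.\<close>

lemma smooth_form_deriv_linear:
  assumes T: "smooth_form S T" and p: "p \<in> S"
  shows "linear (\<lambda>v. \<partial> (\<lambda>q. T q v) p h)"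
proof (rule linearI)
  have D: "((\<lambda>q. T q v) has_derivative \<partial> (\<lambda>q. T q v) p) (at p)" for v
    by (rule smooth_on_has_derivative[OF S smooth_formD(2)[OF T] p])
  fix u v and r :: real
  have "\<partial> (\<lambda>q. T q (u + v)) p h = \<partial> (\<lambda>q. T q u + T q v) p h"
    by (rule dirder_cong[OF S p]) (rule linear_add[OF smooth_formD(1)[OF T]])
  then show "\<partial> (\<lambda>q. T q (u + v)) p h = \<partial> (\<lambda>q. T q u) p h + \<partial> (\<lambda>q. T q v) p h"
    by (simp add: dirder_eqI[OF has_derivative_add[OF D D]])
  have "\<partial> (\<lambda>q. T q (r *\<^sub>R v)) p h = \<partial> (\<lambda>q. r *\<^sub>R T q v) p h"
    by (rule dirder_cong[OF S p]) (rule linear_cmul[OF smooth_formD(1)[OF T]])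
  then show "\<partial> (\<lambda>q. T q (r *\<^sub>R v)) p h = r *\<^sub>R \<partial> (\<lambda>q. T q v) p h"
    by (simp add: dirder_eqI[OF has_derivative_scaleR_right[OF D]])
qed

lemma smooth_form_direction: "smooth_on S f \<Longrightarrow> smooth_form S (\<lambda>q h. \<partial> f q h)"
  unfolding smooth_form_def
  by (metis smooth_on_deriv linear_frechet_derivative smooth_on_differentiable[OF S])

text \<open>Product rule for the pairing of a form with a vector field; in the first summand the
  field is frozen at its value at \<open>p\<close>.\<close>

lemma dirder_app:
  assumes T: "smooth_form S T" and X: "smooth_on S X" and p: "p \<in> S"
  shows "\<partial> (\<lambda>q. T q (X q)) p h = \<partial> (\<lambda>q. T q (X p)) p h + T p (\<partial> X p h)"
proof -
  have DX: "((\<lambda>q. X q \<bullet> b) has_derivative (\<lambda>h. \<partial> X p h \<bullet> b)) (at p)" for b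
    by (intro has_derivative_inner_left smooth_on_has_derivative[OF S X p])
  have DT: "((\<lambda>q. T q b) has_derivative \<partial> (\<lambda>q. T q b) p) (at p)" for b
    by (rule smooth_on_has_derivative[OF S smooth_formD(2)[OF T] p])
  have "\<partial> (\<lambda>q. T q (X q)) p h = \<partial> (\<lambda>q. \<Sum>b\<in>Basis. (X q \<bullet> b) *\<^sub>R T q b) p h"
    by (rule dirder_cong[OF S p]) (rule linear_expand[OF smooth_formD(1)[OF T]])
  also have "\<dots> = (\<Sum>b\<in>Basis. (X p \<bullet> b) *\<^sub>R \<partial> (\<lambda>q. T q b) p h + (\<partial> X p h \<bullet> b) *\<^sub>R T p b)"
    by (rule dirder_eqI, rule has_derivative_sum, rule has_derivative_scaleR[OF DX DT])
  also have "\<dots> = \<partial> (\<lambda>q. T q (X p)) p h + T p (\<partial> X p h)"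
    by (simp only: sum.distrib linear_expand[OF smooth_form_deriv_linear[OF T p], symmetric]
        linear_expand[OF smooth_formD(1)[OF T p], symmetric])
  finally show ?thesis .
qed

end

definition smooth_bilinear ::
  "'a::euclidean_space set \<Rightarrow> ('a \<Rightarrow> 'c::euclidean_space \<Rightarrow> 'd::euclidean_space \<Rightarrow> 'b::real_normed_vector) \<Rightarrow> bool"
  where "smooth_bilinear S T \<longleftrightarrow> (\<forall>q\<in>S. bilinear (T q)) \<and> (\<forall>u v. smooth_on S (\<lambda>q. T q u v))"

lemma smooth_bilinear_iff:
  "smooth_bilinear S T \<longleftrightarrow> (\<forall>u. smooth_form S (\<lambda>q v. T q u v)) \<and> (\<forall>v. smooth_form S (\<lambda>q u. T q u v))"
  by (auto simp: smooth_bilinear_def smooth_form_def bilinear_def)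

lemma smooth_bilinearD:
  assumes "smooth_bilinear S T"
  shows "smooth_form S (\<lambda>q v. T q u v)" "smooth_form S (\<lambda>q u. T q u v)"
    "smooth_on S (\<lambda>q. T q u v)" "q \<in> S \<Longrightarrow> bilinear (T q)"
  using assms unfolding smooth_bilinear_iff[symmetric] using assms
  by (simp_all add: smooth_bilinear_iff) (auto simp: smooth_form_def bilinear_def)

lemma smooth_bilinear_app:
  assumes S: "open S" and T: "smooth_bilinear S T" and X: "smooth_on S X" and Y: "smooth_on S Y"
  shows "smooth_on S (\<lambda>q. T q (X q) (Y q))"
    and "p \<in> S \<Longrightarrow> \<partial> (\<lambda>q. T q (X q) (Y q)) p h =
      \<partial> (\<lambda>q. T q (X p) (Y p)) p h + T p (\<partial> X p h) (Y p) + T p (X p) (\<partial> Y p h)"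
proof -
  have 1: "smooth_form S (\<lambda>q u. T q u (Y q))"
    unfolding smooth_form_def
    using smooth_bilinearD[OF T] smooth_form_app[OF S smooth_bilinearD(1)[OF T] Y]
    by (auto simp: bilinear_def)
  show "smooth_on S (\<lambda>q. T q (X q) (Y q))"
    by (rule smooth_form_app[OF S 1 X])
  show "\<partial> (\<lambda>q. T q (X q) (Y q)) p h =
      \<partial> (\<lambda>q. T q (X p) (Y p)) p h + T p (\<partial> X p h) (Y p) + T p (X p) (\<partial> Y p h)" if "p \<in> S"
    using dirder_app[OF S 1 X that] dirder_app[OF S smooth_bilinearD(1)[OF T] Y that, of "X p"]
    by simp
qed

lemma linear_simps:
  assumes "linear L"
  shows "L (x + y) = L x + L y" "L (x - y) = L x - L y" "L (- x) = - L x" "L (c *\<^sub>R x) = c *\<^sub>R L x"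
    "L 0 = 0"
  using assms by (simp_all add: linear_add linear_diff linear_neg linear_cmul linear_0)

lemma bilinear_simps:
  assumes "bilinear T"
  shows "T (x + y) z = T x z + T y z" "T (x - y) z = T x z - T y z" "T (- x) z = - T x z"
    "T (c *\<^sub>R x) z = c *\<^sub>R T x z" "T 0 z = 0"
    "T w (u + v) = T w u + T w v" "T w (u - v) = T w u - T w v" "T w (- u) = - T w u"
    "T w (c *\<^sub>R u) = c *\<^sub>R T w u" "T w 0 = 0"
  using assms by (simp_all add: bilinear_ladd bilinear_lsub bilinear_lneg bilinear_lmul bilinear_lzero
      bilinear_radd bilinear_rsub bilinear_rneg bilinear_rmul bilinear_rzero)

text \<open>All that the geometry uses of a Riemannian manifold near a point: the image of one chart
  together with the metric in these coordinates.\<close>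

locale local_metric =
  fixes S :: "(real^'n::finite) set" and g :: "'n metric"
  assumes open_S: "open S" and smooth_g: "smooth_on S g"
    and ip_sym: "p \<in> S \<Longrightarrow> ip g p x y = ip g p y x"
    and ip_pos: "p \<in> S \<Longrightarrow> x \<noteq> 0 \<Longrightarrow> 0 < ip g p x x"
begin

abbreviation chr where "chr \<equiv> christoffel g"

lemmas smooth_intros = smooth_on_add[OF open_S] smooth_on_diff[OF open_S] smooth_on_minus[OF open_S]
  smooth_on_mult[OF open_S] smooth_on_scaleR[OF open_S] smooth_on_sum[OF open_S]
  smooth_on_divide_const[OF open_S] smooth_on_const smooth_on_deriv

lemmas dirder_cong_chart = dirder_cong[OF open_S]
lemmas smooth_cong_chart = smooth_on_cong[OF open_S]
lemmas has_derivative_chart = smooth_on_has_derivative[OF open_S]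

lemma dirder_add: "smooth_on S f \<Longrightarrow> smooth_on S h \<Longrightarrow> p \<in> S \<Longrightarrow>
    \<partial> (\<lambda>q. f q + h q) p x = \<partial> f p x + \<partial> h p x"
  using dirder_eqI[OF has_derivative_add[OF has_derivative_chart has_derivative_chart]] .

lemma dirder_diff: "smooth_on S f \<Longrightarrow> smooth_on S h \<Longrightarrow> p \<in> S \<Longrightarrow>
    \<partial> (\<lambda>q. f q - h q) p x = \<partial> f p x - \<partial> h p x"
  using dirder_eqI[OF has_derivative_diff[OF has_derivative_chart has_derivative_chart]] .

lemma dirder_minus: "smooth_on S f \<Longrightarrow> p \<in> S \<Longrightarrow> \<partial> (\<lambda>q. - f q) p x = - \<partial> f p x"
  using dirder_eqI[OF has_derivative_minus[OF has_derivative_chart]] .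

lemma dirder_cmult: "smooth_on S f \<Longrightarrow> p \<in> S \<Longrightarrow> \<partial> (\<lambda>q. c * f q) p x = c * \<partial> f p x" for c :: real
  using dirder_eqI[OF has_derivative_mult_right[OF has_derivative_chart]] .

lemma dirder_scaleR: "smooth_on S f \<Longrightarrow> smooth_on S h \<Longrightarrow> p \<in> S \<Longrightarrow>
    \<partial> (\<lambda>q. f q *\<^sub>R h q) p x = f p *\<^sub>R \<partial> h p x + \<partial> f p x *\<^sub>R h p"
  using dirder_eqI[OF has_derivative_scaleR[OF has_derivative_chart has_derivative_chart]] .

lemma dirder_mult: "smooth_on S f \<Longrightarrow> smooth_on S h \<Longrightarrow> p \<in> S \<Longrightarrow>
    \<partial> (\<lambda>q. f q * h q) p x = f p * \<partial> h p x + \<partial> f p x * h p" for f h :: "_ \<Rightarrow> real"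
  using dirder_scaleR[of f h] by simp

lemma smooth_ip: "smooth_bilinear S (ip g)"
proof -
  have eq: "ip g q u v = (\<Sum>i\<in>UNIV. \<Sum>j\<in>UNIV. (u $ i * v $ j) * g q $ i $ j)" for q u v
    by (simp add: ip_def inner_vec_def matrix_vector_mult_def sum_distrib_left mult_ac)
  show ?thesis
    unfolding smooth_bilinear_def
    by (simp add: ip_bilinear eq smooth_intros smooth_on_nth open_S smooth_g)
qed

lemma ip_eqI:
  assumes p: "p \<in> S" and eq: "\<And>z. ip g p x z = ip g p y z"
  shows "x = y"
  using ip_pos[OF p, of "x - y"] eq[of "x - y"] by (auto simp: ip_simps)

lemma ip_sharp_chart: "p \<in> S \<Longrightarrow> linear \<alpha> \<Longrightarrow> ip g p (sharp g p \<alpha>) x = \<alpha> x"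
  by (rule ip_sharp) (auto intro: ip_sym ip_pos)

lemma smooth_matrix_inv: "smooth_on S (\<lambda>q. matrix_inv (g q) $ i $ j)"
  by (rule smooth_on_matrix_inv[OF open_S smooth_g]) (rule posdef_invertible, rule ip_pos)

lemma smooth_sharp:
  assumes "\<And>v. smooth_on S (\<lambda>q. \<alpha> q v)"
  shows "smooth_on S (\<lambda>q. sharp g q (\<alpha> q))"
proof -
  have "sharp g q (\<alpha> q) = (\<Sum>i\<in>UNIV. (\<Sum>j\<in>UNIV. matrix_inv (g q) $ i $ j * \<alpha> q (axis j 1)) *\<^sub>R axis i 1)" for q
    by (simp add: sharp_def vec_eq_iff matrix_vector_mult_def axis_def if_distrib cong: if_cong)
  then show ?thesis
    by (simp add: smooth_intros smooth_matrix_inv assms)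
qed

lemma smooth_form_sharp:
  assumes "smooth_bilinear S P"
  shows "smooth_form S (\<lambda>q v. sharp g q (P q v))"
  unfolding smooth_form_def
proof (intro conjI ballI allI)
  show "linear (\<lambda>v. sharp g q (P q v))" if "q \<in> S" for q
  proof (rule linearI)
    note b = bilinear_simps[OF smooth_bilinearD(4)[OF assms that]]
    fix u v and r :: real
    have "P q (u + v) = (\<lambda>z. P q u z + P q v z)" "P q (r *\<^sub>R v) = (\<lambda>z. r * P q v z)"
      by (simp_all add: b fun_eq_iff)
    then show "sharp g q (P q (u + v)) = sharp g q (P q u) + sharp g q (P q v)"
      "sharp g q (P q (r *\<^sub>R v)) = r *\<^sub>R sharp g q (P q v)"
      by (simp_all add: sharp_add sharp_scaleR)
  qed
  show "smooth_on S (\<lambda>q. sharp g q (P q v))" for v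
    by (rule smooth_sharp) (rule smooth_bilinearD[OF assms])
qed

lemma smooth_chr: "smooth_bilinear S chr"
proof -
  note l1 = linear_simps[OF smooth_form_deriv_linear[OF open_S smooth_bilinearD(1)[OF smooth_ip]]]
  note l2 = linear_simps[OF smooth_form_deriv_linear[OF open_S smooth_bilinearD(2)[OF smooth_ip]]]
  note l3 = linear_simps[OF smooth_formD(1)[OF smooth_form_direction[OF open_S smooth_bilinearD(3)[OF smooth_ip]]]]
  have "bilinear (chr q)" if q: "q \<in> S" for q
    unfolding bilinear_def christoffel_def
    by (intro conjI allI linearI; unfold sharp_add[symmetric] sharp_scaleR[symmetric];
        intro arg_cong[where f = "sharp g q"] ext; simp add: l1[OF q] l2[OF q] l3[OF q] field_simps)
  moreover have "smooth_on S (\<lambda>q. chr q x y)" for x y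
    unfolding christoffel_def
    by (rule smooth_sharp) (intro smooth_intros smooth_bilinearD[OF smooth_ip])
  ultimately show ?thesis
    by (simp add: smooth_bilinear_def)
qed

lemmas chr_bilinear = smooth_bilinearD(4)[OF smooth_chr]
lemmas chr_simps = bilinear_simps[OF chr_bilinear]

lemma chr_sym: "p \<in> S \<Longrightarrow> chr p x y = chr p y x"
  by (rule levi_civita(1)[of S]) (auto intro: ip_sym ip_pos smooth_on_differentiable smooth_g open_S)

lemma dirder_ip_const:
  assumes p: "p \<in> S"
  shows "\<partial> (\<lambda>q. ip g q y z) p x = ip g p (chr p x y) z + ip g p y (chr p x z)"
proof -
  have "cov2 g (ip g) p x y z = 0"
    by (rule levi_civita(2)[of S]) (auto intro: ip_sym ip_pos smooth_on_differentiable smooth_g open_S p)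
  then show ?thesis by (simp add: cov2_def)
qed

lemma dirder_ip:
  assumes "smooth_on S X" "smooth_on S Y" "p \<in> S"
  shows "\<partial> (\<lambda>q. ip g q (X q) (Y q)) p h =
    ip g p (\<partial> X p h + chr p h (X p)) (Y p) + ip g p (X p) (\<partial> Y p h + chr p h (Y p))"
  by (simp add: smooth_bilinear_app(2)[OF open_S smooth_ip assms] dirder_ip_const[OF assms(3)] ip_simps)

abbreviation Rv where "Rv q x y w \<equiv> riem_field g (\<lambda>_. x) (\<lambda>_. y) (\<lambda>_. w) q"

abbreviation dchr where "dchr p h x y \<equiv> \<partial> (\<lambda>q. chr q x y) p h"

text \<open>Constant fields have zero derivatives and commute, so only Christoffel symbols and their
  first derivatives remain.\<close>

lemma Rv_eq:
  "p \<in> S \<Longrightarrow> Rv p x y w = - dchr p x y w - chr p x (chr p y w) + dchr p y x w + chr p y (chr p x w)"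
  by (simp add: riem_field_def cov_vec_def[abs_def] lie_bracket_def chr_simps)

lemma chr_smooth_forms:
  "smooth_form S (\<lambda>q. chr q x)" "smooth_form S (\<lambda>q v. chr q v x)" "smooth_on S (\<lambda>q. chr q x y)"
  using smooth_bilinearD[OF smooth_chr] by auto

lemma smooth_Rv: "smooth_form S (\<lambda>q x. Rv q x y w)" "smooth_form S (\<lambda>q y. Rv q x y w)"
  "smooth_form S (\<lambda>q w. Rv q x y w)"
proof -
  let ?R = "\<lambda>q x y w. - dchr q x y w - chr q x (chr q y w) + dchr q y x w + chr q y (chr q x w)"
  have sm: "smooth_on S (\<lambda>q. ?R q x y w)" for x y w
    by (intro smooth_intros smooth_bilinear_app(1)[OF open_S smooth_chr] chr_smooth_forms)
  have "smooth_on S (\<lambda>q. Rv q x y w)" for x y w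
    by (rule smooth_cong_chart[OF _ sm]) (simp add: Rv_eq)
  moreover have "linear (\<lambda>x. Rv q x y w)" "linear (\<lambda>y. Rv q x y w)" "linear (\<lambda>w. Rv q x y w)"
    if q: "q \<in> S" for q x y w
  proof -
    note l = linear_simps[OF smooth_form_deriv_linear[OF open_S chr_smooth_forms(1) q]]
      linear_simps[OF smooth_form_deriv_linear[OF open_S chr_smooth_forms(2) q]]
      linear_simps[OF smooth_formD(1)[OF smooth_form_direction[OF open_S chr_smooth_forms(3)] q]]
    show "linear (\<lambda>x. Rv q x y w)" "linear (\<lambda>y. Rv q x y w)" "linear (\<lambda>w. Rv q x y w)"
      by (rule linearI; simp add: Rv_eq[OF q] l chr_simps[OF q] algebra_simps)+
  qed
  ultimately show "smooth_form S (\<lambda>q x. Rv q x y w)" "smooth_form S (\<lambda>q y. Rv q x y w)"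
    "smooth_form S (\<lambda>q w. Rv q x y w)"
    by (simp_all add: smooth_form_def)
qed

end

section \<open>Contraction, curvature and the Bianchi identities\<close>

lemma contract_add: "contract g p (\<lambda>a b. T a b + T' a b) = contract g p T + contract g p T'"
  by (simp add: contract_def distrib_left sum.distrib)

lemma contract_diff: "contract g p (\<lambda>a b. T a b - T' a b) = contract g p T - contract g p T'"
  by (simp add: contract_def right_diff_distrib sum_subtractf)

lemma contract_minus: "contract g p (\<lambda>a b. - T a b) = - contract g p T"
  by (simp add: contract_def sum_negf)

lemma contract_cmult: "contract g p (\<lambda>a b. c * T a b) = c * contract g p T"
  by (simp add: contract_def sum_distrib_left mult_ac)

lemma contract_cmult_right: "contract g p (\<lambda>a b. T a b * c) = contract g p T * c"
  using contract_cmult[of g p c T] by (simp add: mult.commute)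

lemma contract_zero: "contract g p (\<lambda>a b. 0) = 0"
  by (simp add: contract_def)

text \<open>\<open>contract\<close> evaluates on coordinate vectors only, so this is an interchange
  of finite sums for arbitrary \<open>F\<close>.\<close>

lemma contract_swap:
  "contract g p (\<lambda>a a'. contract g p (\<lambda>b b'. F a a' b b')) = contract g p (\<lambda>b b'. contract g p (\<lambda>a a'. F a a' b b'))"
proof -
  let ?G = "\<lambda>i j. matrix_inv (g p) $ i $ j" and ?e = "\<lambda>i. axis i 1"
  have "(\<Sum>i\<in>UNIV. \<Sum>j\<in>UNIV. \<Sum>k\<in>UNIV. \<Sum>l\<in>UNIV. ?G i j * (?G k l * F (?e i) (?e j) (?e k) (?e l))) =
    (\<Sum>i\<in>UNIV. \<Sum>k\<in>UNIV. \<Sum>j\<in>UNIV. \<Sum>l\<in>UNIV. ?G i j * (?G k l * F (?e i) (?e j) (?e k) (?e l)))"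
    by (intro sum.cong refl sum.swap)
  also have "\<dots> = (\<Sum>k\<in>UNIV. \<Sum>i\<in>UNIV. \<Sum>l\<in>UNIV. \<Sum>j\<in>UNIV. ?G i j * (?G k l * F (?e i) (?e j) (?e k) (?e l)))"
    by (subst sum.swap) (intro sum.cong refl sum.swap)
  also have "\<dots> = (\<Sum>k\<in>UNIV. \<Sum>l\<in>UNIV. \<Sum>i\<in>UNIV. \<Sum>j\<in>UNIV. ?G i j * (?G k l * F (?e i) (?e j) (?e k) (?e l)))"
    by (intro sum.cong refl sum.swap)
  finally show ?thesis
    by (simp add: contract_def sum_distrib_left mult.left_commute)
qed

text \<open>Rank four is needed for the covariant derivative of the curvature tensor in the second
  Bianchi identity; \<open>x\<close> is the direction of differentiation.\<close>

definition cov4 ::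
  "'n::finite metric \<Rightarrow> (real^'n \<Rightarrow> real^'n \<Rightarrow> real^'n \<Rightarrow> real^'n \<Rightarrow> real^'n \<Rightarrow> real) \<Rightarrow>
   real^'n \<Rightarrow> real^'n \<Rightarrow> real^'n \<Rightarrow> real^'n \<Rightarrow> real^'n \<Rightarrow> real^'n \<Rightarrow> real" where
  "cov4 g T p x y z w u =
     \<partial> (\<lambda>q. T q y z w u) p x - T p (christoffel g p x y) z w u
       - T p y (christoffel g p x z) w u - T p y z (christoffel g p x w) u
       - T p y z w (christoffel g p x u)"

context local_metric begin

lemma dirder_chr_sym: "p \<in> S \<Longrightarrow> dchr p h x y = dchr p h y x"
  by (rule dirder_cong_chart) (auto intro: chr_sym)

lemma cov2_smooth:
  assumes T: "smooth_bilinear S T"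
  shows "smooth_form S (\<lambda>q x. cov2 g T q x y z)" "smooth_form S (\<lambda>q y. cov2 g T q x y z)"
    "smooth_form S (\<lambda>q z. cov2 g T q x y z)" "smooth_on S (\<lambda>q. cov2 g T q x y z)"
    "smooth_bilinear S (\<lambda>q x y. cov2 g T q x y z)" "smooth_bilinear S (\<lambda>q x. cov2 g T q x y)"
    "smooth_bilinear S (\<lambda>q y. cov2 g T q x y)"
proof -
  have sm: "smooth_on S (\<lambda>q. cov2 g T q x y z)" for x y z
    unfolding cov2_def
    by (intro smooth_intros smooth_bilinear_app(1)[OF open_S T] smooth_bilinearD(3)[OF T] chr_smooth_forms(3))
  have lin: "linear (\<lambda>x. cov2 g T q x y z)" "linear (\<lambda>y. cov2 g T q x y z)" "linear (\<lambda>z. cov2 g T q x y z)"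
    if q: "q \<in> S" for q x y z
  proof -
    note l = linear_simps[OF smooth_form_deriv_linear[OF open_S smooth_bilinearD(1)[OF T] q]]
      linear_simps[OF smooth_form_deriv_linear[OF open_S smooth_bilinearD(2)[OF T] q]]
      linear_simps[OF smooth_formD(1)[OF smooth_form_direction[OF open_S smooth_bilinearD(3)[OF T]] q]]
      bilinear_simps[OF smooth_bilinearD(4)[OF T q]] chr_simps[OF q]
    show "linear (\<lambda>x. cov2 g T q x y z)" "linear (\<lambda>y. cov2 g T q x y z)" "linear (\<lambda>z. cov2 g T q x y z)"
      by (rule linearI; simp add: cov2_def l algebra_simps)+
  qed
  show "smooth_form S (\<lambda>q x. cov2 g T q x y z)" "smooth_form S (\<lambda>q y. cov2 g T q x y z)"
    "smooth_form S (\<lambda>q z. cov2 g T q x y z)" "smooth_on S (\<lambda>q. cov2 g T q x y z)"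
    "smooth_bilinear S (\<lambda>q x y. cov2 g T q x y z)" "smooth_bilinear S (\<lambda>q x. cov2 g T q x y)"
    "smooth_bilinear S (\<lambda>q y. cov2 g T q x y)"
    using sm lin by (simp_all add: smooth_form_def smooth_bilinear_def bilinear_def)
qed

text \<open>Second partial derivatives cancel by symmetry, and the corrections in the slot
  \<open>y\<close> by the absence of torsion. The curvature acts on covariant slots with a plus sign
  because \<open>Rv\<close> is minus the commutator of covariant derivatives.\<close>

lemma ricci_identity:
  assumes T: "smooth_bilinear S T" and p: "p \<in> S"
  shows "cov3 g (cov2 g T) p x y z w - cov3 g (cov2 g T) p y x z w =
    T p (Rv p x y z) w + T p z (Rv p x y w)"
proof -
  note b = bilinear_simps[OF smooth_bilinearD(4)[OF T p]]
  have D: "\<partial> (\<lambda>q. cov2 g T q y z w) p x =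
      \<partial> (\<lambda>q. \<partial> (\<lambda>q. T q z w) q y) p x
      - (\<partial> (\<lambda>q. T q (chr p y z) w) p x + T p (dchr p x y z) w)
      - (\<partial> (\<lambda>q. T q z (chr p y w)) p x + T p z (dchr p x y w))" for x y
  proof -
    note s = smooth_bilinear_app(1)[OF open_S T chr_smooth_forms(3) smooth_on_const]
      smooth_bilinear_app(1)[OF open_S T smooth_on_const chr_smooth_forms(3)]
      smooth_bilinearD(3)[OF T]
    show ?thesis
      unfolding cov2_def
      by (simp add: dirder_diff s smooth_on_diff[OF open_S] smooth_on_deriv p b
          smooth_bilinear_app(2)[OF open_S T chr_smooth_forms(3) smooth_on_const p]
          smooth_bilinear_app(2)[OF open_S T smooth_on_const chr_smooth_forms(3) p])
  qed
  have "\<partial> (\<lambda>q. \<partial> (\<lambda>q. T q z w) q y) p x = \<partial> (\<lambda>q. \<partial> (\<lambda>q. T q z w) q x) p y"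
    by (rule second_derivative_symmetric[OF open_S smooth_bilinearD(3)[OF T] p])
  then show ?thesis
    unfolding cov3_def D
    by (simp add: cov2_def Rv_eq[OF p] b chr_sym[OF p, of y x])
qed

lemma Rv_skew: "p \<in> S \<Longrightarrow> Rv p x y w = - Rv p y x w"
  by (simp add: Rv_eq)

text \<open>Symmetry of the Christoffel symbols, and hence of their derivatives, makes the terms of
  the cyclic sum cancel in pairs.\<close>

lemma bianchi_first:
  assumes p: "p \<in> S"
  shows "Rv p x y z + Rv p y z x + Rv p z x y = 0"
proof -
  note s = chr_sym[OF p, of y x] chr_sym[OF p, of z x] chr_sym[OF p, of z y]
    dirder_chr_sym[OF p, where x = y and y = x] dirder_chr_sym[OF p, where x = z and y = x]
    dirder_chr_sym[OF p, where x = z and y = y]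
  show ?thesis
    unfolding Rv_eq[OF p] s by simp
qed

lemma Rv_linear: "p \<in> S \<Longrightarrow> linear (\<lambda>x. Rv p x y w)" "p \<in> S \<Longrightarrow> linear (\<lambda>y. Rv p x y w)"
  "p \<in> S \<Longrightarrow> linear (\<lambda>w. Rv p x y w)"
  using smooth_formD(1)[OF smooth_Rv(1)] smooth_formD(1)[OF smooth_Rv(2)] smooth_formD(1)[OF smooth_Rv(3)]
  by auto

lemmas Rv_simps = linear_simps[OF Rv_linear(1)] linear_simps[OF Rv_linear(2)] linear_simps[OF Rv_linear(3)]

text \<open>\<open>E x y z\<close> is the commutator of the covariant derivative along
  \<open>x\<close> with the operator \<open>Rv p y z\<close>, applied to the constant field
  \<open>w\<close>. For commuting coordinate fields the claim is the Jacobi identity for three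
  covariant derivatives; the corrections in the slots \<open>y\<close> and \<open>z\<close> are left
  out here.\<close>

lemma bianchi_second_vec:
  fixes w :: "real^'n"
  assumes p: "p \<in> S"
  defines "E \<equiv> \<lambda>x y z. \<partial> (\<lambda>q. Rv q y z w) p x + chr p x (Rv p y z w) - Rv p y z (chr p x w)"
  shows "E x y z + E y z x + E z x y = 0"
proof -
  have s: "smooth_on S (\<lambda>q. chr q a (chr q b c))" for a b c
    by (intro smooth_bilinear_app(1)[OF open_S smooth_chr] smooth_intros chr_smooth_forms)
  have c: "\<partial> (\<lambda>q. chr q a (chr q b c)) p h = dchr p h a (chr p b c) + chr p a (dchr p h b c)" for a b c h
    using dirder_app[OF open_S chr_smooth_forms(1,3) p] by simp
  have D: "\<partial> (\<lambda>q. Rv q y z w) p x =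
      - \<partial> (\<lambda>q. dchr q y z w) p x - (dchr p x y (chr p z w) + chr p y (dchr p x z w))
      + \<partial> (\<lambda>q. dchr q z y w) p x + (dchr p x z (chr p y w) + chr p z (dchr p x y w))" for x y z
  proof -
    have "\<partial> (\<lambda>q. Rv q y z w) p x =
        \<partial> (\<lambda>q. - dchr q y z w - chr q y (chr q z w) + dchr q z y w + chr q z (chr q y w)) p x"
      by (rule dirder_cong_chart[OF p]) (rule Rv_eq)
    then show ?thesis
      by (simp add: dirder_add dirder_diff dirder_minus smooth_intros chr_smooth_forms s c p)
  qed
  have sy: "\<partial> (\<lambda>q. dchr q a b w) p c = \<partial> (\<lambda>q. dchr q c b w) p a" for a b c
    by (rule second_derivative_symmetric[OF open_S chr_smooth_forms(3) p])
  show ?thesis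
    unfolding E_def D Rv_eq[OF p]
    by (simp add: chr_simps[OF p] sy[where a = y and b = z and c = x]
        sy[where a = z and b = x and c = y] sy[where a = z and b = y and c = x])
qed

abbreviation Rm where "Rm \<equiv> riem g"

lemma Rm_simps:
  assumes "p \<in> S"
  shows "Rm p (x + x') y z w = Rm p x y z w + Rm p x' y z w"
    "Rm p x (y + y') z w = Rm p x y z w + Rm p x y' z w"
    "Rm p x y (z + z') w = Rm p x y z w + Rm p x y z' w"
    "Rm p x y z (w + w') = Rm p x y z w + Rm p x y z w'"
    "Rm p (c *\<^sub>R x) y z w = c * Rm p x y z w" "Rm p x (c *\<^sub>R y) z w = c * Rm p x y z w"
    "Rm p x y (c *\<^sub>R z) w = c * Rm p x y z w" "Rm p x y z (c *\<^sub>R w) = c * Rm p x y z w"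
  by (simp_all add: riem_def Rv_simps[OF assms] ip_simps)

lemma Rv_smooth: "smooth_on S (\<lambda>q. Rv q x y w)"
  by (rule smooth_formD(2)[OF smooth_Rv(1)])

lemma Rm_smooth: "smooth_on S (\<lambda>q. Rm q x y z w)"
  unfolding riem_def by (intro smooth_bilinear_app(1)[OF open_S smooth_ip] Rv_smooth smooth_on_const)

lemma Rm_skew12: "p \<in> S \<Longrightarrow> Rm p x y z w = - Rm p y x z w"
  unfolding riem_def using Rv_skew[of p x y z] by (simp add: ip_simps)

text \<open>The metric is parallel, so the Ricci identity applied to it has left side 0.\<close>

lemma Rm_skew34:
  assumes p: "p \<in> S"
  shows "Rm p x y z w = - Rm p x y w z"
proof -
  have c: "cov2 g (ip g) q y z w = 0" if "q \<in> S" for q y z w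
    by (simp add: cov2_def dirder_ip_const[OF that])
  have "cov3 g (cov2 g (ip g)) p x y z w = 0" for x y
    unfolding cov3_def using dirder_cong_chart[OF p, of "\<lambda>q. cov2 g (ip g) q y z w" "\<lambda>q. 0" x]
    by (simp add: c p)
  then have "ip g p (Rv p x y z) w + ip g p z (Rv p x y w) = 0"
    using ricci_identity[OF smooth_ip p, of x y z w] by simp
  then show ?thesis
    by (simp add: riem_def ip_sym[OF p, of z])
qed

lemma Rm_cyclic: "p \<in> S \<Longrightarrow> Rm p x y z w + Rm p y z x w + Rm p z x y w = 0"
  unfolding riem_def using bianchi_first[of p x y z] by (metis ip_simps(1,9))

text \<open>The usual octahedron argument: four instances of the cyclic identity combined with the
  two skew symmetries.\<close>

lemma Rm_pair:
  assumes p: "p \<in> S"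
  shows "Rm p x y z w = Rm p z w x y"
  using Rm_cyclic[OF p, of x y z w] Rm_cyclic[OF p, of y z w x] Rm_cyclic[OF p, of z w x y]
    Rm_cyclic[OF p, of w x y z] Rm_skew34[OF p] Rm_skew12[OF p]
  by (smt (verit))

section \<open>Traces written with the metric duals of the coordinate covectors\<close>

definition dual_basis where "dual_basis p i = sharp g p (\<lambda>z. z $ i)"

lemma ip_dual_basis: "p \<in> S \<Longrightarrow> ip g p (dual_basis p i) z = z $ i"
  unfolding dual_basis_def by (rule ip_sharp_chart) (auto intro!: linearI)

lemma dual_basis_smooth: "smooth_on S (\<lambda>q. dual_basis q i)"
  unfolding dual_basis_def by (rule smooth_sharp) (rule smooth_on_const)

lemma dual_basis_nth: "dual_basis p i $ k = matrix_inv (g p) $ k $ i"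
  by (simp add: dual_basis_def sharp_def matrix_vector_mult_def axis_def if_distrib cong: if_cong)

lemma matrix_inv_sym: "p \<in> S \<Longrightarrow> matrix_inv (g p) $ i $ j = matrix_inv (g p) $ j $ i"
  by (metis ip_dual_basis ip_sym dual_basis_nth)

lemma contract_flip: "p \<in> S \<Longrightarrow> contract g p (\<lambda>a b. T b a) = contract g p T"
  unfolding contract_def by (subst sum.swap) (simp add: matrix_inv_sym[of p])

lemma linear_expand_axis:
  fixes v :: "real^'m"
  assumes "linear L"
  shows "L v = (\<Sum>i\<in>UNIV. v $ i *\<^sub>R L (axis i 1))"
proof -
  have "v = (\<Sum>i\<in>UNIV. v $ i *\<^sub>R axis i 1)"
    by (simp add: basis_expansion flip: scalar_mult_eq_scaleR)
  then have "L v = L (\<Sum>i\<in>UNIV. v $ i *\<^sub>R axis i 1)"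
    by simp
  then show ?thesis
    by (simp add: linear_sum[OF assms] linear_cmul[OF assms])
qed

text \<open>Absorbing the inverse metric into one frame leaves a sum over a single index, which can
  be differentiated slot by slot and spares the construction of a smooth orthonormal frame.\<close>

lemma contract_dual_basis:
  assumes "bilinear T"
  shows "contract g p T = (\<Sum>i\<in>UNIV. T (dual_basis p i) (axis i 1))"
proof -
  have "T (dual_basis p i) y = (\<Sum>k\<in>UNIV. matrix_inv (g p) $ k $ i * T (axis k 1) y)" for i y
    using linear_expand_axis[of "\<lambda>x. T x y" "dual_basis p i"] assms by (simp add: bilinear_def dual_basis_nth)
  then show ?thesis
    unfolding contract_def by (subst sum.swap) simp
qed

lemma contract_ip:
  assumes p: "p \<in> S" and F: "linear F"
  shows "contract g p (\<lambda>a b. F a * ip g p u b) = F u" "contract g p (\<lambda>a b. ip g p u a * F b) = F u"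
proof -
  have "bilinear (\<lambda>a b. ip g p u a * F b)"
    unfolding bilinear_def
    by (auto intro!: linearI simp: linear_simps[OF F] ip_simps distrib_left distrib_right)
  then have "contract g p (\<lambda>a b. ip g p u a * F b) = (\<Sum>i\<in>UNIV. u $ i * F (axis i 1))"
    by (simp add: contract_dual_basis ip_sym[OF p, of u] ip_dual_basis[OF p])
  also have "\<dots> = F u"
    using linear_expand_axis[OF F, of u] by simp
  finally show *: "contract g p (\<lambda>a b. ip g p u a * F b) = F u" .
  show "contract g p (\<lambda>a b. F a * ip g p u b) = F u"
    using * contract_flip[OF p, of "\<lambda>a b. ip g p u a * F b"] by (simp add: mult.commute)
qed

lemma contract_sharp:
  assumes p: "p \<in> S" and F: "linear F" and H: "linear H"
  shows "contract g p (\<lambda>a b. F a * H b) = F (sharp g p H)"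
  using contract_ip(1)[OF p F, of "sharp g p H"] by (simp add: ip_sharp_chart[OF p H])

text \<open>Differentiate the constant pairing \<open>ip g q (dual_basis q i) z = z $ i\<close> and
  use nondegeneracy; the sum is the transpose of the Christoffel matrix acting on the dual
  frame.\<close>

lemma dirder_dual_basis:
  assumes p: "p \<in> S"
  shows "\<partial> (\<lambda>q. dual_basis q i) p x =
    - chr p x (dual_basis p i) - (\<Sum>k\<in>UNIV. chr p x (axis k 1) $ i *\<^sub>R dual_basis p k)"
proof (rule ip_eqI[OF p])
  fix z
  have "\<partial> (\<lambda>q. ip g q (dual_basis q i) z) p x = \<partial> (\<lambda>q. z $ i) p x"
    by (rule dirder_cong_chart[OF p]) (rule ip_dual_basis)
  then have "0 = ip g p (\<partial> (\<lambda>q. dual_basis q i) p x + chr p x (dual_basis p i)) z + chr p x z $ i"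
    by (simp add: dirder_ip[OF dual_basis_smooth smooth_on_const p] ip_dual_basis[OF p])
  moreover have "ip g p (\<Sum>k\<in>UNIV. chr p x (axis k 1) $ i *\<^sub>R dual_basis p k) z = chr p x z $ i"
  proof -
    have 1: "linear (\<lambda>v. ip g p v z)" and 2: "linear (\<lambda>v. chr p x v $ i)"
      by (auto intro!: linearI simp: ip_simps chr_simps[OF p])
    show ?thesis
      using linear_expand_axis[OF 2, of z]
      by (simp add: linear_sum[OF 1] ip_simps ip_dual_basis[OF p] mult.commute)
  qed
  ultimately show "ip g p (\<partial> (\<lambda>q. dual_basis q i) p x) z =
      ip g p (- chr p x (dual_basis p i) - (\<Sum>k\<in>UNIV. chr p x (axis k 1) $ i *\<^sub>R dual_basis p k)) z"
    by (simp add: ip_simps)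
qed

text \<open>Metric traces commute with covariant differentiation: of the two terms in the derivative
  of the dual frame, one is the Christoffel correction in the first slot and the other becomes that
  in the second slot.\<close>

lemma dirder_contract:
  assumes T: "smooth_bilinear S T" and p: "p \<in> S"
  shows "\<partial> (\<lambda>q. contract g q (T q)) p x = contract g p (cov2 g T p x)"
proof -
  note b = bilinear_simps[OF smooth_bilinearD(4)[OF T p]]
  have l: "linear (\<lambda>u. T p u v)" "linear (T p v)" for v
    using smooth_bilinearD(4)[OF T p] by (auto simp: bilinear_def)
  have sm: "smooth_on S (\<lambda>q. T q (dual_basis q i) v)" for i v
    by (intro smooth_bilinear_app(1)[OF open_S T] dual_basis_smooth smooth_on_const)
  \<comment> \<open>Exchanging the two sums carries the transposed Christoffel matrix from the dual
    frame over to the coordinate vectors.\<close>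
  have "(\<Sum>i\<in>UNIV. T p (\<Sum>k\<in>UNIV. chr p x (axis k 1) $ i *\<^sub>R dual_basis p k) (axis i 1)) =
      (\<Sum>i\<in>UNIV. \<Sum>k\<in>UNIV. chr p x (axis k 1) $ i * T p (dual_basis p k) (axis i 1))"
    by (simp add: linear_sum[OF l(1)] linear_cmul[OF l(1)])
  also have "\<dots> = (\<Sum>k\<in>UNIV. T p (dual_basis p k) (chr p x (axis k 1)))"
    by (subst sum.swap) (simp add: linear_expand_axis[OF l(2), of _ "chr p x (axis _ 1)"])
  finally have swap: "(\<Sum>i\<in>UNIV. T p (\<Sum>k\<in>UNIV. chr p x (axis k 1) $ i *\<^sub>R dual_basis p k) (axis i 1)) =
      (\<Sum>k\<in>UNIV. T p (dual_basis p k) (chr p x (axis k 1)))" .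
  have "\<partial> (\<lambda>q. contract g q (T q)) p x = \<partial> (\<lambda>q. \<Sum>i\<in>UNIV. T q (dual_basis q i) (axis i 1)) p x"
    by (rule dirder_cong_chart[OF p]) (rule contract_dual_basis[OF smooth_bilinearD(4)[OF T]])
  also have "\<dots> = (\<Sum>i\<in>UNIV. \<partial> (\<lambda>q. T q (dual_basis q i) (axis i 1)) p x)"
    by (rule dirder_eqI, rule has_derivative_sum, rule has_derivative_chart[OF sm p])
  also have "\<dots> = (\<Sum>i\<in>UNIV. \<partial> (\<lambda>q. T q (dual_basis p i) (axis i 1)) p x - T p (chr p x (dual_basis p i)) (axis i 1)
      - T p (\<Sum>k\<in>UNIV. chr p x (axis k 1) $ i *\<^sub>R dual_basis p k) (axis i 1))"
    by (simp add: smooth_bilinear_app(2)[OF open_S T dual_basis_smooth smooth_on_const p] dirder_dual_basis[OF p] b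
        add_diff_eq[symmetric] algebra_simps)
  also have "\<dots> = (\<Sum>i\<in>UNIV. cov2 g T p x (dual_basis p i) (axis i 1))"
    by (simp add: sum_subtractf swap cov2_def)
  also have "\<dots> = contract g p (cov2 g T p x)"
    by (rule contract_dual_basis[symmetric]) (rule smooth_bilinearD(4)[OF cov2_smooth(7)[OF T] p])
  finally show ?thesis .
qed

section \<open>The divergence of the Ricci tensor\<close>

lemma Rm_smooth_bilinear: "smooth_bilinear S (\<lambda>q a b. Rm q a y b z)"
  unfolding smooth_bilinear_def bilinear_def
  by (auto intro!: linearI simp: Rm_simps Rm_smooth)

lemma smooth_contract:
  assumes "\<And>a b. smooth_on S (\<lambda>q. T q a b)"
  shows "smooth_on S (\<lambda>q. contract g q (T q))"
  unfolding contract_def by (intro smooth_intros smooth_matrix_inv assms)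

abbreviation Ric where "Ric \<equiv> ricci g"

lemma Ric_smooth: "smooth_bilinear S Ric"
proof -
  have "smooth_on S (\<lambda>q. Ric q y z)" for y z
    unfolding ricci_def by (rule smooth_contract) (rule Rm_smooth)
  then show ?thesis
    unfolding smooth_bilinear_def bilinear_def
    by (auto intro!: linearI simp: ricci_def Rm_simps contract_add contract_cmult)
qed

lemma Ric_sym: "p \<in> S \<Longrightarrow> Ric p y z = Ric p z y"
  unfolding ricci_def using contract_flip[of p "\<lambda>a b. Rm p b z a y"] by (simp add: Rm_pair[of p _ y _ z])

lemma scal_smooth: "smooth_on S (scal g)"
proof -
  have "smooth_on S (\<lambda>q. contract g q (Ric q))"
    by (rule smooth_contract) (rule smooth_bilinearD(3)[OF Ric_smooth])
  then show ?thesis by (simp add: scal_def[abs_def])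
qed

text \<open>The trace runs over the slots \<open>a\<close> and \<open>b\<close> with
  \<open>y\<close> and \<open>z\<close> frozen; the corrections in \<open>y\<close> and
  \<open>z\<close> are the same on both sides.\<close>

lemma cov2_Ric:
  assumes p: "p \<in> S"
  shows "cov2 g Ric p x y z = contract g p (\<lambda>a b. cov4 g Rm p x a y b z)"
proof -
  have "\<partial> (\<lambda>q. Ric q y z) p x = contract g p (\<lambda>a b. cov2 g (\<lambda>q a b. Rm q a y b z) p x a b)"
    unfolding ricci_def by (rule dirder_contract[OF Rm_smooth_bilinear p])
  then show ?thesis
    by (simp add: cov2_def cov4_def ricci_def contract_diff)
qed

lemma cov4_Rm_skew12: "p \<in> S \<Longrightarrow> cov4 g Rm p x y z w u = - cov4 g Rm p x z y w u"
  unfolding cov4_def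
  using dirder_cong_chart[of p "\<lambda>q. Rm q y z w u" "\<lambda>q. - Rm q z y w u" x]
  by (simp add: Rm_skew12[of _ y z] dirder_minus Rm_smooth
      Rm_skew12[of p "chr p x y" z] Rm_skew12[of p y "chr p x z"])

lemma cov4_Rm_pair: "p \<in> S \<Longrightarrow> cov4 g Rm p x y z w u = cov4 g Rm p x w u y z"
  unfolding cov4_def
  using dirder_cong_chart[of p "\<lambda>q. Rm q y z w u" "\<lambda>q. Rm q w u y z" x]
  by (simp add: Rm_pair[of _ y z w u] Rm_pair[of p "chr p x y" z w u] Rm_pair[of p y "chr p x z" w u]
      Rm_pair[of p y z "chr p x w" u] Rm_pair[of p y z w "chr p x u"])

text \<open>What \<open>bianchi_second_vec\<close> omits, the corrections in the two slots of the
  2-form, cancels in the cyclic sum because \<open>chr\<close> is symmetric and \<open>Rm\<close> is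
  skew in these slots.\<close>

lemma bianchi_second:
  assumes p: "p \<in> S"
  shows "cov4 g Rm p x y z w u + cov4 g Rm p y z x w u + cov4 g Rm p z x y w u = 0"
proof -
  have c: "cov4 g Rm p x y z w u =
      ip g p (\<partial> (\<lambda>q. Rv q y z w) p x + chr p x (Rv p y z w) - Rv p y z (chr p x w)) u
      - Rm p (chr p x y) z w u - Rm p y (chr p x z) w u" for x y z
  proof -
    have "\<partial> (\<lambda>q. Rm q y z w u) p x =
        ip g p (\<partial> (\<lambda>q. Rv q y z w) p x + chr p x (Rv p y z w)) u + Rm p y z w (chr p x u)"
      unfolding riem_def by (simp add: dirder_ip[OF Rv_smooth smooth_on_const p])
    then show ?thesis
      by (simp add: cov4_def riem_def ip_simps)
  qed
  have "ip g p (\<partial> (\<lambda>q. Rv q y z w) p x + chr p x (Rv p y z w) - Rv p y z (chr p x w)) u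
      + ip g p (\<partial> (\<lambda>q. Rv q z x w) p y + chr p y (Rv p z x w) - Rv p z x (chr p y w)) u
      + ip g p (\<partial> (\<lambda>q. Rv q x y w) p z + chr p z (Rv p x y w) - Rv p x y (chr p z w)) u = 0"
    unfolding ip_simps(1)[symmetric] bianchi_second_vec[OF p] by (simp add: ip_simps)
  moreover have "Rm p (chr p x y) z w u = - Rm p z (chr p y x) w u"
    "Rm p (chr p y z) x w u = - Rm p x (chr p z y) w u" "Rm p (chr p z x) y w u = - Rm p y (chr p x z) w u"
    using Rm_skew12[OF p] chr_sym[OF p] by metis+
  ultimately show ?thesis
    unfolding c by linarith
qed

text \<open>Pair symmetry moves the divergence slot \<open>b\<close> into the second pair. The
  Bianchi identity for \<open>a\<close>, \<open>z\<close>, \<open>w\<close> then turns the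
  differentiation along \<open>a\<close> into differentiations along \<open>z\<close> and
  \<open>w\<close>, and the remaining trace over \<open>a\<close>, \<open>b\<close> is a Ricci
  trace.\<close>

lemma div_Rm:
  assumes p: "p \<in> S"
  shows "contract g p (\<lambda>a b. cov4 g Rm p a b y z w) = d_ricci g p z w y"
proof -
  have "cov4 g Rm p a b y z w = cov4 g Rm p z a w b y - cov4 g Rm p w a z b y" for a b
    using bianchi_second[OF p, of a z w b y] cov4_Rm_pair[OF p, of a b y z w]
      cov4_Rm_skew12[OF p, of z a w b y] by simp
  then show ?thesis
    by (simp add: contract_diff cov2_Ric[OF p] d_ricci_def)
qed

lemma cov2_Ric_sym: "p \<in> S \<Longrightarrow> cov2 g Ric p x y z = cov2 g Ric p x z y"
  unfolding cov2_def using dirder_cong_chart[of p "\<lambda>q. Ric q y z" "\<lambda>q. Ric q z y" x]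
  by (simp add: Ric_sym[of _ y z] Ric_sym[of p "chr p x y" z] Ric_sym[of p y "chr p x z"])

lemma dirder_scal: "p \<in> S \<Longrightarrow> \<partial> (scal g) p x = contract g p (cov2 g Ric p x)"
  using dirder_contract[OF Ric_smooth, of p x] by (simp add: scal_def[abs_def])

text \<open>Trace \<open>div_Rm\<close> once more, over \<open>z\<close> and \<open>y\<close>: the
  left side becomes - div Ric, while the right side is div Ric - dR.\<close>

lemma div_Ric:
  assumes p: "p \<in> S"
  shows "contract g p (\<lambda>a b. cov2 g Ric p a b w) = 1/2 * \<partial> (scal g) p w"
proof -
  have inner: "contract g p (\<lambda>z y. cov4 g Rm p a b y z w) = - cov2 g Ric p a b w" for a b
  proof -
    have "contract g p (\<lambda>z y. cov4 g Rm p a b y z w) = - contract g p (\<lambda>z y. cov4 g Rm p a y b z w)"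
      unfolding contract_minus[symmetric] using cov4_Rm_skew12[OF p] by metis
    then show ?thesis
      by (simp add: contract_flip[OF p, of "\<lambda>y z. cov4 g Rm p a y b z w"] cov2_Ric[OF p])
  qed
  have "contract g p (\<lambda>z y. d_ricci g p z w y) = - contract g p (\<lambda>a b. cov2 g Ric p a b w)"
    unfolding div_Rm[OF p, symmetric] contract_swap[of g p "\<lambda>z y a b. cov4 g Rm p a b y z w"] inner
    by (rule contract_minus)
  moreover have "contract g p (\<lambda>z y. d_ricci g p z w y) =
      contract g p (\<lambda>a b. cov2 g Ric p a b w) - \<partial> (scal g) p w"
    by (simp add: d_ricci_def contract_diff dirder_scal[OF p] cov2_Ric_sym[OF p, of _ w])
  ultimately show ?thesis by simp
qed

text \<open>This is the covariant derivative of \<open>div_Ric\<close> along \<open>x\<close>, taken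
  under the trace.\<close>

lemma div_cov2_Ric:
  assumes p: "p \<in> S"
  shows "contract g p (\<lambda>a b. cov3 g (cov2 g Ric) p x a b z) = 1/2 * hess g (scal g) p x z"
proof -
  let ?T = "\<lambda>q a b. cov2 g Ric q a b z"
  have "\<partial> (\<lambda>q. contract g q (?T q)) p x = contract g p (cov2 g ?T p x)"
    by (rule dirder_contract[OF cov2_smooth(5)[OF Ric_smooth] p])
  \<comment> \<open>Since \<open>?T\<close> freezes \<open>z\<close>, its \<open>cov2\<close> lacks
    the Christoffel correction in that slot. The term that makes up for it turns, by
    \<open>div_Ric\<close>, into the Christoffel term of the Hessian of the scalar
    curvature.\<close>
  also have "cov2 g ?T p x = (\<lambda>a b. cov3 g (cov2 g Ric) p x a b z + cov2 g Ric p a b (chr p x z))"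
    by (simp add: fun_eq_iff cov3_def) (simp add: cov2_def)
  finally have "\<partial> (\<lambda>q. contract g q (?T q)) p x =
      contract g p (\<lambda>a b. cov3 g (cov2 g Ric) p x a b z) + 1/2 * \<partial> (scal g) p (chr p x z)"
    by (simp add: contract_add div_Ric[OF p])
  moreover have "\<partial> (\<lambda>q. contract g q (?T q)) p x = \<partial> (\<lambda>q. 1/2 * \<partial> (scal g) q z) p x"
    by (rule dirder_cong_chart[OF p]) (rule div_Ric)
  moreover have "\<partial> (\<lambda>q. 1/2 * \<partial> (scal g) q z) p x = 1/2 * \<partial> (\<lambda>q. \<partial> (scal g) q z) p x"
    by (rule dirder_cmult[OF smooth_on_deriv[OF scal_smooth] p])
  ultimately have "contract g p (\<lambda>a b. cov3 g (cov2 g Ric) p x a b z) + 1/2 * \<partial> (scal g) p (chr p x z) =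
      1/2 * \<partial> (\<lambda>q. \<partial> (scal g) q z) p x"
    by (simp only:)
  then show ?thesis
    by (simp add: hess_def cov1_def field_simps)
qed

text \<open>In the second summand the derivatives along \<open>a\<close> and \<open>x\<close> are
  interchanged, so that the trace meets a divergence of Ric; the two curvature terms of the Ricci
  identity give Ric^2 and, after a skew exchange, minus the pairing of Rm with Ric.\<close>

lemma div_d_ricci:
  assumes p: "p \<in> S"
  shows "contract g p (\<lambda>a b. cov3 g (cov2 g Ric) p a b x y - cov3 g (cov2 g Ric) p a x b y) =
    laplacian2 g Ric p x y - 1/2 * hess g (scal g) p x y - ricci_sq g p x y + riem_pair g Ric p x y"
proof -
  have lin: "linear (\<lambda>u. Ric p u v)" "linear (Ric p v)" for v
    using smooth_bilinearD(4)[OF Ric_smooth p] by (auto simp: bilinear_def)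
  have 1: "contract g p (\<lambda>a b. Ric p (Rv p a x b) y) = ricci_sq g p x y"
  proof -
    have "contract g p (\<lambda>a b. Ric p (Rv p a x b) y) =
        contract g p (\<lambda>a b. contract g p (\<lambda>c c'. Rm p a x b c * Ric p c' y))"
      using contract_ip(2)[OF p lin(1)] by (simp add: riem_def)
    also have "\<dots> = contract g p (\<lambda>c c'. contract g p (\<lambda>a b. Rm p a x b c * Ric p c' y))"
      by (rule contract_swap)
    also have "\<dots> = ricci_sq g p x y"
      by (simp add: contract_cmult_right ricci_sq_def flip: ricci_def)
    finally show ?thesis .
  qed
  have 2: "contract g p (\<lambda>a b. Ric p b (Rv p a x y)) = - riem_pair g Ric p x y"
  proof -
    have "contract g p (\<lambda>a b. Ric p b (Rv p a x y)) =
        contract g p (\<lambda>a b. contract g p (\<lambda>c c'. Rm p a x y c * Ric p b c'))"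
      using contract_ip(2)[OF p lin(2)] by (simp add: riem_def)
    also have "\<dots> = - riem_pair g Ric p x y"
      unfolding riem_pair_def contract_minus[symmetric] using Rm_skew34[OF p, of _ x _ y] by simp
    finally show ?thesis .
  qed
  have "contract g p (\<lambda>a b. cov3 g (cov2 g Ric) p a x b y) =
      contract g p (\<lambda>a b. cov3 g (cov2 g Ric) p x a b y + (Ric p (Rv p a x b) y + Ric p b (Rv p a x y)))"
    using ricci_identity[OF Ric_smooth p, of _ x _ y] by (simp add: algebra_simps)
  then show ?thesis
    by (simp add: contract_diff contract_add 1 2 div_cov2_Ric[OF p] laplacian2_def)
qed

end

section \<open>Curvature of the tractor connection\<close>

lemma sharp_zero: "sharp g p (\<lambda>_. 0) = 0"
  by (simp add: sharp_def vec_eq_iff matrix_vector_mult_def)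

text \<open>A general symmetric \<open>P\<close>, because the weighted Schouten tensor changes with
  \<open>m\<close> and one curvature computation has to serve for all of them.\<close>

locale tractor_connection = local_metric S g
  for S :: "(real^'n::finite) set" and g :: "'n metric" +
  fixes P :: "real^'n \<Rightarrow> real^'n \<Rightarrow> real^'n \<Rightarrow> real"
  assumes P_smooth: "smooth_bilinear S P" and P_sym: "p \<in> S \<Longrightarrow> P p x y = P p y x"
begin

definition dP where "dP p x y z = cov2 g P p x y z - cov2 g P p y x z"

text \<open>The bracket is the Kulkarni-Nomizu product of \<open>P\<close> with the metric, so this
  is the Weyl-type part of the tractor curvature; \<open>dP\<close> is the Cotton-type part.\<close>

definition A where "A p x y z w = Rm p x y z w -
  (P p x z * ip g p y w + P p y w * ip g p x z - P p x w * ip g p y z - P p y z * ip g p x w)"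

lemma P_simps:
  assumes "p \<in> S"
  shows "P p (x + x') y = P p x y + P p x' y" "P p (c *\<^sub>R x) y = c * P p x y" "P p 0 y = 0"
    "P p x (y + y') = P p x y + P p x y'" "P p x (c *\<^sub>R y) = c * P p x y" "P p x 0 = 0"
  using bilinear_simps[OF smooth_bilinearD(4)[OF P_smooth assms]] by simp_all

lemma sharp_P: "p \<in> S \<Longrightarrow> ip g p (sharp g p (P p x)) y = P p x y"
  "p \<in> S \<Longrightarrow> ip g p y (sharp g p (P p x)) = P p x y"
  using ip_sharp_chart[of p "P p x" y] smooth_bilinearD(4)[OF P_smooth, of p] ip_sym
  by (auto simp: bilinear_def)

lemma sharp_P_zero: "p \<in> S \<Longrightarrow> sharp g p (P p 0) = 0"
  using sharp_zero[of g p] P_simps(3)[of p] by (metis ext)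

lemma sharp_P_smooth: "smooth_on S (\<lambda>q. sharp g q (P q x))"
  by (rule smooth_formD(2)[OF smooth_form_sharp[OF P_smooth]])

lemma cov_sharp:
  assumes p: "p \<in> S"
  shows "ip g p (\<partial> (\<lambda>q. sharp g q (P q y)) p x + chr p x (sharp g p (P p y))) z =
    \<partial> (\<lambda>q. P q y z) p x - P p y (chr p x z)"
proof -
  have "\<partial> (\<lambda>q. ip g q (sharp g q (P q y)) z) p x = \<partial> (\<lambda>q. P q y z) p x"
    by (rule dirder_cong_chart[OF p]) (rule sharp_P)
  then show ?thesis
    by (simp add: dirder_ip[OF sharp_P_smooth smooth_on_const p] sharp_P[OF p])
qed

lemma tcov_const:
  assumes "q \<in> S"
  shows "tcov g P (\<lambda>_. y) (\<lambda>_. (s, w, r)) q =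
    (- ip g q w y, chr q y w + s *\<^sub>R sharp g q (P q y) + r *\<^sub>R y, - P q y w)"
  by (simp add: tcov_def cov_vec_def)

lemma tcov_tcov_const:
  assumes p: "p \<in> S"
  shows "tcov g P (\<lambda>_. x) (tcov g P (\<lambda>_. y) (\<lambda>_. (s, w, r))) p =
    (- (ip g p (chr p x w) y + ip g p w (chr p x y))
       - (ip g p (chr p y w) x + s * P p y x + r * ip g p y x),
     dchr p x y w + s *\<^sub>R \<partial> (\<lambda>q. sharp g q (P q y)) p x
       + (chr p x (chr p y w) + s *\<^sub>R chr p x (sharp g p (P p y)) + r *\<^sub>R chr p x y)
       - ip g p w y *\<^sub>R sharp g p (P p x) - P p y w *\<^sub>R x,
     - \<partial> (\<lambda>q. P q y w) p x
       - (P p x (chr p y w) + s * P p x (sharp g p (P p y)) + r * P p x y))"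
proof -
  let ?I = "tcov g P (\<lambda>_. y) (\<lambda>_. (s, w, r))"
  have 1: "\<partial> (\<lambda>q. fst (?I q)) p x = - (ip g p (chr p x w) y + ip g p w (chr p x y))"
  proof -
    have "\<partial> (\<lambda>q. fst (?I q)) p x = \<partial> (\<lambda>q. - ip g q w y) p x"
      by (rule dirder_cong_chart[OF p]) (simp add: tcov_const)
    then show ?thesis
      by (simp add: dirder_minus smooth_bilinearD(3)[OF smooth_ip] p dirder_ip_const)
  qed
  have 2: "\<partial> (\<lambda>q. fst (snd (?I q))) p x = dchr p x y w + s *\<^sub>R \<partial> (\<lambda>q. sharp g q (P q y)) p x"
  proof -
    have "\<partial> (\<lambda>q. fst (snd (?I q))) p x = \<partial> (\<lambda>q. chr q y w + s *\<^sub>R sharp g q (P q y) + r *\<^sub>R y) p x"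
      by (rule dirder_cong_chart[OF p]) (simp add: tcov_const)
    then show ?thesis
      by (simp add: dirder_add dirder_scaleR smooth_intros chr_smooth_forms sharp_P_smooth p)
  qed
  have 3: "\<partial> (\<lambda>q. snd (snd (?I q))) p x = - \<partial> (\<lambda>q. P q y w) p x"
  proof -
    have "\<partial> (\<lambda>q. snd (snd (?I q))) p x = \<partial> (\<lambda>q. - P q y w) p x"
      by (rule dirder_cong_chart[OF p]) (simp add: tcov_const)
    then show ?thesis
      by (simp add: dirder_minus smooth_bilinearD(3)[OF P_smooth] p)
  qed
  show ?thesis
    unfolding tcov_def[of g P "\<lambda>_. x" ?I] Let_def cov_vec_def 1 2 3
    by (simp add: tcov_const[OF p] ip_simps P_simps[OF p] chr_simps[OF p] sharp_P[OF p])
qed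

text \<open>The curvature annihilates \<open>tr_X\<close>, so \<open>r\<close> and \<open>r'\<close>
  disappear. Symmetry of \<open>P\<close> removes the \<open>\<sigma>\<close> component of the
  curvature, and the Kulkarni-Nomizu terms come from the algebraic part of the connection applied
  twice.\<close>

lemma tcurv_eq:
  assumes p: "p \<in> S"
  shows "tcurv g P p x y (s, w, r) (s', w', r') =
    A p x y w w' - s * dP p x y w' + s' * dP p x y w"
proof -
  have 0: "tcov g P (lie_bracket (\<lambda>_. x) (\<lambda>_. y)) (\<lambda>_. (s, w, r)) p = 0"
    by (simp add: tcov_def cov_vec_def lie_bracket_def ip_simps chr_simps[OF p] P_simps[OF p] sharp_P_zero[OF p]
        zero_prod_def)
  have D: "ip g p (\<partial> (\<lambda>q. sharp g q (P q b)) p a) w' =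
      \<partial> (\<lambda>q. P q b w') p a - P p b (chr p a w') - ip g p (chr p a (sharp g p (P p b))) w'" for a b
    using cov_sharp[OF p, of b a w'] by (simp add: ip_simps)
  \<comment> \<open>Both sides are the inner product of the vectors dual to \<open>P p x\<close> and
    \<open>P p y\<close>; this removes the terms quadratic in \<open>P\<close> from the
    \<open>\<rho>\<close> component.\<close>
  have PP: "P p y (sharp g p (P p x)) = P p x (sharp g p (P p y))"
    by (metis sharp_P[OF p])
  show ?thesis
    unfolding tcurv_def tcurv_field_def 0 tcov_tcov_const[OF p]
    by (simp add: tip_def ip_simps D A_def dP_def cov2_def riem_def Rv_eq[OF p] sharp_P[OF p]
        chr_sym[OF p, of y x] P_sym[OF p, of y x] ip_sym[OF p, of y x] ip_sym[OF p, of w x] ip_sym[OF p, of w y]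
        PP algebra_simps)
qed

lemma A_smooth: "smooth_on S (\<lambda>q. A q x y z w)"
  unfolding A_def by (intro smooth_intros Rm_smooth smooth_bilinearD(3)[OF P_smooth] smooth_bilinearD(3)[OF smooth_ip])

lemma dP_smooth: "smooth_on S (\<lambda>q. dP q x y z)"
  unfolding dP_def by (intro smooth_intros cov2_smooth(4)[OF P_smooth])

lemma dP_linear: "p \<in> S \<Longrightarrow> linear (\<lambda>y. dP p x y z)" "p \<in> S \<Longrightarrow> linear (dP p x y)"
  unfolding dP_def
  by (intro linear_compose_sub smooth_formD(1)[OF cov2_smooth(1)[OF P_smooth]]
      smooth_formD(1)[OF cov2_smooth(2)[OF P_smooth]] smooth_formD(1)[OF cov2_smooth(3)[OF P_smooth]]; assumption)+

lemmas dP_simps = linear_simps[OF dP_linear(1)] linear_simps[OF dP_linear(2)]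

lemma A_linear: "p \<in> S \<Longrightarrow> linear (\<lambda>y. A p x y z w)" "p \<in> S \<Longrightarrow> linear (\<lambda>z. A p x y z w)"
  "p \<in> S \<Longrightarrow> linear (A p x y z)"
  by (auto intro!: linearI simp: A_def Rm_simps P_simps ip_simps algebra_simps)

lemmas A_simps = linear_simps[OF A_linear(1)] linear_simps[OF A_linear(2)] linear_simps[OF A_linear(3)]

lemma A_skew34: "p \<in> S \<Longrightarrow> A p x y z w = - A p x y w z"
  using Rm_skew34[of p x y z w] by (simp add: A_def)

lemma tcurv_skew: "p \<in> S \<Longrightarrow> tcurv g P p x y I1 I2 = - tcurv g P p x y I2 I1"
  by (cases I1; cases I2) (simp add: tcurv_eq, rule A_skew34)

lemma tcurv_zero:
  assumes p: "p \<in> S"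
  shows "tcurv g P p 0 y I1 I2 = 0"
proof -
  have "Rm p 0 y z w = 0" for z w
    using Rm_simps(5)[OF p, of 0 0 y z w] by simp
  moreover have "dP p 0 y z = 0" for z
    using linear_0[OF smooth_formD(1)[OF cov2_smooth(1)[OF P_smooth, of y z] p]]
      linear_0[OF smooth_formD(1)[OF cov2_smooth(2)[OF P_smooth, of y z] p]] by (simp add: dP_def)
  ultimately show ?thesis
    by (cases I1; cases I2) (simp add: tcurv_eq[OF p] A_def P_simps[OF p] ip_simps)
qed

lemma tcurv_smooth: "smooth_on S (\<lambda>q. tcurv g P q x y I1 I2)"
proof (rule smooth_cong_chart)
  show "smooth_on S (\<lambda>q. A q x y (fst (snd I1)) (fst (snd I2)) - fst I1 * dP q x y (fst (snd I2))
      + fst I2 * dP q x y (fst (snd I1)))"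
    by (intro smooth_intros A_smooth dP_smooth)
qed (cases I1; cases I2; simp add: tcurv_eq)

lemma tcurv_cov_skew:
  assumes p: "p \<in> S"
  shows "tcurv_cov g P p w x y I1 I2 = - tcurv_cov g P p w x y I2 I1"
proof -
  have "\<partial> (\<lambda>q. tcurv g P q x y I1 I2) p w = \<partial> (\<lambda>q. - tcurv g P q x y I2 I1) p w"
    by (rule dirder_cong_chart[OF p]) (rule tcurv_skew)
  then show ?thesis
    unfolding tcurv_cov_def dirder_minus[OF tcurv_smooth p]
    using tcurv_skew[OF p] by (smt (verit))
qed

text \<open>The derivative of the constant section \<open>tr_Y\<close> along \<open>a\<close> is
  \<open>tr_Z\<close> of the vector dual to \<open>P p a\<close>; this is where the algebraic term
  with \<open>A\<close> comes from.\<close>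

lemma tcurv_cov_YZ:
  assumes p: "p \<in> S"
  shows "tcurv_cov g P p a b x tr_Y (tr_Z z) =
    - (cov3 g (cov2 g P) p a b x z - cov3 g (cov2 g P) p a x b z) - A p b x (sharp g p (P p a)) z"
proof -
  have "\<partial> (\<lambda>q. tcurv g P q b x tr_Y (tr_Z z)) p a = \<partial> (\<lambda>q. - dP q b x z) p a"
    by (rule dirder_cong_chart[OF p]) (simp add: tr_Y_def tr_Z_def tcurv_eq A_simps dP_simps)
  also have "\<dots> = - (\<partial> (\<lambda>q. cov2 g P q b x z) p a - \<partial> (\<lambda>q. cov2 g P q x b z) p a)"
    unfolding dirder_minus[OF dP_smooth p] unfolding dP_def
    by (simp add: dirder_diff cov2_smooth(4)[OF P_smooth] p)
  finally show ?thesis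
    unfolding tcurv_cov_def
    by (simp add: tr_Y_def tr_Z_def tcov_const[OF p] tcurv_eq[OF p] A_simps[OF p] dP_simps[OF p] ip_simps
        chr_simps[OF p] P_simps[OF p] cov3_def)
      (simp add: dP_def)
qed

text \<open>The derivative of \<open>tr_Z c\<close> along \<open>a\<close> has \<open>tr_Y\<close>
  component \<open>- ip g p c a\<close>, which produces the two final terms with
  \<open>dP\<close>.\<close>

lemma tcurv_cov_ZZ:
  assumes p: "p \<in> S"
  shows "tcurv_cov g P p a b x (tr_Z c) (tr_Z d) = cov4 g Rm p a b x c d
    - (cov2 g P p a b c * ip g p x d + cov2 g P p a x d * ip g p b c
       - cov2 g P p a b d * ip g p x c - cov2 g P p a x c * ip g p b d)
    - ip g p c a * dP p b x d + ip g p d a * dP p b x c"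
proof -
  note sm = smooth_intros Rm_smooth smooth_bilinearD(3)[OF P_smooth] smooth_bilinearD(3)[OF smooth_ip]
  have "\<partial> (\<lambda>q. tcurv g P q b x (tr_Z c) (tr_Z d)) p a = \<partial> (\<lambda>q. A q b x c d) p a"
    by (rule dirder_cong_chart[OF p]) (simp add: tr_Z_def tcurv_eq)
  also have "\<dots> = \<partial> (\<lambda>q. Rm q b x c d) p a - (
      P p b c * \<partial> (\<lambda>q. ip g q x d) p a + \<partial> (\<lambda>q. P q b c) p a * ip g p x d
      + (P p x d * \<partial> (\<lambda>q. ip g q b c) p a + \<partial> (\<lambda>q. P q x d) p a * ip g p b c)
      - (P p b d * \<partial> (\<lambda>q. ip g q x c) p a + \<partial> (\<lambda>q. P q b d) p a * ip g p x c)
      - (P p x c * \<partial> (\<lambda>q. ip g q b d) p a + \<partial> (\<lambda>q. P q x c) p a * ip g p b d))"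
    unfolding A_def by (simp add: dirder_diff dirder_add dirder_mult sm p)
  finally show ?thesis
    unfolding tcurv_cov_def
    by (simp add: tr_Z_def tcov_const[OF p] tcurv_eq[OF p] dirder_ip_const[OF p] cov4_def cov2_def A_def
        algebra_simps)
qed

lemma div_tcurv_YZ:
  assumes p: "p \<in> S"
  shows "contract g p (\<lambda>a b. tcurv_cov g P p a b x tr_Y (tr_Z z)) =
    - contract g p (\<lambda>a b. cov3 g (cov2 g P) p a b x z - cov3 g (cov2 g P) p a x b z)
    - contract g p (\<lambda>a b. contract g p (\<lambda>c c'. A p b x c z * P p a c'))"
proof -
  have "linear (P p a)" for a
    using smooth_bilinearD(4)[OF P_smooth p] by (auto simp: bilinear_def)
  then show ?thesis
    by (simp add: tcurv_cov_YZ[OF p] contract_diff contract_sharp[OF p A_linear(2)[OF p]] flip: contract_minus)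
qed

lemma div_tcurv_ZZ:
  assumes p: "p \<in> S"
  shows "contract g p (\<lambda>a b. tcurv_cov g P p a b x (tr_Z c) (tr_Z d)) = d_ricci g p c d x
    - contract g p (\<lambda>a b. cov2 g P p a b c * ip g p x d + cov2 g P p a x d * ip g p b c
       - cov2 g P p a b d * ip g p x c - cov2 g P p a x c * ip g p b d
       + ip g p c a * dP p b x d - ip g p d a * dP p b x c)"
  unfolding div_Rm[OF p, symmetric] contract_diff[symmetric]
  by (simp add: tcurv_cov_ZZ[OF p] algebra_simps)

text \<open>For \<open>v = 1\<close> the potential \<open>\<phi>\<close> is constant and the
  weighted divergence has no drift term.\<close>

lemma tcurv_div_const:
  "p \<in> S \<Longrightarrow> tcurv_div g P (\<lambda>_. c) p x I1 I2 = contract g p (\<lambda>a b. tcurv_cov g P p a b x I1 I2)"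
  by (simp add: tcurv_div_def grad_def sharp_zero tcurv_zero)

end

section \<open>The limit of large dimensional constant\<close>

lemma sum_Basis_pair:
  fixes f :: "'a::euclidean_space \<times> 'b::euclidean_space \<Rightarrow> 'c::comm_monoid_add"
  shows "sum f Basis = (\<Sum>u\<in>Basis. f (u, 0)) + (\<Sum>v\<in>Basis. f (0, v))"
proof -
  have "inj_on (\<lambda>u. (u::'a, 0::'b)) Basis" "inj_on (\<lambda>v. (0::'a, v::'b)) Basis"
    by (auto intro!: inj_onI)
  then show ?thesis
    unfolding Basis_prod_def by (subst sum.union_disjoint) (auto simp: sum.reindex)
qed

lemma sum_tractor_Basis:
  fixes f :: "'n::finite tractor \<Rightarrow> real"
  shows "(\<Sum>A\<in>Basis. f A) = f tr_Y + (\<Sum>i\<in>UNIV. f (tr_Z (axis i 1))) + f tr_X"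
proof -
  have "(\<Sum>v\<in>Basis. h v) = (\<Sum>i\<in>UNIV. h (axis i 1))" for h :: "real^'n \<Rightarrow> real"
  proof -
    have B: "Basis = range (\<lambda>i::'n. axis i (1::real))"
      by (auto simp: Basis_vec_def)
    show ?thesis
      unfolding B by (subst sum.reindex) (auto simp: inj_def axis_eq_axis)
  qed
  then show ?thesis
    by (simp add: sum_Basis_pair tr_X_def tr_Y_def tr_Z_def zero_prod_def add.assoc)
qed

text \<open>The bivector \<open>\<tau> Y \<and> Z(u) + \<Sum> \<Psi> k l Z(e\<^sub>k) \<and> Z(e\<^sub>l) / 2\<close>.\<close>

definition tbiv :: "real \<Rightarrow> real^'n \<Rightarrow> ('n \<Rightarrow> 'n \<Rightarrow> real) \<Rightarrow> 'n::finite tractor \<Rightarrow> 'n tractor \<Rightarrow> real" where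
  "tbiv \<tau> u \<Psi> = (\<lambda>(s, w, r) (s', w', r'). \<tau> * (s * (u \<bullet> w') - s' * (u \<bullet> w))
     + (\<Sum>k\<in>UNIV. \<Sum>l\<in>UNIV. \<Psi> k l * (w $ k * w' $ l)))"

lemma bivector_tbiv:
  fixes \<Psi> :: "'n::finite \<Rightarrow> 'n \<Rightarrow> real"
  assumes "\<And>k l. \<Psi> k l = - \<Psi> l k"
  shows "bivector (tbiv \<tau> u \<Psi>)"
proof -
  have "(\<Sum>k\<in>UNIV. \<Sum>l\<in>UNIV. \<Psi> k l * (w $ k * w' $ l)) = - (\<Sum>k\<in>UNIV. \<Sum>l\<in>UNIV. \<Psi> k l * (w' $ k * w $ l))"
    for w w' :: "real^'n"
    by (subst sum.swap, subst assms) (simp add: sum_negf mult.commute[of "w $ _"])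
  then show ?thesis
    by (auto simp: bivector_def tbiv_def algebra_simps)
qed

text \<open>The orders (Y, Z) and (Z, Y) contribute equally because both factors are skew, hence the
  2; there are no coefficients along \<open>tr_X\<close>.\<close>

lemma sum_tbiv:
  fixes F :: "'n::finite tractor \<Rightarrow> 'n tractor \<Rightarrow> real"
  assumes F: "\<And>C D. F C D = - F D C"
  shows "(\<Sum>C\<in>Basis. \<Sum>D\<in>Basis. tbiv \<tau> u \<Psi> C D * F C D) =
    2 * \<tau> * (\<Sum>i\<in>UNIV. u $ i * F tr_Y (tr_Z (axis i 1)))
    + (\<Sum>k\<in>UNIV. \<Sum>l\<in>UNIV. \<Psi> k l * F (tr_Z (axis k 1)) (tr_Z (axis l 1)))"
proof -
  have ax: "axis k (1::real) $ i = (if i = k then 1 else 0)" for i k :: 'n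
    by (simp add: axis_def)
  have 1: "tbiv \<tau> u \<Psi> tr_Y (tr_Z (axis i 1)) = \<tau> * u $ i" "tbiv \<tau> u \<Psi> (tr_Z (axis i 1)) tr_Y = - (\<tau> * u $ i)"
    "tbiv \<tau> u \<Psi> tr_Y tr_Y = 0" "tbiv \<tau> u \<Psi> tr_X A = 0" "tbiv \<tau> u \<Psi> A tr_X = 0" for i A
    by (simp_all add: tbiv_def tr_X_def tr_Y_def tr_Z_def inner_axis split: prod.split)
  have 2: "tbiv \<tau> u \<Psi> (tr_Z (axis i 1)) (tr_Z (axis j 1)) = \<Psi> i j" for i j
  proof -
    have s: "(\<Sum>k\<in>UNIV. h k * axis i (1::real) $ k) = h i" for h and i :: 'n
      by (simp add: ax if_distrib cong: if_cong)
    have "tbiv \<tau> u \<Psi> (tr_Z (axis i 1)) (tr_Z (axis j 1)) =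
        (\<Sum>k\<in>UNIV. (\<Sum>l\<in>UNIV. \<Psi> k l * axis j (1::real) $ l) * axis i (1::real) $ k)"
      by (simp add: tbiv_def tr_Z_def sum_distrib_left mult_ac)
    then show ?thesis by (simp only: s)
  qed
  show ?thesis
    by (simp add: sum_tractor_Basis 1 2 F[of "tr_Z _" tr_Y] sum.distrib sum_distrib_left mult.assoc)
qed

text \<open>Applying \<open>sum_tbiv\<close> to each pair of arguments gives 2\<tau> for every pair
  of type (Y, Z); with the factor 1/4 the weights become \<tau>^2, \<tau>/2 and 1/4.\<close>

lemma on_bivectors_tbiv:
  fixes W :: "'n::finite tractor \<Rightarrow> 'n tractor \<Rightarrow> 'n tractor \<Rightarrow> 'n tractor \<Rightarrow> real"
  assumes skew: "\<And>A B C D. W A B C D = - W B A C D" "\<And>A B C D. W A B C D = - W A B D C"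
  defines "Z \<equiv> \<lambda>i. tr_Z (axis i 1)"
  shows "on_bivectors W (tbiv \<tau> u \<Psi>) (tbiv \<tau> u \<Psi>) =
    \<tau>\<^sup>2 * (\<Sum>i\<in>UNIV. \<Sum>j\<in>UNIV. u $ i * u $ j * W tr_Y (Z i) tr_Y (Z j))
    + \<tau> / 2 * (\<Sum>i\<in>UNIV. \<Sum>k\<in>UNIV. \<Sum>l\<in>UNIV. u $ i * \<Psi> k l * (W tr_Y (Z i) (Z k) (Z l) + W (Z k) (Z l) tr_Y (Z i)))
    + 1 / 4 * (\<Sum>k\<in>UNIV. \<Sum>l\<in>UNIV. \<Sum>i\<in>UNIV. \<Sum>j\<in>UNIV. \<Psi> k l * \<Psi> i j * W (Z k) (Z l) (Z i) (Z j))"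
proof -
  let ?G = "\<lambda>A B. 2 * \<tau> * (\<Sum>j\<in>UNIV. u $ j * W A B tr_Y (Z j)) + (\<Sum>i\<in>UNIV. \<Sum>j\<in>UNIV. \<Psi> i j * W A B (Z i) (Z j))"
  \<comment> \<open>\<open>?G\<close> is the result of summing over the second pair; its skewness
    permits the second use of \<open>sum_tbiv\<close>.\<close>
  have G: "?G A B = - ?G B A" for A B
    by (subst skew(1), subst (2) skew(1)) (simp add: sum_negf)
  have "on_bivectors W (tbiv \<tau> u \<Psi>) (tbiv \<tau> u \<Psi>) = 1/4 * (\<Sum>A\<in>Basis. \<Sum>B\<in>Basis. tbiv \<tau> u \<Psi> A B *
      (\<Sum>C\<in>Basis. \<Sum>D\<in>Basis. tbiv \<tau> u \<Psi> C D * W A B C D))"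
    by (simp add: on_bivectors_def sum_distrib_left mult.assoc)
  also have "\<dots> = 1/4 * (\<Sum>A\<in>Basis. \<Sum>B\<in>Basis. tbiv \<tau> u \<Psi> A B * ?G A B)"
    unfolding sum_tbiv[OF skew(2)] Z_def ..
  also have "\<dots> = 1/4 * (2 * \<tau> * (\<Sum>i\<in>UNIV. u $ i * ?G tr_Y (Z i)) + (\<Sum>k\<in>UNIV. \<Sum>l\<in>UNIV. \<Psi> k l * ?G (Z k) (Z l)))"
    using sum_tbiv[of ?G, OF G] by (simp add: Z_def)
  also have "(\<Sum>i\<in>UNIV. u $ i * ?G tr_Y (Z i)) =
      2 * \<tau> * (\<Sum>i\<in>UNIV. \<Sum>j\<in>UNIV. u $ i * u $ j * W tr_Y (Z i) tr_Y (Z j))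
      + (\<Sum>i\<in>UNIV. \<Sum>k\<in>UNIV. \<Sum>l\<in>UNIV. u $ i * \<Psi> k l * W tr_Y (Z i) (Z k) (Z l))"
    by (simp add: distrib_left sum.distrib sum_distrib_left mult_ac)
  also have "(\<Sum>k\<in>UNIV. \<Sum>l\<in>UNIV. \<Psi> k l * ?G (Z k) (Z l)) =
      2 * \<tau> * (\<Sum>k\<in>UNIV. \<Sum>l\<in>UNIV. \<Sum>i\<in>UNIV. u $ i * \<Psi> k l * W (Z k) (Z l) tr_Y (Z i))
      + (\<Sum>k\<in>UNIV. \<Sum>l\<in>UNIV. \<Sum>i\<in>UNIV. \<Sum>j\<in>UNIV. \<Psi> k l * \<Psi> i j * W (Z k) (Z l) (Z i) (Z j))"
    by (simp add: distrib_left sum.distrib sum_distrib_left mult_ac)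
  also have "(\<Sum>k\<in>UNIV. \<Sum>l\<in>UNIV. \<Sum>i\<in>UNIV. u $ i * \<Psi> k l * W (Z k) (Z l) tr_Y (Z i)) =
      (\<Sum>i\<in>UNIV. \<Sum>k\<in>UNIV. \<Sum>l\<in>UNIV. u $ i * \<Psi> k l * W (Z k) (Z l) tr_Y (Z i))"
  proof -
    have "(\<Sum>k\<in>UNIV. \<Sum>l\<in>UNIV. \<Sum>i\<in>UNIV. u $ i * \<Psi> k l * W (Z k) (Z l) tr_Y (Z i)) =
        (\<Sum>k\<in>UNIV. \<Sum>i\<in>UNIV. \<Sum>l\<in>UNIV. u $ i * \<Psi> k l * W (Z k) (Z l) tr_Y (Z i))"
      by (intro sum.cong refl sum.swap)
    also have "\<dots> = (\<Sum>i\<in>UNIV. \<Sum>k\<in>UNIV. \<Sum>l\<in>UNIV. u $ i * \<Psi> k l * W (Z k) (Z l) tr_Y (Z i))"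
      by (rule sum.swap)
    finally show ?thesis .
  qed
  finally show ?thesis
    by (simp add: distrib_left sum.distrib power2_eq_square)
qed

text \<open>The contravariant components of \<open>\<Phi>\<close>: bivector coefficients refer to
  the vectors \<open>tr_Z (axis k 1)\<close>, whereas \<open>\<Phi>\<close> is a form.\<close>

definition raise2 :: "'n::finite metric \<Rightarrow> real^'n \<Rightarrow> (real^'n \<Rightarrow> real^'n \<Rightarrow> real) \<Rightarrow> 'n \<Rightarrow> 'n \<Rightarrow> real" where
  "raise2 g p \<Phi> k l = (\<Sum>i\<in>UNIV. \<Sum>j\<in>UNIV. matrix_inv (g p) $ k $ i * matrix_inv (g p) $ l $ j * \<Phi> (axis i 1) (axis j 1))"

lemma contract_raise2:
  "contract g p (\<lambda>a a'. contract g p (\<lambda>b b'. F a b * \<Phi> a' b')) =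
    (\<Sum>k\<in>UNIV. \<Sum>l\<in>UNIV. raise2 g p \<Phi> k l * F (axis k 1) (axis l 1))"
proof -
  let ?G = "\<lambda>i j. matrix_inv (g p) $ i $ j" and ?e = "\<lambda>i. axis i 1"
  have "contract g p (\<lambda>a a'. contract g p (\<lambda>b b'. F a b * \<Phi> a' b')) =
    (\<Sum>k\<in>UNIV. \<Sum>i\<in>UNIV. \<Sum>l\<in>UNIV. \<Sum>j\<in>UNIV. ?G k i * ?G l j * \<Phi> (?e i) (?e j) * F (?e k) (?e l))"
    by (simp add: contract_def sum_distrib_left mult_ac)
  also have "\<dots> = (\<Sum>k\<in>UNIV. \<Sum>l\<in>UNIV. \<Sum>i\<in>UNIV. \<Sum>j\<in>UNIV. ?G k i * ?G l j * \<Phi> (?e i) (?e j) * F (?e k) (?e l))"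
    by (intro sum.cong refl sum.swap)
  finally show ?thesis
    by (simp add: raise2_def sum_distrib_right)
qed

lemma raise2_skew:
  assumes "\<And>x y. \<Phi> x y = - \<Phi> y x"
  shows "raise2 g p \<Phi> k l = - raise2 g p \<Phi> l k"
  unfolding raise2_def by (subst sum.swap, subst assms) (simp add: sum_negf mult_ac)

lemma tendsto_contract:
  assumes "\<And>a b. ((\<lambda>i. T i a b) \<longlongrightarrow> L a b) F"
  shows "((\<lambda>i. contract g p (T i)) \<longlongrightarrow> contract g p L) F"
  unfolding contract_def by (intro tendsto_sum tendsto_mult tendsto_const assms)

lemma hess_const: "hess g (\<lambda>_. c) = (\<lambda>_ _ _. 0)"
  by (simp add: hess_def cov1_def fun_eq_iff)

lemma grad_const: "grad g (\<lambda>_. c) p = 0"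
  by (simp add: grad_def sharp_zero)

section \<open>The weighted objects for \<open>v = 1\<close>\<close>

context local_metric begin

text \<open>A family containing the weighted Schouten tensors of all \<open>m\<close>, so that the
  dependence on \<open>m\<close> sits in three constants and the tensors \<open>Ric\<close>,
  \<open>scal g\<close> and the metric stay fixed.\<close>

definition schouten :: "real \<Rightarrow> real \<Rightarrow> real \<Rightarrow> real^'n \<Rightarrow> real^'n \<Rightarrow> real^'n \<Rightarrow> real" where
  "schouten a b c q x y = a * Ric q x y + (b + c * scal g q) * ip g q x y"

lemma P_w_eq:
  fixes m \<mu> :: real
  defines "N \<equiv> m + real CARD('n)"
  shows "P_w g (\<lambda>_. 1) m \<mu> = schouten (1 / (N - 2)) (- m * \<mu> / (2 * (N - 1) * (N - 2))) (- 1 / (2 * (N - 1) * (N - 2)))"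
proof -
  \<comment> \<open>The case distinction includes zero denominators, where both sides agree because
    \<open>x / 0 = 0\<close>.\<close>
  have *: "(r - (s + m * \<mu>) / (2 * d) * h) / e = 1 / e * r + (- m * \<mu> / (2 * d * e) + - 1 / (2 * d * e) * s) * h"
    for r s h d e :: real
    by (cases "d = 0"; cases "e = 0") (simp_all add: field_simps)
  have "P_w g (\<lambda>_. 1) m \<mu> q x y = (Ric q x y - (scal g q + m * \<mu>) / (2 * (N - 1)) * ip g q x y) / (N - 2)" for q x y
    by (simp add: P_w_def J_w_def ricci_w_def scal_w_def hess_const grad_const laplacian_def contract_zero
        ip_simps N_def)
  then show ?thesis
    by (simp only: fun_eq_iff * schouten_def) simp
qed

lemma schouten_smooth: "smooth_bilinear S (schouten a b c)"
  unfolding smooth_bilinear_def bilinear_def schouten_def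
  by (auto intro!: linearI smooth_intros scal_smooth smooth_bilinearD(3)[OF Ric_smooth] smooth_bilinearD(3)[OF smooth_ip]
      simp: bilinear_simps[OF smooth_bilinearD(4)[OF Ric_smooth]] ip_simps algebra_simps)

lemma schouten_tractor: "tractor_connection S g (schouten a b c)"
  by unfold_locales (simp_all add: schouten_smooth schouten_def Ric_sym ip_sym)

text \<open>The metric is parallel, so \<open>b\<close> drops out and only the derivative of the
  scalar curvature multiplies the metric.\<close>

lemma cov2_schouten:
  assumes p: "p \<in> S"
  shows "cov2 g (schouten a b c) p x y z = a * cov2 g Ric p x y z + c * \<partial> (scal g) p x * ip g p y z"
proof -
  note sm = smooth_intros scal_smooth smooth_bilinearD(3)[OF Ric_smooth] smooth_bilinearD(3)[OF smooth_ip]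
  show ?thesis
    by (simp add: cov2_def schouten_def dirder_add dirder_mult dirder_cmult sm p dirder_ip_const algebra_simps)
qed

lemma cov3_cov2_schouten:
  assumes p: "p \<in> S"
  shows "cov3 g (cov2 g (schouten a b c)) p x y z w = a * cov3 g (cov2 g Ric) p x y z w
    + c * hess g (scal g) p x y * ip g p z w"
proof -
  note sm = smooth_intros scal_smooth cov2_smooth(4)[OF Ric_smooth] smooth_bilinearD(3)[OF smooth_ip]
  have "\<partial> (\<lambda>q. cov2 g (schouten a b c) q y z w) p x =
      \<partial> (\<lambda>q. a * cov2 g Ric q y z w + c * \<partial> (scal g) q y * ip g q z w) p x"
    by (rule dirder_cong_chart[OF p]) (simp add: cov2_schouten)
  also have "\<dots> = a * \<partial> (\<lambda>q. cov2 g Ric q y z w) p x +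
     (c * \<partial> (scal g) p y * (ip g p (chr p x z) w + ip g p z (chr p x w))
      + c * \<partial> (\<lambda>q. \<partial> (scal g) q y) p x * ip g p z w)"
    by (simp add: dirder_add dirder_mult dirder_cmult sm p dirder_ip_const)
  finally show ?thesis
    by (simp add: cov3_def cov2_schouten[OF p] hess_def cov1_def algebra_simps)
qed

lemma cov3_linear:
  assumes T: "smooth_bilinear S T" and p: "p \<in> S"
  shows "linear (\<lambda>b. cov3 g (cov2 g T) p a b x y)" "linear (\<lambda>x. cov3 g (cov2 g T) p a b x y)"
    "linear (cov3 g (cov2 g T) p a b x)"
proof -
  note l = linear_simps[OF smooth_form_deriv_linear[OF open_S cov2_smooth(1)[OF T] p]]
    linear_simps[OF smooth_form_deriv_linear[OF open_S cov2_smooth(2)[OF T] p]]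
    linear_simps[OF smooth_form_deriv_linear[OF open_S cov2_smooth(3)[OF T] p]]
    linear_simps[OF smooth_formD(1)[OF cov2_smooth(1)[OF T] p]]
    linear_simps[OF smooth_formD(1)[OF cov2_smooth(2)[OF T] p]]
    linear_simps[OF smooth_formD(1)[OF cov2_smooth(3)[OF T] p]] chr_simps[OF p]
  show "linear (\<lambda>b. cov3 g (cov2 g T) p a b x y)" "linear (\<lambda>x. cov3 g (cov2 g T) p a b x y)"
    "linear (cov3 g (cov2 g T) p a b x)"
    by (rule linearI; simp add: cov3_def l algebra_simps)+
qed

lemma B_tensor_bilinear:
  assumes p: "p \<in> S"
  shows "bilinear (B_tensor g p)"
proof -
  have "smooth_form S (\<lambda>q z. \<partial> (scal g) q z)"
    by (rule smooth_form_direction[OF open_S scal_smooth])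
  note l = linear_simps[OF smooth_form_deriv_linear[OF open_S this p]]
    linear_simps[OF smooth_formD(1)[OF this p]]
    linear_simps[OF linear_frechet_derivative[OF smooth_on_differentiable[OF open_S smooth_on_deriv[OF scal_smooth] p]]]
    linear_simps[OF cov3_linear(2)[OF Ric_smooth p]] linear_simps[OF cov3_linear(3)[OF Ric_smooth p]]
    bilinear_simps[OF smooth_bilinearD(4)[OF Ric_smooth p]] chr_simps[OF p] Rm_simps[OF p]
  show ?thesis
    unfolding bilinear_def
    by (auto intro!: linearI simp: B_tensor_def laplacian2_def hess_def cov1_def riem_pair_def ricci_sq_def
        l contract_add contract_cmult distrib_left distrib_right mult.assoc mult.left_commute)
      (simp_all add: field_simps)
qed

text \<open>With zero gradient, |J|^2 is twice the last component, that is -R/(n(n-1)). The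
  coefficient of R then collapses by (m+2n-2)(m-1) - (m+n-1)(m+n-2) = -n(n-1).\<close>

lemma tr_Jt_eq:
  fixes m \<mu> :: real
  defines "n \<equiv> real CARD('n)"
  assumes "n \<ge> 2" "m + n - 1 \<noteq> 0" "m + n - 2 \<noteq> 0"
  shows "tr_Jt g (\<lambda>_. 1) m \<mu> = (\<lambda>q. (1, 0, (\<mu> * (m + 2 * n - 2) - scal g q) / (2 * (m + n - 1) * (m + n - 2))))"
proof
  fix q
  define s where "s = scal g q"
  have J: "tr_J g (\<lambda>_. 1) q = (1, 0, - (1 / n) * (s / (2 * (n - 1))))"
    by (simp add: tr_J_def grad_const laplacian_def hess_const contract_zero s_def n_def)
  have "n \<noteq> 0" "n - 1 \<noteq> 0"
    using assms(2) by auto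
  then have "- (1 / n) * (s / (2 * (n - 1))) + (m + 2 * n - 2) * (\<mu> - (m - 1) * (2 * (- (1 / n) * (s / (2 * (n - 1))))))
      / (2 * (m + n - 1) * (m + n - 2)) = (\<mu> * (m + 2 * n - 2) - s) / (2 * (m + n - 1) * (m + n - 2))"
    using assms(3,4) by (simp add: divide_simps) algebra
  then show "tr_Jt g (\<lambda>_. 1) m \<mu> q = (1, 0, (\<mu> * (m + 2 * n - 2) - scal g q) / (2 * (m + n - 1) * (m + n - 2)))"
    by (simp add: tr_Jt_def J tip_def ip_simps tr_X_def s_def flip: n_def)
qed

lemma weyl_YZ_schouten:
  fixes m \<mu> a b c :: real and \<rho> :: "real^'n \<Rightarrow> real"
  assumes p: "p \<in> S" and P: "P_w g (\<lambda>_. 1) m \<mu> = schouten a b c"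
    and Jt: "tr_Jt g (\<lambda>_. 1) m \<mu> = (\<lambda>q. (1, 0, \<rho> q))"
  shows "weyl_YZ g (\<lambda>_. 1) m \<mu> p x tr_Y (tr_Z z) =
      contract g p (\<lambda>e f. cov3 g (cov2 g (schouten a b c)) p e f x z - cov3 g (cov2 g (schouten a b c)) p e x f z)
      + contract g p (\<lambda>e f. contract g p (\<lambda>u u'. tractor_connection.A g (schouten a b c) p f x u z * schouten a b c p e u'))
      - m * \<rho> p * (schouten a b c p x z + \<rho> p * ip g p x z)"
    and "weyl_YZ g (\<lambda>_. 1) m \<mu> p x (tr_Z z) (tr_Z w) = - d_ricci g p z w x
      + contract g p (\<lambda>e f. cov2 g (schouten a b c) p e f z * ip g p x w + cov2 g (schouten a b c) p e x w * ip g p f z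
       - cov2 g (schouten a b c) p e f w * ip g p x z - cov2 g (schouten a b c) p e x z * ip g p f w
       + ip g p z e * tractor_connection.dP g (schouten a b c) p f x w
       - ip g p w e * tractor_connection.dP g (schouten a b c) p f x z)"
    and "weyl_YZ g (\<lambda>_. 1) m \<mu> p x I1 I2 = - weyl_YZ g (\<lambda>_. 1) m \<mu> p x I2 I1"
proof -
  interpret T: tractor_connection S g "schouten a b c"
    by (rule schouten_tractor)
  \<comment> \<open>The component \<open>r\<close> may stay unnamed: in the (Y, Z) value it is
    multiplied by the vanishing vector part of the modified tractor, and in the (Z, Z) values it
    does not occur.\<close>
  obtain r where t: "tcov g (schouten a b c) (\<lambda>_. x) (\<lambda>q. (1, 0, \<rho> q)) p =
      (0, sharp g p (schouten a b c p x) + \<rho> p *\<^sub>R x, r)"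
    by (simp add: tcov_def cov_vec_def chr_simps[OF p] ip_simps)
  have "twedge g p (0, sharp g p (schouten a b c p x) + \<rho> p *\<^sub>R x, r) (1, 0, \<rho> p) tr_Y (tr_Z z) =
      - \<rho> p * (schouten a b c p x z + \<rho> p * ip g p x z)"
    by (simp add: twedge_def tip_def tr_Y_def tr_Z_def ip_simps T.sharp_P[OF p])
  then show "weyl_YZ g (\<lambda>_. 1) m \<mu> p x tr_Y (tr_Z z) =
      contract g p (\<lambda>e f. cov3 g (cov2 g (schouten a b c)) p e f x z - cov3 g (cov2 g (schouten a b c)) p e x f z)
      + contract g p (\<lambda>e f. contract g p (\<lambda>u u'. T.A p f x u z * schouten a b c p e u'))
      - m * \<rho> p * (schouten a b c p x z + \<rho> p * ip g p x z)"
    by (simp add: weyl_YZ_def P Jt t T.tcurv_div_const[OF p] T.div_tcurv_YZ[OF p])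
  have "twedge g p (0, sharp g p (schouten a b c p x) + \<rho> p *\<^sub>R x, r) (1, 0, \<rho> p) (tr_Z z) (tr_Z w) = 0"
    by (simp add: twedge_def tip_def tr_Z_def ip_simps)
  then show "weyl_YZ g (\<lambda>_. 1) m \<mu> p x (tr_Z z) (tr_Z w) = - d_ricci g p z w x
      + contract g p (\<lambda>e f. cov2 g (schouten a b c) p e f z * ip g p x w + cov2 g (schouten a b c) p e x w * ip g p f z
       - cov2 g (schouten a b c) p e f w * ip g p x z - cov2 g (schouten a b c) p e x z * ip g p f w
       + ip g p z e * T.dP p f x w - ip g p w e * T.dP p f x z)"
    by (simp add: weyl_YZ_def P Jt t T.tcurv_div_const[OF p] T.div_tcurv_ZZ[OF p])
  have "contract g p (\<lambda>e f. tcurv_cov g (schouten a b c) p e f x I1 I2) =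
      - contract g p (\<lambda>e f. tcurv_cov g (schouten a b c) p e f x I2 I1)"
    unfolding contract_minus[symmetric] using T.tcurv_cov_skew[OF p] by metis
  then show "weyl_YZ g (\<lambda>_. 1) m \<mu> p x I1 I2 = - weyl_YZ g (\<lambda>_. 1) m \<mu> p x I2 I1"
    by (simp add: weyl_YZ_def P T.tcurv_div_const[OF p] twedge_def algebra_simps)
qed

lemma weighted_weyl_schouten_values:
  fixes m \<mu> a b c :: real
  assumes p: "p \<in> S" and P: "P_w g (\<lambda>_. 1) m \<mu> = schouten a b c"
  defines "W \<equiv> weighted_weyl g (\<lambda>_. 1) m \<mu> p"
  shows "W tr_Y (tr_Z x) I1 I2 = weyl_YZ g (\<lambda>_. 1) m \<mu> p x I1 I2"
    and "W (tr_Z x) (tr_Z y) (tr_Z z) (tr_Z w) = (m + real CARD('n) - 4) * tractor_connection.A g (schouten a b c) p x y z w"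
    and "W (tr_Z x) (tr_Z y) tr_Y (tr_Z z) = - ((m + real CARD('n) - 4) * tractor_connection.dP g (schouten a b c) p x y z)"
proof -
  interpret T: tractor_connection S g "schouten a b c"
    by (rule schouten_tractor)
  show "W tr_Y (tr_Z x) I1 I2 = weyl_YZ g (\<lambda>_. 1) m \<mu> p x I1 I2"
    "W (tr_Z x) (tr_Z y) (tr_Z z) (tr_Z w) = (m + real CARD('n) - 4) * T.A p x y z w"
    "W (tr_Z x) (tr_Z y) tr_Y (tr_Z z) = - ((m + real CARD('n) - 4) * T.dP p x y z)"
    by (simp_all add: W_def weighted_weyl_def weyl_ZZ_def P tr_Y_def tr_Z_def T.tcurv_zero[OF p] T.tcurv_eq[OF p]
        T.A_simps[OF p])
qed

lemma weighted_weyl_skew: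
  fixes m \<mu> a b c :: real and \<rho> :: "real^'n \<Rightarrow> real"
  assumes p: "p \<in> S" and P: "P_w g (\<lambda>_. 1) m \<mu> = schouten a b c"
    and Jt: "tr_Jt g (\<lambda>_. 1) m \<mu> = (\<lambda>q. (1, 0, \<rho> q))"
  defines "W \<equiv> weighted_weyl g (\<lambda>_. 1) m \<mu> p"
  shows "W I1 I2 I3 I4 = - W I2 I1 I3 I4" and "W I1 I2 I3 I4 = - W I1 I2 I4 I3"
proof -
  interpret T: tractor_connection S g "schouten a b c"
    by (rule schouten_tractor)
  have 1: "tcurv g (schouten a b c) p x y I3 I4 = - tcurv g (schouten a b c) p y x I3 I4" for x y I3 I4
    using Rm_skew12[OF p, of x y]
    by (cases I3; cases I4) (simp add: T.tcurv_eq[OF p] T.A_def T.dP_def algebra_simps)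
  show "W I1 I2 I3 I4 = - W I2 I1 I3 I4"
    by (cases I1; cases I2) (simp add: W_def weighted_weyl_def weyl_ZZ_def P, subst 1, simp)
  show "W I1 I2 I3 I4 = - W I1 I2 I4 I3"
    by (cases I1; cases I2)
      (simp add: W_def weighted_weyl_def weyl_ZZ_def P T.tcurv_skew[OF p, of _ _ I3 I4]
        weyl_YZ_schouten(3)[OF p P Jt, of _ I3 I4])
qed

end

text \<open>The asymptotics that the limit relies on. The values 1/4 and -1/4 are -\<mu>/2 and
  \<mu>/2 at \<mu> = -1/2.\<close>

locale schouten_limit = local_metric S g
  for S :: "(real^'n::finite) set" and g :: "'n metric" +
  fixes m a b c \<rho> :: "nat \<Rightarrow> real"
  assumes m: "filterlim m at_top sequentially"
    and ma: "(\<lambda>i. m i * a i) \<longlonglongrightarrow> 1" and mb: "(\<lambda>i. m i * b i) \<longlonglongrightarrow> 1/4"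
    and mc: "(\<lambda>i. m i * c i) \<longlonglongrightarrow> 0" and m\<rho>: "(\<lambda>i. m i * \<rho> i) \<longlonglongrightarrow> - 1/4"
begin

lemma lim_zero:
  assumes "(\<lambda>i. m i * f i) \<longlonglongrightarrow> l"
  shows "f \<longlonglongrightarrow> 0"
proof -
  have "(\<lambda>i. inverse (m i)) \<longlonglongrightarrow> 0"
    by (rule tendsto_inverse_0_at_top[OF m])
  from tendsto_mult[OF this assms] have "(\<lambda>i. inverse (m i) * (m i * f i)) \<longlonglongrightarrow> 0"
    by simp
  moreover have "\<forall>\<^sub>F i in sequentially. inverse (m i) * (m i * f i) = f i"
    using filterlim_at_top_dense[THEN iffD1, OF m, rule_format, of 0] by eventually_elim simp
  ultimately show ?thesis
    by (rule Lim_transform_eventually)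
qed

text \<open>With \<open>k = n - 4\<close> this treats the factor m + n - 4 in the values of the Weyl
  tractor on two vectors.\<close>

lemma lim_shift:
  assumes "(\<lambda>i. m i * f i) \<longlonglongrightarrow> l"
  shows "(\<lambda>i. (m i + k) * f i) \<longlonglongrightarrow> l"
  using tendsto_add[OF assms tendsto_mult[OF tendsto_const[of k] lim_zero[OF assms]]]
  by (simp add: distrib_right)

abbreviation P_seq where "P_seq i \<equiv> schouten (a i) (b i) (c i)"

lemma lim_P: "(\<lambda>i. m i * P_seq i p x y) \<longlonglongrightarrow> Ric p x y + 1/4 * ip g p x y"
proof -
  have "(\<lambda>i. (m i * a i) * Ric p x y + (m i * b i + m i * c i * scal g p) * ip g p x y)
      \<longlonglongrightarrow> 1 * Ric p x y + (1/4 + 0 * scal g p) * ip g p x y"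
    by (intro tendsto_intros ma mb mc)
  then show ?thesis
    by (simp add: schouten_def algebra_simps)
qed

text \<open>\<open>P_seq\<close> tends to 0, so the Kulkarni-Nomizu correction disappears in the
  limit.\<close>

lemma lim_A: "(\<lambda>i. tractor_connection.A g (P_seq i) p x y z w) \<longlonglongrightarrow> Rm p x y z w"
proof -
  have "(\<lambda>i. Rm p x y z w - (P_seq i p x z * ip g p y w + P_seq i p y w * ip g p x z
      - P_seq i p x w * ip g p y z - P_seq i p y z * ip g p x w)) \<longlonglongrightarrow> Rm p x y z w - (0 * ip g p y w + 0 * ip g p x z
      - 0 * ip g p y z - 0 * ip g p x w)"
    by (intro tendsto_intros lim_zero[OF lim_P])
  then show ?thesis
    by (simp add: tractor_connection.A_def[OF schouten_tractor])
qed

lemma lim_cov2: "p \<in> S \<Longrightarrow> (\<lambda>i. m i * cov2 g (P_seq i) p x y z) \<longlonglongrightarrow> cov2 g Ric p x y z"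
proof -
  have "(\<lambda>i. (m i * a i) * cov2 g Ric p x y z + (m i * c i) * (\<partial> (scal g) p x * ip g p y z))
      \<longlonglongrightarrow> 1 * cov2 g Ric p x y z + 0 * (\<partial> (scal g) p x * ip g p y z)"
    by (intro tendsto_intros ma mc)
  then show "p \<in> S \<Longrightarrow> ?thesis"
    by (simp add: cov2_schouten algebra_simps)
qed

lemma lim_cov3: "p \<in> S \<Longrightarrow> (\<lambda>i. m i * cov3 g (cov2 g (P_seq i)) p x y z w) \<longlonglongrightarrow> cov3 g (cov2 g Ric) p x y z w"
proof -
  have "(\<lambda>i. (m i * a i) * cov3 g (cov2 g Ric) p x y z w + (m i * c i) * (hess g (scal g) p x y * ip g p z w))
      \<longlonglongrightarrow> 1 * cov3 g (cov2 g Ric) p x y z w + 0 * (hess g (scal g) p x y * ip g p z w)"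
    by (intro tendsto_intros ma mc)
  then show "p \<in> S \<Longrightarrow> ?thesis"
    by (simp add: cov3_cov2_schouten algebra_simps)
qed

lemma lim_dP:
  assumes p: "p \<in> S"
  shows "(\<lambda>i. m i * tractor_connection.dP g (P_seq i) p x y z) \<longlonglongrightarrow> d_ricci g p x y z"
  using tendsto_diff[OF lim_cov2[OF p, of x y z] lim_cov2[OF p, of y x z]]
  by (simp add: tractor_connection.dP_def[OF schouten_tractor] d_ricci_def right_diff_distrib)

text \<open>The outer factor \<open>m\<close> is given to exactly one factor of each product: to
  \<open>P_seq\<close> next to \<open>A\<close>, and to the bracket next to
  \<open>m i * \<rho> i\<close>. In that bracket the limits g/4 and -g/4 cancel, leaving
  Ric/4.\<close>

lemma lim_YY:
  assumes p: "p \<in> S"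
  shows "(\<lambda>i. m i * (contract g p (\<lambda>e f. cov3 g (cov2 g (P_seq i)) p e f x z - cov3 g (cov2 g (P_seq i)) p e x f z)
      + contract g p (\<lambda>e f. contract g p (\<lambda>u u'. tractor_connection.A g (P_seq i) p f x u z * P_seq i p e u'))
      - m i * \<rho> i * (P_seq i p x z + \<rho> i * ip g p x z))) \<longlonglongrightarrow> B_tensor g p x z"
proof -
  have lim: "(\<lambda>i. contract g p (\<lambda>e f. m i * cov3 g (cov2 g (P_seq i)) p e f x z - m i * cov3 g (cov2 g (P_seq i)) p e x f z)
      + contract g p (\<lambda>e f. contract g p (\<lambda>u u'. tractor_connection.A g (P_seq i) p f x u z * (m i * P_seq i p e u')))
      - m i * \<rho> i * (m i * P_seq i p x z + m i * \<rho> i * ip g p x z)) \<longlonglongrightarrow>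
      contract g p (\<lambda>e f. cov3 g (cov2 g Ric) p e f x z - cov3 g (cov2 g Ric) p e x f z)
      + contract g p (\<lambda>e f. contract g p (\<lambda>u u'. Rm p f x u z * (Ric p e u' + 1/4 * ip g p e u')))
      - (- 1/4) * (Ric p x z + 1/4 * ip g p x z + (- 1/4) * ip g p x z)"
    by (intro tendsto_intros tendsto_contract lim_cov3 lim_A lim_P m\<rho> p)
  \<comment> \<open>Tracing Rm against the metric part g/4 yields Ric/4, the other half of the term
    Ric/2 in B.\<close>
  have trace: "contract g p (\<lambda>e f. contract g p (\<lambda>u u'. Rm p f x u z * (Ric p e u' + 1/4 * ip g p e u'))) =
      riem_pair g Ric p x z + 1/4 * Ric p x z"
  proof -
    have l: "linear (\<lambda>u. Rm p f x u z)" for f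
      by (rule linearI) (simp_all add: Rm_simps[OF p])
    have "contract g p (\<lambda>e f. contract g p (\<lambda>u u'. Rm p f x u z * (Ric p e u' + 1/4 * ip g p e u'))) =
        contract g p (\<lambda>e f. contract g p (\<lambda>u u'. Rm p f x u z * Ric p e u') + 1/4 * contract g p (\<lambda>u u'. Rm p f x u z * ip g p e u'))"
      unfolding contract_cmult[symmetric] contract_add[symmetric] by (simp add: algebra_simps)
    also have "\<dots> = contract g p (\<lambda>f e. contract g p (\<lambda>u u'. Rm p f x u z * Ric p e u') + 1/4 * Rm p f x e z)"
      by (subst contract_flip[OF p, symmetric]) (simp add: contract_ip(1)[OF p l])
    finally show ?thesis
      unfolding contract_add contract_cmult by (simp add: riem_pair_def ricci_def)
  qed
  have "contract g p (\<lambda>e f. m i * cov3 g (cov2 g (P_seq i)) p e f x z - m i * cov3 g (cov2 g (P_seq i)) p e x f z) =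
      m i * contract g p (\<lambda>e f. cov3 g (cov2 g (P_seq i)) p e f x z - cov3 g (cov2 g (P_seq i)) p e x f z)" for i
    by (simp only: right_diff_distrib[symmetric] contract_cmult)
  moreover have "contract g p (\<lambda>e f. contract g p (\<lambda>u u'. tractor_connection.A g (P_seq i) p f x u z * (m i * P_seq i p e u'))) =
      m i * contract g p (\<lambda>e f. contract g p (\<lambda>u u'. tractor_connection.A g (P_seq i) p f x u z * P_seq i p e u'))" for i
    by (simp only: mult.left_commute[of _ "m i"] contract_cmult)
  moreover have "B_tensor g p x z = contract g p (\<lambda>e f. cov3 g (cov2 g Ric) p e f x z - cov3 g (cov2 g Ric) p e x f z)
      + (riem_pair g Ric p x z + 1/4 * Ric p x z)
      - (- 1/4) * (Ric p x z + 1/4 * ip g p x z + (- 1/4) * ip g p x z)"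
    by (simp add: div_d_ricci[OF p] B_tensor_def)
  ultimately show ?thesis
    using lim unfolding trace by (simp add: distrib_left right_diff_distrib mult_ac)
qed

text \<open>This part carries no factor \<open>m\<close>, so every term containing a derivative of
  \<open>P_seq\<close> tends to 0 and only the divergence of the curvature remains.\<close>

lemma lim_YZ:
  assumes p: "p \<in> S"
  shows "(\<lambda>i. - d_ricci g p z w x
      + contract g p (\<lambda>e f. cov2 g (P_seq i) p e f z * ip g p x w + cov2 g (P_seq i) p e x w * ip g p f z
       - cov2 g (P_seq i) p e f w * ip g p x z - cov2 g (P_seq i) p e x z * ip g p f w
       + ip g p z e * tractor_connection.dP g (P_seq i) p f x w
       - ip g p w e * tractor_connection.dP g (P_seq i) p f x z)) \<longlonglongrightarrow> - d_ricci g p z w x"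
proof -
  have "(\<lambda>i. - d_ricci g p z w x
      + contract g p (\<lambda>e f. cov2 g (P_seq i) p e f z * ip g p x w + cov2 g (P_seq i) p e x w * ip g p f z
       - cov2 g (P_seq i) p e f w * ip g p x z - cov2 g (P_seq i) p e x z * ip g p f w
       + ip g p z e * tractor_connection.dP g (P_seq i) p f x w
       - ip g p w e * tractor_connection.dP g (P_seq i) p f x z)) \<longlonglongrightarrow> - d_ricci g p z w x
      + contract g p (\<lambda>e f. 0 * ip g p x w + 0 * ip g p f z - 0 * ip g p x z - 0 * ip g p f w
       + ip g p z e * 0 - ip g p w e * 0)"
    by (intro tendsto_intros tendsto_contract lim_zero[OF lim_cov2] lim_zero[OF lim_dP] p)
  then show ?thesis by (simp add: contract_zero)
qed

end

text \<open>Each product with \<open>m\<close> is rewritten as a polynomial in ratios m/(m+k),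
  tending to 1, and 1/(m+k), tending to 0. The number \<open>s\<close> stands for the scalar
  curvature at the point considered, which does not vary with \<open>m\<close>.\<close>

lemma (in local_metric) schouten_limitI:
  fixes m :: "nat \<Rightarrow> real" and s :: real
  defines "n \<equiv> real CARD('n)"
  assumes m: "filterlim m at_top sequentially"
  shows "schouten_limit S g m (\<lambda>i. 1 / (m i + n - 2))
    (\<lambda>i. - m i * (- 1/2) / (2 * (m i + n - 1) * (m i + n - 2)))
    (\<lambda>i. - 1 / (2 * (m i + n - 1) * (m i + n - 2)))
    (\<lambda>i. (- 1/2 * (m i + 2 * n - 2) - s) / (2 * (m i + n - 1) * (m i + n - 2)))"
proof unfold_locales
  have shift: "filterlim (\<lambda>i. m i + k) at_top sequentially" for k
    using filterlim_tendsto_add_at_top[OF tendsto_const[of k] m] by (simp add: add.commute)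
  have 0: "(\<lambda>i. 1 / (m i + k)) \<longlonglongrightarrow> 0" for k
    using tendsto_inverse_0_at_top[OF shift[of k]] by (simp add: inverse_eq_divide)
  have 1: "(\<lambda>i. m i / (m i + k)) \<longlonglongrightarrow> 1" for k
  proof (rule Lim_transform_eventually)
    show "(\<lambda>i. 1 - k * (1 / (m i + k))) \<longlonglongrightarrow> 1"
      using tendsto_diff[OF tendsto_const[of 1] tendsto_mult[OF tendsto_const[of k] 0[of k]]] by simp
    show "\<forall>\<^sub>F i in sequentially. 1 - k * (1 / (m i + k)) = m i / (m i + k)"
      using filterlim_at_top_dense[THEN iffD1, OF shift[of k], rule_format, of 0]
      by eventually_elim (simp add: field_simps)
  qed
  define d where "d i = m i + (n - 1)" for i
  define e where "e i = m i + (n - 2)" for i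
  have de: "m i + n - 1 = d i" "m i + n - 2 = e i" for i
    by (simp_all add: d_def e_def)
  have l: "(\<lambda>i. m i / d i) \<longlonglongrightarrow> 1" "(\<lambda>i. m i / e i) \<longlonglongrightarrow> 1" "(\<lambda>i. 1 / e i) \<longlonglongrightarrow> 0"
    unfolding d_def e_def by (rule 1 0)+
  show "filterlim m at_top sequentially" by (rule m)
  show "(\<lambda>i. m i * (1 / (m i + n - 2))) \<longlonglongrightarrow> 1"
    unfolding de using l(2) by simp
  have "x * (- x * (- 1/2) / (2 * y * z)) = 1/4 * (x / y) * (x / z)" for x y z :: real
    by simp
  moreover have "(\<lambda>i. 1/4 * (m i / d i) * (m i / e i)) \<longlonglongrightarrow> 1/4 * 1 * 1"
    by (intro tendsto_mult tendsto_const l)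
  ultimately show "(\<lambda>i. m i * (- m i * (- 1/2) / (2 * (m i + n - 1) * (m i + n - 2)))) \<longlonglongrightarrow> 1/4"
    unfolding de by (simp only: mult_1_right)
  have "x * (- 1 / (2 * y * z)) = - 1/2 * (x / y) * (1 / z)" for x y z :: real
    by simp
  moreover have "(\<lambda>i. - 1/2 * (m i / d i) * (1 / e i)) \<longlonglongrightarrow> - 1/2 * 1 * 0"
    by (intro tendsto_mult tendsto_const l)
  ultimately show "(\<lambda>i. m i * (- 1 / (2 * (m i + n - 1) * (m i + n - 2)))) \<longlonglongrightarrow> 0"
    unfolding de by (simp only: mult_zero_right)
  have "x * ((- 1/2 * (x + 2 * n - 2) - s) / (2 * y * z)) =
      1/2 * (x / y) * (- 1/2 * (x / z) + (- (n - 1) - s) * (1 / z))" for x y z :: real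
    by (cases "y = 0"; cases "z = 0") (simp_all add: field_simps)
  moreover have "(\<lambda>i. 1/2 * (m i / d i) * (- 1/2 * (m i / e i) + (- (n - 1) - s) * (1 / e i)))
      \<longlonglongrightarrow> 1/2 * 1 * (- 1/2 * 1 + (- (n - 1) - s) * 0)"
    by (intro tendsto_mult tendsto_add tendsto_const l)
  ultimately show "(\<lambda>i. m i * ((- 1/2 * (m i + 2 * n - 2) - s) / (2 * (m i + n - 1) * (m i + n - 2)))) \<longlonglongrightarrow> - 1/4"
    unfolding de by simp
qed

section \<open>Coordinate form of the pairings, and the limit inequality\<close>

lemma (in local_metric) d_ricci_linear: "p \<in> S \<Longrightarrow> linear (d_ricci g p x y)"
  using smooth_formD(1)[OF cov2_smooth(3)[OF Ric_smooth]] unfolding d_ricci_def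
  by (intro linear_compose_sub) 

lemma (in local_metric) d_ricci_pair_eq:
  assumes p: "p \<in> S" and \<alpha>: "linear \<alpha>"
  shows "d_ricci_pair g p \<Phi> \<alpha> =
    1/2 * (\<Sum>k\<in>UNIV. \<Sum>l\<in>UNIV. raise2 g p \<Phi> k l * d_ricci g p (axis k 1) (axis l 1) (sharp g p \<alpha>))"
proof -
  have "linear (\<lambda>c. d_ricci g p a b c * t)" for a b t
    using linear_compose_scale_right[OF d_ricci_linear[OF p], of t a b] by (simp add: mult.commute)
  then have "contract g p (\<lambda>c c'. d_ricci g p a b c * t * \<alpha> c') = d_ricci g p a b (sharp g p \<alpha>) * t" for a b t
    by (rule contract_sharp[OF p _ \<alpha>])
  then show ?thesis
    by (simp add: d_ricci_pair_def contract_raise2)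
qed

lemma riem_two_forms_eq:
  "riem_two_forms g p \<Phi> \<Phi> = 1/4 * (\<Sum>k\<in>UNIV. \<Sum>l\<in>UNIV. \<Sum>i\<in>UNIV. \<Sum>j\<in>UNIV.
     raise2 g p \<Phi> k l * raise2 g p \<Phi> i j * riem g p (axis k 1) (axis l 1) (axis i 1) (axis j 1))"
proof -
  have "contract g p (\<lambda>c c'. contract g p (\<lambda>d d'. riem g p a b c d * \<Phi> a' b' * \<Phi> c' d')) =
      (\<Sum>i\<in>UNIV. \<Sum>j\<in>UNIV. raise2 g p \<Phi> i j * riem g p a b (axis i 1) (axis j 1)) * \<Phi> a' b'" for a b a' b'
    unfolding contract_raise2[where F = "\<lambda>c d. riem g p a b c d * \<Phi> a' b'"]
    by (simp add: sum_distrib_right mult.assoc)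
  then show ?thesis
    by (simp add: riem_two_forms_def contract_raise2 sum_distrib_left mult.assoc)
qed

theorem (in local_metric) weighted_weyl_limit_nonneg:
  fixes m :: "nat \<Rightarrow> real" and \<alpha> :: "real^'n \<Rightarrow> real"
  assumes p: "p \<in> S" and n: "CARD('n) \<ge> 2" and m: "filterlim m at_top sequentially"
    and nz: "\<And>i. m i \<notin> {- real CARD('n), 1 - real CARD('n), 2 - real CARD('n)}"
    and nonneg: "\<And>i T. bivector T \<Longrightarrow> 0 \<le> on_bivectors (weighted_weyl g (\<lambda>_. 1) (m i) (- 1/2) p) T T"
    and \<alpha>: "linear \<alpha>" and \<Phi>: "two_form \<Phi>"
  shows "0 \<le> eval_covectors g p (B_tensor g p) \<alpha> \<alpha> - 2 * d_ricci_pair g p \<Phi> \<alpha> + riem_two_forms g p \<Phi> \<Phi>"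
proof -
  define N where "N = real CARD('n)"
  define a where "a i = 1 / (m i + N - 2)" for i
  define b where "b i = - m i * (- 1/2) / (2 * (m i + N - 1) * (m i + N - 2))" for i
  define c where "c i = - 1 / (2 * (m i + N - 1) * (m i + N - 2))" for i
  \<comment> \<open>A function of the point, since the modified tractor is differentiated as a
    field; the limit only involves its value at \<open>p\<close>.\<close>
  define \<rho> where "\<rho> i q = (- 1/2 * (m i + 2 * N - 2) - scal g q) / (2 * (m i + N - 1) * (m i + N - 2))" for i q
  interpret L: schouten_limit S g m a b c "\<lambda>i. \<rho> i p"
    using schouten_limitI[OF m, of "scal g p"] unfolding a_def b_def c_def \<rho>_def N_def .
  have nz': "m i + N - 1 \<noteq> 0" "m i + N - 2 \<noteq> 0" for i
    using nz[of i] by (auto simp: N_def)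
  have P: "P_w g (\<lambda>_. 1) (m i) (- 1/2) = L.P_seq i" for i
    unfolding P_w_eq a_def b_def c_def N_def ..
  have Jt: "tr_Jt g (\<lambda>_. 1) (m i) (- 1/2) = (\<lambda>q. (1, 0, \<rho> i q))" for i
    unfolding \<rho>_def N_def by (rule tr_Jt_eq) (use n nz'[of i] in \<open>auto simp: N_def\<close>)
  define W where "W i = weighted_weyl g (\<lambda>_. 1) (m i) (- 1/2) p" for i
  note val = weighted_weyl_schouten_values[OF p P, folded W_def]
  have YY: "(\<lambda>i. m i * W i tr_Y (tr_Z x) tr_Y (tr_Z z)) \<longlonglongrightarrow> B_tensor g p x z" for x z
    unfolding val(1) weyl_YZ_schouten(1)[OF p P Jt] by (rule L.lim_YY[OF p])
  have YZ: "(\<lambda>i. W i tr_Y (tr_Z x) (tr_Z z) (tr_Z w)) \<longlonglongrightarrow> - d_ricci g p z w x" for x z w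
    unfolding val(1) weyl_YZ_schouten(2)[OF p P Jt] by (rule L.lim_YZ[OF p])
  have ZY: "(\<lambda>i. W i (tr_Z x) (tr_Z y) tr_Y (tr_Z z)) \<longlonglongrightarrow> - d_ricci g p x y z" for x y z
    unfolding val(3) using tendsto_minus[OF L.lim_shift[OF L.lim_dP[OF p], of "N - 4" x y z]]
    by (simp add: N_def add_diff_eq)
  \<comment> \<open>\<open>lim_shift\<close> applied to the sequence 1/m gives (m + n - 4)/m tending
    to 1.\<close>
  have ZZ: "(\<lambda>i. W i (tr_Z x) (tr_Z y) (tr_Z z) (tr_Z w) / m i) \<longlonglongrightarrow> Rm p x y z w" for x y z w
  proof -
    have "\<forall>\<^sub>F i in sequentially. m i * (1 / m i) = 1"
      using filterlim_at_top_dense[THEN iffD1, OF m, rule_format, of 0] by eventually_elim simp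
    then have "(\<lambda>i. m i * (1 / m i)) \<longlonglongrightarrow> 1"
      by (rule tendsto_eventually)
    from tendsto_mult[OF L.lim_shift[OF this, of "N - 4"] L.lim_A[of p x y z w]]
    show ?thesis
      unfolding val(2) by (simp add: N_def add_diff_eq)
  qed
  define u where "u = sharp g p \<alpha>"
  define \<Psi> where "\<Psi> = raise2 g p \<Phi>"
  let ?e = "\<lambda>k. axis k (1::real) :: real^'n"
  \<comment> \<open>The quadratic form on \<open>tbiv (m i) u \<Psi>\<close> divided by
    \<open>m i\<close>, with the powers of \<open>m i\<close> moved to the values whose limits are
    known.\<close>
  let ?Q = "\<lambda>i. (\<Sum>k\<in>UNIV. \<Sum>l\<in>UNIV. u $ k * u $ l * (m i * W i tr_Y (tr_Z (?e k)) tr_Y (tr_Z (?e l))))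
    + 1/2 * (\<Sum>j\<in>UNIV. \<Sum>k\<in>UNIV. \<Sum>l\<in>UNIV. u $ j * \<Psi> k l *
        (W i tr_Y (tr_Z (?e j)) (tr_Z (?e k)) (tr_Z (?e l)) + W i (tr_Z (?e k)) (tr_Z (?e l)) tr_Y (tr_Z (?e j))))
    + 1/4 * (\<Sum>k\<in>UNIV. \<Sum>l\<in>UNIV. \<Sum>r\<in>UNIV. \<Sum>s\<in>UNIV. \<Psi> k l * \<Psi> r s *
        (W i (tr_Z (?e k)) (tr_Z (?e l)) (tr_Z (?e r)) (tr_Z (?e s)) / m i))"
  have "?Q \<longlonglongrightarrow> (\<Sum>k\<in>UNIV. \<Sum>l\<in>UNIV. u $ k * u $ l * B_tensor g p (?e k) (?e l))
    + 1/2 * (\<Sum>j\<in>UNIV. \<Sum>k\<in>UNIV. \<Sum>l\<in>UNIV. u $ j * \<Psi> k l *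
        (- d_ricci g p (?e k) (?e l) (?e j) + - d_ricci g p (?e k) (?e l) (?e j)))
    + 1/4 * (\<Sum>k\<in>UNIV. \<Sum>l\<in>UNIV. \<Sum>r\<in>UNIV. \<Sum>s\<in>UNIV. \<Psi> k l * \<Psi> r s * Rm p (?e k) (?e l) (?e r) (?e s))"
    (is "_ \<longlonglongrightarrow> ?L1 + 1/2 * ?L2 + ?L3")
    by (intro tendsto_add tendsto_sum tendsto_mult tendsto_const YY YZ ZY ZZ)
  \<comment> \<open>Nonnegativity survives the division only when \<open>m i\<close> is positive,
    which holds eventually.\<close>
  moreover have "\<forall>\<^sub>F i in sequentially. 0 \<le> ?Q i"
    using filterlim_at_top_dense[THEN iffD1, OF m, rule_format, of 0]
  proof eventually_elim
    fix i assume "0 < m i"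
    have "bivector (tbiv (m i) u \<Psi>)"
      unfolding \<Psi>_def by (rule bivector_tbiv, rule raise2_skew) (use \<Phi> in \<open>unfold two_form_def, blast\<close>)
    then have "0 \<le> on_bivectors (W i) (tbiv (m i) u \<Psi>) (tbiv (m i) u \<Psi>) / m i"
      using nonneg \<open>0 < m i\<close> by (simp add: W_def)
    also have "\<dots> = ?Q i"
    proof -
      have *: "((m i)\<^sup>2 * x + m i / 2 * y + 1 / 4 * z) / m i = m i * x + 1/2 * y + 1/4 * (z / m i)" for x y z
        using \<open>0 < m i\<close> by (simp add: field_simps power2_eq_square)
      show ?thesis
        unfolding on_bivectors_tbiv[OF weighted_weyl_skew[OF p P Jt, folded W_def]] *
        by (simp only: sum_distrib_left[of "m i"] sum_divide_distrib[of _ _ "m i"] mult.left_commute[of "m i"]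
            times_divide_eq_right)
    qed
    finally show "0 \<le> ?Q i" .
  qed
  ultimately have "0 \<le> ?L1 + 1/2 * ?L2 + ?L3"
    by (rule tendsto_lowerbound) simp
  moreover have "?L1 = eval_covectors g p (B_tensor g p) \<alpha> \<alpha>"
  proof -
    have l: "linear (\<lambda>x. B_tensor g p x y)" "linear (B_tensor g p y)" for y
      using B_tensor_bilinear[OF p] by (auto simp: bilinear_def)
    have "B_tensor g p u u = (\<Sum>k\<in>UNIV. u $ k * (\<Sum>l\<in>UNIV. u $ l * B_tensor g p (?e k) (?e l)))"
      using linear_expand_axis[OF l(1), of u u] linear_expand_axis[OF l(2), of _ u] by simp
    then show ?thesis
      by (simp add: eval_covectors_def u_def sum_distrib_left mult.assoc)
  qed
  moreover have "1/2 * ?L2 = - 2 * d_ricci_pair g p \<Phi> \<alpha>"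
  proof -
    have "?L2 = - 2 * (\<Sum>j\<in>UNIV. \<Sum>k\<in>UNIV. \<Sum>l\<in>UNIV. \<Psi> k l * (u $ j * d_ricci g p (?e k) (?e l) (?e j)))"
      by (simp add: sum_distrib_left sum_negf mult_ac)
    also have "(\<Sum>j\<in>UNIV. \<Sum>k\<in>UNIV. \<Sum>l\<in>UNIV. \<Psi> k l * (u $ j * d_ricci g p (?e k) (?e l) (?e j))) =
        (\<Sum>k\<in>UNIV. \<Sum>j\<in>UNIV. \<Sum>l\<in>UNIV. \<Psi> k l * (u $ j * d_ricci g p (?e k) (?e l) (?e j)))"
      by (rule sum.swap)
    also have "\<dots> = (\<Sum>k\<in>UNIV. \<Sum>l\<in>UNIV. \<Sum>j\<in>UNIV. \<Psi> k l * (u $ j * d_ricci g p (?e k) (?e l) (?e j)))"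
      by (intro sum.cong refl sum.swap)
    also have "\<dots> = (\<Sum>k\<in>UNIV. \<Sum>l\<in>UNIV. \<Psi> k l * d_ricci g p (?e k) (?e l) u)"
      by (simp add: linear_expand_axis[OF d_ricci_linear[OF p], of _ _ u] sum_distrib_left)
    finally show ?thesis
      by (simp add: d_ricci_pair_eq[OF p \<alpha>] \<Psi>_def u_def)
  qed
  moreover have "?L3 = riem_two_forms g p \<Phi> \<Phi>"
    by (simp add: riem_two_forms_eq \<Psi>_def)
  ultimately show ?thesis by simp
qed

theorem theorem6p1:
  fixes M :: "'a topology" and \<A> :: "('a, 'n::finite) chart set"
    and g :: "('a, 'n) chart \<Rightarrow> 'n metric" and m :: "nat \<Rightarrow> real"
    and \<alpha> :: "real^'n \<Rightarrow> real" and \<Phi> :: "real^'n \<Rightarrow> real^'n \<Rightarrow> real"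
  assumes "CARD('n) \<ge> 2"
    and "riemannian_manifold M \<A> g"
    and "filterlim m at_top sequentially"
    and "\<And>i. smooth_metric_measure_space M \<A> g (\<lambda>_. 1) (m i)"
    and "\<And>i. weighted_weyl_nonneg \<A> g (\<lambda>_. 1) (m i) (- 1/2)"
    and "(U, \<xi>) \<in> \<A>" and "p \<in> \<xi> ` U"
    and "linear \<alpha>" and "two_form \<Phi>"
  shows "eval_covectors (g (U, \<xi>)) p (B_tensor (g (U, \<xi>)) p) \<alpha> \<alpha>
         - 2 * d_ricci_pair (g (U, \<xi>)) p \<Phi> \<alpha>
         + riem_two_forms (g (U, \<xi>)) p \<Phi> \<Phi> \<ge> 0"
proof -
  \<comment> \<open>The statement concerns one point in one chart, so the data of that chart alone
    yield the local setting.\<close>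
  have "open (\<xi> ` U)"
    using assms(2,6) by (auto simp: riemannian_manifold_def smooth_atlas_def)
  moreover have "smooth_on (\<xi> ` U) (g (U, \<xi>))"
    "\<And>q x y. q \<in> \<xi> ` U \<Longrightarrow> ip (g (U, \<xi>)) q x y = ip (g (U, \<xi>)) q y x"
    "\<And>q x. q \<in> \<xi> ` U \<Longrightarrow> x \<noteq> 0 \<Longrightarrow> 0 < ip (g (U, \<xi>)) q x x"
    using assms(2,6) unfolding riemannian_manifold_def by fast+
  ultimately interpret local_metric "\<xi> ` U" "g (U, \<xi>)"
    by unfold_locales
  show ?thesis
  proof (rule weighted_weyl_limit_nonneg[OF assms(7,1,3) _ _ assms(8,9)])
    show "m i \<notin> {- real CARD('n), 1 - real CARD('n), 2 - real CARD('n)}" for i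
      using assms(4)[of i] by (simp add: smooth_metric_measure_space_def)
    have "(\<lambda>_. 1) \<circ> inv_into U \<xi> = (\<lambda>_. 1 :: real)"
      by (simp add: comp_def)
    then show "0 \<le> on_bivectors (weighted_weyl (g (U, \<xi>)) (\<lambda>_. 1) (m i) (- 1/2) p) T T"
      if "bivector T" for i T
      using assms(5)[of i] assms(6,7) that unfolding weighted_weyl_nonneg_def by fastforce
  qed
qed

end
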